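(* There is a deterministic algorithm which, given two finite solvable groups $G$ and $H$ of the same order $n$, each specified by its multiplication table, decides whether $G \cong H$ in time $n^{(1/2)\log_p n + O(\log n/\log\log n)}$, where $p$ is the smallest prime dividing $n$.
   Context: A finite group is solvable if it has a subnormal series $1 = G_0 \triangleleft G_1 \triangleleft \cdots \triangleleft G_m = G$ all of whose factors $G_{i+1}/G_i$ are abelian. A group of order $n$ is given by its $n \times n$ multiplication table; running time is measured as a function of $n$. *)

theory Defs
  imports
    Complex_Main
    "HOL-Library.Landau_Symbols"
    "HOL-Library.Discrete_Functions"
    "HOL-Computational_Algebra.Primes"
    "HOL-Algebra.Solvable_Groups"
begin

section \<open>Random access machines with logarithmic cost\<close>

text \<open>
  Deterministic random access machines in the sense of Cook and Reckhow: finitely many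
  instructions, an unbounded memory of registers holding natural numbers (initially all zero)
  and a read-only input \<open>xs\<close>.  With \<open>m\<close> the memory, the instructions mean
  \<^item> \<open>Const i c\<close>: \<open>m[i] := c\<close>
  \<^item> \<open>Add i j k\<close>: \<open>m[i] := m[j] + m[k]\<close>
  \<^item> \<open>Sub i j k\<close>: \<open>m[i] := m[j] - m[k]\<close> (truncated at zero)
  \<^item> \<open>Load i j\<close>: \<open>m[i] := m[m[j]]\<close>
  \<^item> \<open>Store i j\<close>: \<open>m[m[i]] := m[j]\<close>
  \<^item> \<open>Read i j\<close>: \<open>m[i] := xs[m[j]]\<close> (zero beyond the end of the input)
  \<^item> \<open>JumpZ i a\<close>: continue at instruction \<open>a\<close> if \<open>m[i] = 0\<close>

  A machine halts when the program counter leaves the program; its output is register 0.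
\<close>

datatype instr =
    Const nat nat
  | Add nat nat nat
  | Sub nat nat nat
  | Load nat nat
  | Store nat nat
  | Read nat nat
  | JumpZ nat nat

type_synonym ram = "instr list"

type_synonym config = "nat \<times> (nat \<Rightarrow> nat)"

definition input_at :: "nat list \<Rightarrow> nat \<Rightarrow> nat" where
  "input_at xs k = (if k < length xs then xs ! k else 0)"

fun exec_instr :: "nat list \<Rightarrow> instr \<Rightarrow> config \<Rightarrow> config" where
  "exec_instr xs (Const i c) (pc, m) = (Suc pc, m(i := c))"
| "exec_instr xs (Add i j k) (pc, m) = (Suc pc, m(i := m j + m k))"
| "exec_instr xs (Sub i j k) (pc, m) = (Suc pc, m(i := m j - m k))"
| "exec_instr xs (Load i j) (pc, m) = (Suc pc, m(i := m (m j)))"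
| "exec_instr xs (Store i j) (pc, m) = (Suc pc, m(m i := m j))"
| "exec_instr xs (Read i j) (pc, m) = (Suc pc, m(i := input_at xs (m j)))"
| "exec_instr xs (JumpZ i a) (pc, m) = (if m i = 0 then a else Suc pc, m)"

text \<open>The length of the binary representation, where zero has length one.\<close>

definition bits :: "nat \<Rightarrow> nat" where
  "bits x = Suc (floor_log x)"

text \<open>
  Logarithmic cost criterion: an instruction is charged the bit lengths of all register
  addresses and of all values that it handles.
\<close>

fun instr_cost :: "nat list \<Rightarrow> instr \<Rightarrow> (nat \<Rightarrow> nat) \<Rightarrow> nat" where
  "instr_cost xs (Const i c) m = bits i + bits c"
| "instr_cost xs (Add i j k) m = bits i + bits j + bits k + bits (m j) + bits (m k)"
| "instr_cost xs (Sub i j k) m = bits i + bits j + bits k + bits (m j) + bits (m k)"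
| "instr_cost xs (Load i j) m = bits i + bits j + bits (m j) + bits (m (m j))"
| "instr_cost xs (Store i j) m = bits i + bits j + bits (m i) + bits (m j)"
| "instr_cost xs (Read i j) m = bits i + bits j + bits (m j) + bits (input_at xs (m j))"
| "instr_cost xs (JumpZ i a) m = bits i + bits (m i)"

definition halted :: "ram \<Rightarrow> config \<Rightarrow> bool" where
  "halted P c \<longleftrightarrow> fst c \<ge> length P"

definition step :: "ram \<Rightarrow> nat list \<Rightarrow> config \<Rightarrow> config" where
  "step P xs c = (if halted P c then c else exec_instr xs (P ! fst c) c)"

definition step_cost :: "ram \<Rightarrow> nat list \<Rightarrow> config \<Rightarrow> nat" where
  "step_cost P xs c = (if halted P c then 0 else instr_cost xs (P ! fst c) (snd c))"

definition config_at :: "ram \<Rightarrow> nat list \<Rightarrow> nat \<Rightarrow> config" where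
  "config_at P xs t = (step P xs ^^ t) (0, \<lambda>_. 0)"

text \<open>
  \<open>computes_in_time P xs y T\<close>: on input \<open>xs\<close>, the program \<open>P\<close> halts with output \<open>y\<close>, and the
  whole computation costs exactly \<open>T\<close>.  Since halted configurations do not change and cost
  nothing, \<open>y\<close> and \<open>T\<close> do not depend on the number \<open>t\<close> of steps considered.
\<close>

definition computes_in_time :: "ram \<Rightarrow> nat list \<Rightarrow> nat \<Rightarrow> nat \<Rightarrow> bool" where
  "computes_in_time P xs y T \<longleftrightarrow>
     (\<exists>t. halted P (config_at P xs t) \<and> snd (config_at P xs t) 0 = y \<and>
          T = (\<Sum>s<t. step_cost P xs (config_at P xs s)))"

lemma config_at_halted:
  assumes "halted P (config_at P xs t)"
  shows "config_at P xs (t + k) = config_at P xs t"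
proof (induction k)
  case (Suc k)
  have "config_at P xs (t + Suc k) = step P xs (config_at P xs (t + k))"
    by (simp add: config_at_def)
  with Suc assms show ?case by (simp add: step_def)
qed simp

lemma computes_in_time_deterministic:
  assumes "computes_in_time P xs y T" "computes_in_time P xs y' T'"
  shows "y = y' \<and> T = T'"
proof -
  let ?c = "config_at P xs"
  let ?S = "\<lambda>t. \<Sum>s<t. step_cost P xs (?c s)"
  have stable: "?S (t + k) = ?S t" if "halted P (?c t)" for t k
    using that by (induction k) (simp_all add: config_at_halted step_cost_def)
  obtain t where t: "halted P (?c t)" "snd (?c t) 0 = y" "T = ?S t"
    using assms(1) unfolding computes_in_time_def by blast
  obtain u where u: "halted P (?c u)" "snd (?c u) 0 = y'" "T' = ?S u"
    using assms(2) unfolding computes_in_time_def by blast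
  have "?c t = ?c u \<and> ?S t = ?S u"
  proof (cases "t \<le> u")
    case True
    then obtain k where "u = t + k" using le_Suc_ex by blast
    with config_at_halted[OF t(1), of k] stable[OF t(1), of k] show ?thesis by simp
  next
    case False
    then obtain k where "t = u + k" using le_Suc_ex nat_le_linear by blast
    with config_at_halted[OF u(1), of k] stable[OF u(1), of k] show ?thesis by simp
  qed
  with t u show ?thesis by simp
qed

section \<open>Groups given by multiplication tables\<close>

text \<open>The elements are numbered \<open>0, \<dots>, n - 1\<close>; the table is listed row by row.\<close>

definition mult_table :: "nat \<Rightarrow> nat monoid \<Rightarrow> nat list" where
  "mult_table n G = map (\<lambda>(a, b). a \<otimes>\<^bsub>G\<^esub> b) (List.product [0..<n] [0..<n])"

text \<open>The library predicate \<open>solvable\<close> does not itself require \<open>G\<close> to be a group.\<close>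

definition solvable_group_on :: "nat \<Rightarrow> nat monoid \<Rightarrow> bool" where
  "solvable_group_on n G \<longleftrightarrow> group G \<and> carrier G = {..<n} \<and> solvable G"

definition smallest_prime_divisor :: "nat \<Rightarrow> nat" where
  "smallest_prime_divisor n = (LEAST p. prime p \<and> p dvd n)"

end

theory Submission
  imports Defs
begin

text \<open>
  Bidirectional collision detection.  Let \<open>p\<close> be the smallest prime dividing \<open>n\<close> and let \<open>c\<close> be about
  \<open>1 / 2 * log p n\<close>.  A word over a group determines a listing of the subgroup it generates, and a
  listing of the whole group determines a number, the code of its multiplication table in the order of
  the listing.  Equal codes mean isomorphic groups, and isomorphisms preserve codes.

  Every proper inclusion of subgroups multiplies the order by at least \<open>p\<close>, so adjoining missing
  elements greedily \<open>2 * c\<close> times generates the group.  For all \<open>n ^ c\<close> words of length \<open>c\<close> over \<open>G\<close>,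
  complete the word greedily and store its code.  Over \<open>H\<close>, fix one greedy word of length \<open>c\<close>, run
  through all its \<open>n ^ c\<close> continuations of length \<open>c\<close>, and look their codes up.  If \<open>G\<close> and \<open>H\<close> are
  isomorphic, the preimage of the fixed word is among the words over \<open>G\<close>, and the image of its
  completion is among the continuations over \<open>H\<close>, so a collision occurs.  A code is used directly as a
  memory address, hence every step costs \<open>n ^ O(1)\<close>.
\<close>

section \<open>Structured programs for random access machines\<close>

text \<open>Two quantities shape the proof. The first is \<open>c\<close>. Growth by the factor
  \<open>p\<close> starts only from a nonempty word: the letter chosen for the empty word may be the
  identity, so a greedy word of length \<open>c\<close> that does not generate everything is only
  known to generate a subgroup of order at least \<open>p ^ (c - 1)\<close>. Hence the requirement
  \<open>n \<le> p ^ (2 * (c - 1))\<close>; the least such \<open>c\<close> is at most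
  \<open>1 / 2 * log p n + 2\<close>. The additive 2 and all polynomial factors end up in a constant
  exponent, and a constant lies in O(ln n / ln ln n).

  The second is the size of the numbers. A code has about n^2 log n bits, so the common bound
  \<open>M\<close> on all values is exponential in \<open>n\<close>, while its bit length is
  polynomial. \<open>M\<close> belongs to the analysis alone: it is a parameter of the semantics and
  not of the compiled program, which is therefore a single machine for all inputs. As the machine
  only adds and subtracts, each product is a sum of at most \<open>n\<close> equal terms, and codes
  are built by Horner's scheme.\<close>

text \<open>
  The flag \<open>ok\<close> records that no addition has produced a value above the bound \<open>M\<close> that is a
  parameter of \<open>exec\<close> below; as long as it holds, every instruction costs at most \<open>width M\<close>.
\<close>

record state =
  reg :: "nat \<Rightarrow> nat"
  arr :: "nat \<Rightarrow> nat \<Rightarrow> nat"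
  ok :: bool

definition set_reg :: "nat \<Rightarrow> nat \<Rightarrow> state \<Rightarrow> state" where
  "set_reg r v s = s\<lparr>reg := (reg s)(r := v)\<rparr>"

definition set_arr :: "nat \<Rightarrow> nat \<Rightarrow> nat \<Rightarrow> state \<Rightarrow> state" where
  "set_arr k i v s = s\<lparr>arr := (arr s)(k := (arr s k)(i := v))\<rparr>"

definition check :: "bool \<Rightarrow> state \<Rightarrow> state" where
  "check b s = s\<lparr>ok := ok s \<and> b\<rparr>"

lemma state_simps [simp]:
  "reg (set_reg r v s) x = (if x = r then v else reg s x)"
  "arr (set_reg r v s) = arr s"
  "ok (set_reg r v s) = ok s"
  "reg (set_arr k i v s) = reg s"
  "arr (set_arr k i v s) k' i' = (if k' = k \<and> i' = i then v else arr s k' i')"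
  "ok (set_arr k i v s) = ok s"
  "reg (check b s) = reg s"
  "arr (check b s) = arr s"
  "ok (check b s) = (ok s \<and> b)"
  by (auto simp: set_reg_def set_arr_def check_def)

lemma arr_set_arr_other [simp]: "k' \<noteq> k \<Longrightarrow> arr (set_arr k i v s) k' = arr s k'"
  by (simp add: fun_eq_iff)

text \<open>
  Arguments are registers, except that the second argument of \<open>SetC\<close> is a constant and that \<open>Get\<close>
  and \<open>Put\<close> access entry \<open>reg s i\<close> of array \<open>k\<close>.  \<open>For r l c\<close> runs \<open>c\<close> for \<open>r = 0, \<dots>, reg s l - 1\<close>;
  the number of rounds is fixed on entry, so every program terminates.
\<close>

datatype com =
    SetC nat nat
  | Copy nat nat
  | Inc nat
  | Plus nat nat nat
  | Minus nat nat nat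
  | Equal nat nat nat
  | Get nat nat nat
  | Put nat nat nat
  | Inp nat nat
  | Seq com com (infixr \<open>;;\<close> 60)
  | IfNZ nat com
  | IfZ nat com
  | For nat nat com

text \<open>Only \<open>Inc\<close> and \<open>Plus\<close> need a check: \<open>Minus\<close> and
  \<open>Equal\<close> cannot create large values, and the other commands move values or bring in
  constants and inputs, whose size is bounded by separate assumptions. The check never changes a
  value, so \<open>M\<close> influences \<open>ok\<close> only.\<close>

primrec exec :: "nat list \<Rightarrow> nat \<Rightarrow> com \<Rightarrow> state \<Rightarrow> state" where
  "exec xs M (SetC r c) s = set_reg r c s"
| "exec xs M (Copy r a) s = set_reg r (reg s a) s"
| "exec xs M (Inc r) s = check (Suc (reg s r) \<le> M) (set_reg r (Suc (reg s r)) s)"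
| "exec xs M (Plus r a b) s =
     check (reg s a + reg s b \<le> M) (set_reg r (reg s a + reg s b) s)"
| "exec xs M (Minus r a b) s = set_reg r (reg s a - reg s b) s"
| "exec xs M (Equal r a b) s = set_reg r (if reg s a = reg s b then 1 else 0) s"
| "exec xs M (Get r k i) s = set_reg r (arr s k (reg s i)) s"
| "exec xs M (Put k i r) s = set_arr k (reg s i) (reg s r) s"
| "exec xs M (Inp r i) s = set_reg r (input_at xs (reg s i)) s"
| "exec xs M (Seq c d) s = exec xs M d (exec xs M c s)"
| "exec xs M (IfNZ r c) s = (if reg s r \<noteq> 0 then exec xs M c s else s)"
| "exec xs M (IfZ r c) s = (if reg s r = 0 then exec xs M c s else s)"
| "exec xs M (For r l c) s =
     ((\<lambda>s. set_reg r (Suc (reg s r)) (exec xs M c s)) ^^ reg s l) (set_reg r 0 s)"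

definition iter :: "nat list \<Rightarrow> nat \<Rightarrow> nat \<Rightarrow> com \<Rightarrow> state \<Rightarrow> nat \<Rightarrow> state" where
  "iter xs M r c s i =
     ((\<lambda>s. set_reg r (Suc (reg s r)) (exec xs M c s)) ^^ i) (set_reg r 0 s)"

lemma iter_0 [simp]: "iter xs M r c s 0 = set_reg r 0 s"
  by (simp add: iter_def)

lemma iter_Suc [simp]:
  "iter xs M r c s (Suc i) =
     set_reg r (Suc (reg (iter xs M r c s i) r)) (exec xs M c (iter xs M r c s i))"
  by (simp add: iter_def)

lemma exec_For: "exec xs M (For r l c) s = iter xs M r c s (reg s l)"
  by (simp add: iter_def)

primrec writes :: "com \<Rightarrow> nat set" where
  "writes (SetC r c) = {r}"
| "writes (Copy r a) = {r}"
| "writes (Inc r) = {r}"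
| "writes (Plus r a b) = {r}"
| "writes (Minus r a b) = {r}"
| "writes (Equal r a b) = {r}"
| "writes (Get r k i) = {r}"
| "writes (Put k i r) = {}"
| "writes (Inp r i) = {r}"
| "writes (Seq c d) = writes c \<union> writes d"
| "writes (IfNZ r c) = writes c"
| "writes (IfZ r c) = writes c"
| "writes (For r l c) = insert r (writes c)"

primrec array_writes :: "com \<Rightarrow> nat set" where
  "array_writes (SetC r c) = {}"
| "array_writes (Copy r a) = {}"
| "array_writes (Inc r) = {}"
| "array_writes (Plus r a b) = {}"
| "array_writes (Minus r a b) = {}"
| "array_writes (Equal r a b) = {}"
| "array_writes (Get r k i) = {}"
| "array_writes (Put k i r) = {k}"
| "array_writes (Inp r i) = {}"
| "array_writes (Seq c d) = array_writes c \<union> array_writes d"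
| "array_writes (IfNZ r c) = array_writes c"
| "array_writes (IfZ r c) = array_writes c"
| "array_writes (For r l c) = array_writes c"

lemma exec_frame_reg: "r \<notin> writes c \<Longrightarrow> reg (exec xs M c s) r = reg s r"
proof (induction c arbitrary: s)
  case (For x l c)
  have "reg (iter xs M x c s i) r = reg s r" for i
    using For by (induction i) auto
  then show ?case by (simp add: exec_For del: exec.simps)
qed auto

lemma exec_frame_arr: "k \<notin> array_writes c \<Longrightarrow> arr (exec xs M c s) k = arr s k"
proof (induction c arbitrary: s)
  case (For x l c)
  have "arr (iter xs M x c s i) k = arr s k" for i
    using For by (induction i) auto
  then show ?case by (simp add: exec_For del: exec.simps)
qed auto

text \<open>The flag, once lost, is never regained; so the final state certifies all intermediate
  ones.\<close>

lemma exec_okD: "ok (exec xs M c s) \<Longrightarrow> ok s"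
proof (induction c arbitrary: s)
  case (For x l c)
  have *: "ok (iter xs M x c s i) \<Longrightarrow> ok s" for i
  proof (induction i)
    case (Suc i)
    have "ok (exec xs M c (iter xs M x c s i))" using Suc.prems by simp
    then have "ok (iter xs M x c s i)" by (rule For.IH)
    then show ?case by (rule Suc.IH)
  qed simp
  show ?case by (rule *[of "reg s l"]) (use For.prems in \<open>simp add: exec_For del: exec.simps\<close>)
next
  case (Seq c d)
  from Seq.prems have "ok (exec xs M c s)" by (simp add: Seq.IH(2)[of "exec xs M c s"])
  then show ?case by (rule Seq.IH(1))
next
  case (IfNZ r c)
  then show ?case by (cases "reg s r = 0") simp_all
next
  case (IfZ r c)
  then show ?case by (cases "reg s r = 0") simp_all
qed simp_all

lemma iter_ok_mono: "ok (iter xs M r c s j) \<Longrightarrow> i \<le> j \<Longrightarrow> ok (iter xs M r c s i)"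
  by (induction j) (auto simp: le_Suc_eq dest: exec_okD)

text \<open>Registers below 60 leave the scratch registers to the compiler and the addresses from 64
  on to the arrays; constants up to 64 respect every bound \<open>M \<ge> 64\<close>. A compiled
  loop compares counter and limit anew in every round; it agrees with the fixed number of rounds
  because the body may write neither.\<close>

primrec wf_com :: "com \<Rightarrow> bool" where
  "wf_com (SetC r c) \<longleftrightarrow> r < 60 \<and> c \<le> 64"
| "wf_com (Copy r a) \<longleftrightarrow> r < 60 \<and> a < 60"
| "wf_com (Inc r) \<longleftrightarrow> r < 60"
| "wf_com (Plus r a b) \<longleftrightarrow> r < 60 \<and> a < 60 \<and> b < 60"
| "wf_com (Minus r a b) \<longleftrightarrow> r < 60 \<and> a < 60 \<and> b < 60"
| "wf_com (Equal r a b) \<longleftrightarrow> r < 60 \<and> a < 60 \<and> b < 60"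
| "wf_com (Get r k i) \<longleftrightarrow> r < 60 \<and> k < 4 \<and> i < 60"
| "wf_com (Put k i r) \<longleftrightarrow> k < 4 \<and> i < 60 \<and> r < 60"
| "wf_com (Inp r i) \<longleftrightarrow> r < 60 \<and> i < 60"
| "wf_com (Seq c d) \<longleftrightarrow> wf_com c \<and> wf_com d"
| "wf_com (IfNZ r c) \<longleftrightarrow> r < 60 \<and> wf_com c"
| "wf_com (IfZ r c) \<longleftrightarrow> r < 60 \<and> wf_com c"
| "wf_com (For r l c) \<longleftrightarrow>
     r < 60 \<and> l < 60 \<and> r \<noteq> l \<and> r \<notin> writes c \<and> l \<notin> writes c \<and> wf_com c"

lemma iter_counter: "r \<notin> writes c \<Longrightarrow> reg (iter xs M r c s i) r = i"
  by (induction i) (auto simp: exec_frame_reg)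

lemma iter_frame_reg:
  "x \<notin> writes c \<Longrightarrow> x \<noteq> r \<Longrightarrow> reg (iter xs M r c s i) x = reg s x"
  by (induction i) (auto simp: exec_frame_reg)

lemma iter_frame_arr: "k \<notin> array_writes c \<Longrightarrow> arr (iter xs M r c s i) k = arr s k"
  by (induction i) (auto simp: exec_frame_arr)

text \<open>An upper bound on the number of executed instructions: 5 is the length of the longest
  block for a basic command, and it also covers the tests, the three instructions before a loop body
  and the five after it.\<close>

primrec steps :: "nat list \<Rightarrow> nat \<Rightarrow> com \<Rightarrow> state \<Rightarrow> nat" where
  "steps xs M (SetC r c) s = 5"
| "steps xs M (Copy r a) s = 5"
| "steps xs M (Inc r) s = 5"
| "steps xs M (Plus r a b) s = 5"
| "steps xs M (Minus r a b) s = 5"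
| "steps xs M (Equal r a b) s = 5"
| "steps xs M (Get r k i) s = 5"
| "steps xs M (Put k i r) s = 5"
| "steps xs M (Inp r i) s = 5"
| "steps xs M (Seq c d) s = steps xs M c s + steps xs M d (exec xs M c s)"
| "steps xs M (IfNZ r c) s = 5 + (if reg s r \<noteq> 0 then steps xs M c s else 0)"
| "steps xs M (IfZ r c) s = 5 + (if reg s r = 0 then steps xs M c s else 0)"
| "steps xs M (For r l c) s =
     5 + (\<Sum>i<reg s l. 5 + steps xs M c (iter xs M r c s i))"

text \<open>
  Registers \<open>60\<close> and \<open>61\<close> are scratch space, and entry \<open>i\<close> of array \<open>k\<close> is stored at address
  \<open>64 + 4 * i + k\<close>, so that the four arrays are unbounded and never overlap.
\<close>

primrec compile :: "nat \<Rightarrow> com \<Rightarrow> instr list" where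
  "compile pc (SetC r c) = [Const r c]"
| "compile pc (Copy r a) = [Const 60 0, Add r a 60]"
| "compile pc (Inc r) = [Const 60 1, Add r r 60]"
| "compile pc (Plus r a b) = [Add r a b]"
| "compile pc (Minus r a b) = [Sub r a b]"
| "compile pc (Equal r a b) = [Sub 60 a b, Sub 61 b a, Add 60 60 61, Const 61 1, Sub r 61 60]"
| "compile pc (Get r k i) =
     [Add 60 i i, Add 60 60 60, Const 61 (64 + k), Add 60 60 61, Load r 60]"
| "compile pc (Put k i r) =
     [Add 60 i i, Add 60 60 60, Const 61 (64 + k), Add 60 60 61, Store 60 r]"
| "compile pc (Inp r i) = [Read r i]"
| "compile pc (Seq c d) = compile pc c @ compile (pc + length (compile pc c)) d"
| "compile pc (IfNZ r c) =
     (let cs = compile (pc + 1) c in JumpZ r (pc + 1 + length cs) # cs)"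
| "compile pc (IfZ r c) =
     (let cs = compile (pc + 3) c in
      [Const 60 1, Sub 60 60 r, JumpZ 60 (pc + 3 + length cs)] @ cs)"
| "compile pc (For r l c) =
     (let cs = compile (pc + 3) c in
      [Const r 0, Sub 61 l r, JumpZ 61 (pc + 8 + length cs)] @ cs @
      [Const 60 1, Add r r 60, Sub 61 l r, Sub 61 60 61, JumpZ 61 (pc + 3)])"

section \<open>Correctness and cost of the compiler\<close>

definition runs :: "ram \<Rightarrow> nat list \<Rightarrow> config \<Rightarrow> config \<Rightarrow> nat \<Rightarrow> bool" where
  "runs P xs c c' T \<longleftrightarrow>
     (\<exists>t. (step P xs ^^ t) c = c' \<and> (\<Sum>s<t. step_cost P xs ((step P xs ^^ s) c)) \<le> T)"

lemma runs_refl: "runs P xs c c 0"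
  unfolding runs_def by (rule exI[of _ 0]) simp

lemma runs_trans:
  assumes "runs P xs a b S" "runs P xs b c T"
  shows "runs P xs a c (S + T)"
proof -
  let ?f = "step P xs"
  obtain s where s: "(?f ^^ s) a = b" "(\<Sum>i<s. step_cost P xs ((?f ^^ i) a)) \<le> S"
    using assms(1) unfolding runs_def by blast
  obtain t where t: "(?f ^^ t) b = c" "(\<Sum>i<t. step_cost P xs ((?f ^^ i) b)) \<le> T"
    using assms(2) unfolding runs_def by blast
  have pow: "(?f ^^ (s + i)) a = (?f ^^ i) b" for i
    using s(1) by (simp add: add.commute[of s] funpow_add)
  have "(\<Sum>i<s + t. step_cost P xs ((?f ^^ i) a)) =
      (\<Sum>i<s. step_cost P xs ((?f ^^ i) a)) + (\<Sum>i<t. step_cost P xs ((?f ^^ (s + i)) a))"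
    by (induction t) (simp_all add: add.assoc)
  also have "\<dots> \<le> S + T"
    using s(2) t(2) by (simp add: pow)
  finally show ?thesis
    unfolding runs_def using pow[of t] t(1) by blast
qed

lemma runs_mono: "runs P xs a b S \<Longrightarrow> S \<le> T \<Longrightarrow> runs P xs a b T"
  unfolding runs_def using le_trans by blast

lemma runs_step:
  assumes "pc < length P" "instr_cost xs (P ! pc) m \<le> W"
  shows "runs P xs (pc, m) (exec_instr xs (P ! pc) (pc, m)) W"
  unfolding runs_def using assms
  by (intro exI[of _ 1]) (simp add: step_def step_cost_def halted_def)

definition code_at :: "ram \<Rightarrow> nat \<Rightarrow> instr list \<Rightarrow> bool" where
  "code_at P pc is \<longleftrightarrow> (\<exists>us vs. P = us @ is @ vs \<and> length us = pc)"

lemma code_at_Cons: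
  "code_at P pc (i # is) \<longleftrightarrow> pc < length P \<and> P ! pc = i \<and> code_at P (Suc pc) is"
proof
  assume "code_at P pc (i # is)"
  then obtain us vs where P: "P = us @ (i # is) @ vs" "length us = pc"
    by (auto simp: code_at_def)
  moreover have "P = (us @ [i]) @ is @ vs" "length (us @ [i]) = Suc pc" using P by auto
  ultimately show "pc < length P \<and> P ! pc = i \<and> code_at P (Suc pc) is"
    unfolding code_at_def by (metis append_Cons length_append length_Cons less_add_same_cancel1
      nth_append_length zero_less_Suc add_Suc_right)
next
  assume *: "pc < length P \<and> P ! pc = i \<and> code_at P (Suc pc) is"
  then obtain us vs where P: "P = us @ is @ vs" "length us = Suc pc"
    by (auto simp: code_at_def)
  obtain us' x where us: "us = us' @ [x]"
    using P(2) by (metis length_Suc_conv_rev)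
  then have "x = i" "length us' = pc" using * P by (auto simp: nth_append)
  then show "code_at P pc (i # is)"
    unfolding code_at_def using P us by (intro exI[of _ us'] exI[of _ vs]) simp
qed

lemma code_at_append:
  assumes "code_at P pc (is @ js)"
  shows "code_at P pc is" "code_at P (pc + length is) js"
proof -
  obtain us vs where P: "P = us @ (is @ js) @ vs" "length us = pc"
    using assms by (auto simp: code_at_def)
  then have "P = us @ is @ (js @ vs)" "P = (us @ is) @ js @ vs" by auto
  with P(2) show "code_at P pc is" "code_at P (pc + length is) js"
    unfolding code_at_def by (metis, metis length_append)
qed

definition represents :: "state \<Rightarrow> (nat \<Rightarrow> nat) \<Rightarrow> bool" where
  "represents s m \<longleftrightarrow> (\<forall>a<60. m a = reg s a) \<and> (\<forall>k<4. \<forall>i. m (64 + 4 * i + k) = arr s k i)"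

definition bounded_state :: "nat \<Rightarrow> state \<Rightarrow> bool" where
  "bounded_state M s \<longleftrightarrow> (\<forall>a<60. reg s a \<le> M) \<and> (\<forall>k<4. \<forall>i. arr s k i \<le> M)"

text \<open>An instruction is charged for at most five quantities. None exceeds
  \<open>4 * M + 68\<close>: the largest array address in use is
  \<open>64 + 4 * M + 3\<close>.\<close>

definition width :: "nat \<Rightarrow> nat" where
  "width M = 5 * bits (4 * M + 68)"

lemma bits_mono: "x \<le> y \<Longrightarrow> bits x \<le> bits y"
  unfolding bits_def using floor_log_mono by (simp add: monoD)

text \<open>Jump targets are not restricted because the cost model does not charge them. The
  compiler emits no register number or constant above 67.\<close>

definition small_instr :: "instr \<Rightarrow> bool" where
  "small_instr i = (case i of
       Const a b \<Rightarrow> a \<le> 68 \<and> b \<le> 68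
     | Add a b c \<Rightarrow> a \<le> 68 \<and> b \<le> 68 \<and> c \<le> 68
     | Sub a b c \<Rightarrow> a \<le> 68 \<and> b \<le> 68 \<and> c \<le> 68
     | Load a b \<Rightarrow> a \<le> 68 \<and> b \<le> 68
     | Store a b \<Rightarrow> a \<le> 68 \<and> b \<le> 68
     | Read a b \<Rightarrow> a \<le> 68 \<and> b \<le> 68
     | JumpZ a b \<Rightarrow> a \<le> 68)"

lemma instr_cost_le_width:
  assumes "\<And>a. m a \<le> 4 * M + 68" "\<And>k. input_at xs k \<le> M"
    and "small_instr i"
  shows "instr_cost xs i m \<le> width M"
proof -
  let ?B = "bits (4 * M + 68)"
  have m: "bits (m a) \<le> ?B" for a using assms(1) by (rule bits_mono)
  have c: "bits a \<le> ?B" if "a \<le> 68" for a using that by (intro bits_mono) simp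
  have x: "bits (input_at xs k) \<le> ?B" for k
    using assms(2)[of k] by (intro bits_mono) simp
  show ?thesis
  proof (cases i)
    case (Const a b)
    then show ?thesis using assms(3) c[of a] c[of b] by (simp add: width_def small_instr_def)
  next
    case (Add a b d)
    then show ?thesis using assms(3) c[of a] c[of b] c[of d] m[of b] m[of d]
      by (simp add: width_def small_instr_def)
  next
    case (Sub a b d)
    then show ?thesis using assms(3) c[of a] c[of b] c[of d] m[of b] m[of d]
      by (simp add: width_def small_instr_def)
  next
    case (Load a b)
    then show ?thesis using assms(3) c[of a] c[of b] m[of b] m[of "m b"]
      by (simp add: width_def small_instr_def)
  next
    case (Store a b)
    then show ?thesis using assms(3) c[of a] c[of b] m[of a] m[of b]
      by (simp add: width_def small_instr_def)
  next
    case (Read a b)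
    then show ?thesis using assms(3) c[of a] c[of b] m[of b] x[of "m b"]
      by (simp add: width_def small_instr_def)
  next
    case (JumpZ a b)
    then show ?thesis using assms(3) c[of a] m[of a] by (simp add: width_def small_instr_def)
  qed
qed


lemma rel_update_scratch:
  "represents s m \<Longrightarrow> represents s (m(60 := v))" "represents s m \<Longrightarrow> represents s (m(61 := v))"
  by (auto simp: represents_def)

lemma rel_set_reg: "represents s m \<Longrightarrow> r < 60 \<Longrightarrow> represents (set_reg r v s) (m(r := v))"
  by (auto simp: represents_def)

lemma rel_check [simp]: "represents (check b s) m = represents s m"
  by (simp add: represents_def)

lemma rel_set_arr:
  assumes "represents s m" "k < 4"
  shows "represents (set_arr k i v s) (m(64 + 4 * i + k := v))"
proof -
  \<comment> \<open>An address determines its cell: the remainder modulo 4 is \<open>k\<close>, the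
    quotient is \<open>16 + i\<close>.\<close>
  have "j = i \<and> l = k" if "64 + 4 * j + l = 64 + 4 * i + k" "l < 4" for j l :: nat
    using that assms(2) by presburger
  then show ?thesis using assms unfolding represents_def by auto
qed

lemma rel_reg: "represents s m \<Longrightarrow> a < 60 \<Longrightarrow> m a = reg s a"
  by (simp add: represents_def)

lemma rel_arr: "represents s m \<Longrightarrow> k < 4 \<Longrightarrow> m (64 + 4 * i + k) = arr s k i"
  by (simp add: represents_def)

lemma bounded_set_reg:
  "bounded_state M s \<Longrightarrow> v \<le> M \<Longrightarrow> bounded_state M (set_reg r v s)"
  by (auto simp: bounded_state_def)

lemma bounded_set_arr:
  "bounded_state M s \<Longrightarrow> v \<le> M \<Longrightarrow> bounded_state M (set_arr k i v s)"
  by (auto simp: bounded_state_def)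

lemma bounded_check [simp]: "bounded_state M (check b s) = bounded_state M s"
  by (simp add: bounded_state_def)

locale machine =
  fixes P :: ram and xs :: "nat list" and M :: nat
  assumes M_ge: "64 \<le> M"
    and input_le: "\<And>k. input_at xs k \<le> M"
begin

text \<open>Wider than \<open>bounded_state\<close>, because scratch registers hold array
  addresses.\<close>

abbreviation mem_le :: "(nat \<Rightarrow> nat) \<Rightarrow> bool" where
  "mem_le m \<equiv> (\<forall>a. m a \<le> 4 * M + 68)"

lemma runs_Cons:
  assumes "code_at P pc (i # is)" "mem_le m" "small_instr i"
    and "runs P xs (exec_instr xs i (pc, m)) cf (k * width M)"
  shows "runs P xs (pc, m) cf (Suc k * width M)"
proof -
  have "runs P xs (pc, m) (exec_instr xs i (pc, m)) (width M)"
    using runs_step[of pc P xs m "width M"] assms(1-3) instr_cost_le_width[of m M xs i] input_le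
    unfolding code_at_Cons by auto
  from runs_trans[OF this assms(4)] show ?thesis by simp
qed

lemma runs_weaken: "runs P xs a b (k * width M) \<Longrightarrow> k \<le> k' \<Longrightarrow> runs P xs a b (k' * width M)"
  by (erule runs_mono) simp

lemma runs_0: "runs P xs a a (0 * width M)"
  using runs_refl by simp

lemma runs_jump:
  assumes "code_at P pc [JumpZ r a]" "mem_le m" "r \<le> 68" "pc' = (if m r = 0 then a else pc + 1)"
  shows "runs P xs (pc, m) (pc', m) (1 * width M)"
  using runs_Cons[OF assms(1,2), of _ 0] runs_0 assms(3,4) by (auto simp: small_instr_def)

text \<open>Only the final flag is assumed; by \<open>exec_okD\<close> this covers every
  intermediate state. The memory bound is part of the conclusion so that costs compose.\<close>

definition correct :: "com \<Rightarrow> bool" where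
  "correct c \<longleftrightarrow> (\<forall>pc s m. code_at P pc (compile pc c) \<longrightarrow> represents s m \<longrightarrow> bounded_state M s \<longrightarrow>
     mem_le m \<longrightarrow> ok (exec xs M c s) \<longrightarrow>
     (\<exists>m'. runs P xs (pc, m) (pc + length (compile pc c), m') (steps xs M c s * width M) \<and>
        represents (exec xs M c s) m' \<and> bounded_state M (exec xs M c s) \<and> mem_le m'))"

lemma correctD:
  assumes "correct c" "code_at P pc (compile pc c)" "represents s m" "bounded_state M s" "mem_le m"
    "ok (exec xs M c s)"
  obtains m' where
    "runs P xs (pc, m) (pc + length (compile pc c), m') (steps xs M c s * width M)"
    "represents (exec xs M c s) m'" "bounded_state M (exec xs M c s)" "mem_le m'"
  using assms unfolding correct_def by blast

text \<open>Straight-line code changes the memory independently of its position, so the program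
  counter can be the dummy value 0.\<close>

primrec block :: "instr list \<Rightarrow> (nat \<Rightarrow> nat) \<Rightarrow> (nat \<Rightarrow> nat)" where
  "block [] m = m"
| "block (i # is) m = block is (snd (exec_instr xs i (0, m)))"

primrec safe :: "instr list \<Rightarrow> (nat \<Rightarrow> nat) \<Rightarrow> bool" where
  "safe [] m \<longleftrightarrow> mem_le m"
| "safe (i # is) m \<longleftrightarrow> mem_le m \<and> small_instr i \<and> (\<forall>a b. i \<noteq> JumpZ a b) \<and>
     safe is (snd (exec_instr xs i (0, m)))"

lemma runs_block:
  "code_at P pc is \<Longrightarrow> safe is m \<Longrightarrow>
     runs P xs (pc, m) (pc + length is, block is m) (length is * width M) \<and> mem_le (block is m)"
proof (induction "is" arbitrary: pc m)
  case Nil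
  then show ?case using runs_0 by simp
next
  case (Cons i js)
  have "exec_instr xs i (pc, m) = (Suc pc, snd (exec_instr xs i (0, m)))"
    using Cons.prems(2) by (cases i) auto
  then show ?case
    using Cons.IH[of "Suc pc"] Cons.prems runs_Cons[OF Cons.prems(1), of m _ "length js"]
    by (simp add: code_at_Cons)
qed

text \<open>Reduces each basic command to a computation on memories, without program counters or
  costs.\<close>

lemma correct_block:
  assumes "\<And>pc. compile pc c = cs" "length cs \<le> 5" "\<And>s. steps xs M c s = 5"
    and "\<And>s m. represents s m \<Longrightarrow> bounded_state M s \<Longrightarrow> mem_le m \<Longrightarrow> ok (exec xs M c s) \<Longrightarrow>
      safe cs m \<and> represents (exec xs M c s) (block cs m) \<and> bounded_state M (exec xs M c s)"
  shows "correct c"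
  unfolding correct_def
proof (intro allI impI)
  fix pc s m
  assume *: "code_at P pc (compile pc c)" "represents s m" "bounded_state M s" "mem_le m"
    "ok (exec xs M c s)"
  note a = assms(4)[OF *(2-5)]
  have r: "runs P xs (pc, m) (pc + length cs, block cs m) (length cs * width M)"
    "mem_le (block cs m)"
    using runs_block[of pc "cs" m] * a assms(1) by auto
  have "runs P xs (pc, m) (pc + length cs, block cs m) (5 * width M)"
    using r(1) assms(2) by (rule runs_weaken)
  then show "\<exists>m'. runs P xs (pc, m) (pc + length (compile pc c), m') (steps xs M c s * width M) \<and>
        represents (exec xs M c s) m' \<and> bounded_state M (exec xs M c s) \<and> mem_le m'"
    using a r(2) assms by auto
qed

lemma bounded_reg: "bounded_state M s \<Longrightarrow> a < 60 \<Longrightarrow> reg s a \<le> M"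
  by (simp add: bounded_state_def)

lemma bounded_arr: "bounded_state M s \<Longrightarrow> k < 4 \<Longrightarrow> arr s k i \<le> M"
  by (simp add: bounded_state_def)

lemmas rel_intros = rel_set_reg rel_update_scratch

lemma correct_SetC: "r < 60 \<Longrightarrow> v \<le> 64 \<Longrightarrow> correct (SetC r v)"
  by (rule correct_block[where cs = "[Const r v]"])
     (use M_ge in \<open>auto simp: small_instr_def intro!: rel_intros bounded_set_reg\<close>)

lemma correct_Copy: "r < 60 \<Longrightarrow> a < 60 \<Longrightarrow> correct (Copy r a)"
proof (rule correct_block[where cs = "[Const 60 0, Add r a 60]"], goal_cases)
  case (4 s m)
  have "reg s a \<le> M" "m a = reg s a" using 4 by (auto simp: bounded_reg rel_reg)
  with 4 show ?case
    by (auto simp: small_instr_def intro!: rel_intros bounded_set_reg)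
qed auto

lemma correct_Inc: "r < 60 \<Longrightarrow> correct (Inc r)"
proof (rule correct_block[where cs = "[Const 60 1, Add r r 60]"], goal_cases)
  case (4 s m)
  have "reg s r \<le> M" "m r = reg s r" using 4 by (auto simp: bounded_reg rel_reg)
  with 4 show ?case
    by (auto simp: small_instr_def intro!: rel_intros bounded_set_reg)
qed auto

lemma correct_Plus: "r < 60 \<Longrightarrow> a < 60 \<Longrightarrow> b < 60 \<Longrightarrow> correct (Plus r a b)"
proof (rule correct_block[where cs = "[Add r a b]"], goal_cases)
  case (4 s m)
  have "m a = reg s a" "m b = reg s b" using 4 by (auto simp: rel_reg)
  with 4 show ?case
    by (auto simp: small_instr_def intro!: rel_intros bounded_set_reg)
qed auto

lemma correct_Minus: "r < 60 \<Longrightarrow> a < 60 \<Longrightarrow> b < 60 \<Longrightarrow> correct (Minus r a b)"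
proof (rule correct_block[where cs = "[Sub r a b]"], goal_cases)
  case (4 s m)
  have "m a = reg s a" "m b = reg s b" "reg s a \<le> M" using 4 by (auto simp: rel_reg bounded_reg)
  with 4 show ?case
    by (auto simp: small_instr_def intro!: rel_intros bounded_set_reg)
qed auto

text \<open>The sum of the two truncated differences is the distance of the arguments; subtracting
  it from 1 leaves 1 exactly when it is zero.\<close>

lemma correct_Equal: "r < 60 \<Longrightarrow> a < 60 \<Longrightarrow> b < 60 \<Longrightarrow> correct (Equal r a b)"
proof (rule correct_block[where cs = "[Sub 60 a b, Sub 61 b a, Add 60 60 61, Const 61 1, Sub r 61 60]"], goal_cases)
  case (4 s m)
  have "m a = reg s a" "m b = reg s b" "reg s a \<le> M" "reg s b \<le> M"
    using 4 by (auto simp: rel_reg bounded_reg)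
  moreover have "Suc 0 - (reg s a - reg s b + (reg s b - reg s a)) =
      (if reg s a = reg s b then 1 else 0)"
    by auto
  ultimately show ?case using 4 M_ge
    by (auto simp: small_instr_def intro!: rel_intros bounded_set_reg)
qed auto

lemma correct_Get: "r < 60 \<Longrightarrow> k < 4 \<Longrightarrow> i < 60 \<Longrightarrow> correct (Get r k i)"
proof (rule correct_block[where cs = "[Add 60 i i, Add 60 60 60, Const 61 (64 + k), Add 60 60 61, Load r 60]"], goal_cases)
  case (4 s m)
  have m: "m i = reg s i" "reg s i \<le> M" "arr s k (reg s i) \<le> M"
    using 4 by (auto simp: rel_reg bounded_reg bounded_arr)
  have "m (4 * reg s i + (64 + k)) = arr s k (reg s i)"
    using 4 rel_arr[of s m k "reg s i"] by (simp add: ac_simps)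
  then show ?case using 4 m
    by (auto simp: small_instr_def intro!: rel_intros bounded_set_reg)
qed auto

lemma correct_Put: "r < 60 \<Longrightarrow> k < 4 \<Longrightarrow> i < 60 \<Longrightarrow> correct (Put k i r)"
proof (rule correct_block[where cs = "[Add 60 i i, Add 60 60 60, Const 61 (64 + k), Add 60 60 61, Store 60 r]"], goal_cases)
  case (4 s m)
  have m: "m i = reg s i" "reg s i \<le> M" "m r = reg s r" "reg s r \<le> M"
    using 4 by (auto simp: rel_reg bounded_reg)
  have "represents (set_arr k (reg s i) (reg s r) s)
      (m(61 := 64 + k, 60 := 4 * reg s i + (64 + k), 4 * reg s i + (64 + k) := reg s r))"
    using rel_set_arr[of s "m(61 := 64 + k, 60 := 4 * reg s i + (64 + k))" k] 4
    by (simp add: rel_update_scratch ac_simps)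
  then show ?case using 4 m
    by (auto simp: small_instr_def intro!: bounded_set_arr)
qed auto

lemma correct_Inp: "r < 60 \<Longrightarrow> i < 60 \<Longrightarrow> correct (Inp r i)"
proof (rule correct_block[where cs = "[Read r i]"], goal_cases)
  case (4 s m)
  have "m i = reg s i" "reg s i \<le> M" using 4 by (auto simp: rel_reg bounded_reg)
  then show ?case using 4 input_le[of "reg s i"]
    by (auto simp: small_instr_def intro!: rel_intros bounded_set_reg)
qed auto

lemma correct_Seq:
  assumes "correct c" "correct d"
  shows "correct (Seq c d)"
  unfolding correct_def
proof (intro allI impI)
  fix pc s m
  assume *: "code_at P pc (compile pc (c ;; d))" "represents s m" "bounded_state M s" "mem_le m"
    "ok (exec xs M (c ;; d) s)"
  note code = code_at_append[OF *(1)[simplified]]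
  have "ok (exec xs M c s)" using *(5) exec_okD by simp
  from correctD[OF assms(1) code(1) *(2-4) this] obtain m1 where
    1: "runs P xs (pc, m) (pc + length (compile pc c), m1) (steps xs M c s * width M)"
    and m1: "represents (exec xs M c s) m1" "bounded_state M (exec xs M c s)" "mem_le m1" .
  have "ok (exec xs M d (exec xs M c s))" using *(5) by simp
  from correctD[OF assms(2) code(2) m1 this] obtain m2 where
    2: "runs P xs (pc + length (compile pc c), m1)
      (pc + length (compile pc c) + length (compile (pc + length (compile pc c)) d), m2)
      (steps xs M d (exec xs M c s) * width M)"
    and m2: "represents (exec xs M d (exec xs M c s)) m2"
      "bounded_state M (exec xs M d (exec xs M c s))" "mem_le m2" .
  show "\<exists>m'. runs P xs (pc, m) (pc + length (compile pc (c ;; d)), m')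
        (steps xs M (c ;; d) s * width M) \<and>
        represents (exec xs M (c ;; d) s) m' \<and> bounded_state M (exec xs M (c ;; d) s) \<and> mem_le m'"
    using runs_trans[OF 1 2] m2 by (intro exI[of _ m2]) (simp add: algebra_simps)
qed

lemma correct_IfNZ:
  assumes "correct c" "r < 60"
  shows "correct (IfNZ r c)"
  unfolding correct_def
proof (intro allI impI)
  fix pc s m
  assume *: "code_at P pc (compile pc (IfNZ r c))" "represents s m" "bounded_state M s" "mem_le m"
    "ok (exec xs M (IfNZ r c) s)"
  let ?n = "length (compile (pc + 1) c)"
  have code: "code_at P pc [JumpZ r (pc + 1 + ?n)]" "code_at P (pc + 1) (compile (pc + 1) c)"
    using code_at_append[of P pc "[JumpZ r (pc + 1 + ?n)]"] *(1) by (auto simp: Let_def)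
  have m: "m r = reg s r" using * assms by (simp add: rel_reg)
  have 1: "runs P xs (pc, m) (if reg s r = 0 then pc + 1 + ?n else pc + 1, m) (1 * width M)"
    by (rule runs_jump[OF code(1) *(4)]) (use assms(2) m in auto)
  show "\<exists>m'. runs P xs (pc, m) (pc + length (compile pc (IfNZ r c)), m')
        (steps xs M (IfNZ r c) s * width M) \<and>
        represents (exec xs M (IfNZ r c) s) m' \<and> bounded_state M (exec xs M (IfNZ r c) s) \<and> mem_le m'"
  proof (cases "reg s r = 0")
    case True
    then show ?thesis using runs_weaken[OF 1, of 5] * by (auto simp: Let_def)
  next
    case False
    then have "ok (exec xs M c s)" using *(5) by simp
    from correctD[OF assms(1) code(2) *(2-4) this] obtain m1 where
      2: "runs P xs (pc + 1, m) (pc + 1 + ?n, m1) (steps xs M c s * width M)"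
      and m1: "represents (exec xs M c s) m1" "bounded_state M (exec xs M c s)" "mem_le m1" .
    have "runs P xs (pc, m) (pc + 1 + ?n, m1) ((5 + steps xs M c s) * width M)"
      using runs_trans[OF _ 2, of "(pc, m)" "5 * width M"] runs_weaken[OF 1, of 5] False
      by (simp add: algebra_simps)
    then show ?thesis using m1 False by (auto simp: Let_def)
  qed
qed

lemma correct_IfZ:
  assumes "correct c" "r < 60"
  shows "correct (IfZ r c)"
  unfolding correct_def
proof (intro allI impI)
  fix pc s m
  assume *: "code_at P pc (compile pc (IfZ r c))" "represents s m" "bounded_state M s" "mem_le m"
    "ok (exec xs M (IfZ r c) s)"
  let ?n = "length (compile (pc + 3) c)"
  let ?is = "[Const 60 1, Sub 60 60 r]" and ?j = "JumpZ 60 (pc + 3 + ?n)"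
  have "code_at P pc (?is @ [?j] @ compile (pc + 3) c)"
    using *(1) by (simp add: Let_def)
  note c1 = code_at_append[OF this]
  have code: "code_at P pc ?is" "code_at P (pc + 2) [?j]" "code_at P (pc + 3) (compile (pc + 3) c)"
    using c1(1) code_at_append[OF c1(2)] by (simp_all add: numeral_3_eq_3)
  \<comment> \<open>The scratch value is zero iff \<open>m r\<close> is nonzero, so the jump on zero
    skips the body in the right case.\<close>
  define m0 where "m0 = m(60 := 1 - m r)"
  have m: "m r = reg s r" using * assms by (simp add: rel_reg)
  have rel0: "represents s m0" "mem_le m0"
    using * M_ge by (auto simp: m0_def rel_update_scratch)
  have b: "block ?is m = m0" using assms(2) by (auto simp: m0_def fun_eq_iff)
  have "runs P xs (pc, m) (pc + 2, m0) (2 * width M)"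
    using runs_block[OF code(1), of m] assms(2) *(4) M_ge unfolding b
    by (simp add: small_instr_def numeral_2_eq_2)
  moreover have "runs P xs (pc + 2, m0) (if reg s r = 0 then pc + 3 else pc + 3 + ?n, m0) (1 * width M)"
    by (rule runs_jump[OF code(2) rel0(2)]) (use m in \<open>auto simp: m0_def\<close>)
  ultimately have 1: "runs P xs (pc, m) (if reg s r = 0 then pc + 3 else pc + 3 + ?n, m0) (5 * width M)"
    using runs_trans runs_weaken[of _ _ 3 5] by fastforce
  show "\<exists>m'. runs P xs (pc, m) (pc + length (compile pc (IfZ r c)), m')
        (steps xs M (IfZ r c) s * width M) \<and>
        represents (exec xs M (IfZ r c) s) m' \<and> bounded_state M (exec xs M (IfZ r c) s) \<and> mem_le m'"
  proof (cases "reg s r = 0")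
    case False
    have "length (compile pc (IfZ r c)) = 3 + ?n" by (simp add: Let_def)
    then show ?thesis using False 1 * rel0 by (intro exI[of _ m0]) (simp add: add.assoc)
  next
    case True
    then have "ok (exec xs M c s)" using *(5) by simp
    from correctD[OF assms(1) code(3) rel0(1) *(3) rel0(2) this] obtain m1 where
      2: "runs P xs (pc + 3, m0) (pc + 3 + ?n, m1) (steps xs M c s * width M)"
      and m1: "represents (exec xs M c s) m1" "bounded_state M (exec xs M c s)" "mem_le m1" .
    have "runs P xs (pc, m) (pc + 3 + ?n, m1) ((5 + steps xs M c s) * width M)"
      using runs_trans[OF _ 2, of "(pc, m)" "5 * width M"] 1 True
      by (simp add: algebra_simps)
    moreover have "length (compile pc (IfZ r c)) = 3 + ?n" by (simp add: Let_def)
    ultimately show ?thesis using m1 True by (intro exI[of _ m1]) (simp add: add.assoc)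
  qed
qed

text \<open>The loop is entered if \<open>l - r\<close> is nonzero and then tested at its end. Since
  only jumps on zero exist, the test at the end uses \<open>1 - (l - r)\<close>, which is zero as
  long as rounds remain.\<close>

lemma correct_For:
  assumes "correct c" "r < 60" "l < 60" "r \<noteq> l" "r \<notin> writes c" "l \<notin> writes c"
  shows "correct (For r l c)"
  unfolding correct_def
proof (intro allI impI)
  fix pc s m
  assume *: "code_at P pc (compile pc (For r l c))" "represents s m" "bounded_state M s" "mem_le m"
    "ok (exec xs M (For r l c) s)"
  let ?n = "length (compile (pc + 3) c)" and ?k = "reg s l" and ?s = "iter xs M r c s"
  let ?is = "[Const r 0, Sub 61 l r]" and ?j = "JumpZ 61 (pc + 8 + ?n)"
  let ?js = "[Const 60 1, Add r r 60, Sub 61 l r, Sub 61 60 61]" and ?i = "JumpZ 61 (pc + 3)"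
  have "code_at P pc (?is @ [?j] @ compile (pc + 3) c @ ?js @ [?i])"
    using *(1) by (simp add: Let_def)
  note c1 = code_at_append[OF this]
  note c2 = code_at_append[OF c1(2)]
  note c3 = code_at_append[OF c2(2)]
  note c4 = code_at_append[OF c3(2)]
  have code: "code_at P pc ?is" "code_at P (pc + 2) [?j]" "code_at P (pc + 3) (compile (pc + 3) c)"
    "code_at P (pc + 3 + ?n) ?js" "code_at P (pc + 7 + ?n) [?i]"
    using c1(1) c2(1) c3(1) c4 by (simp_all add: numeral_eq_Suc)
  have ok: "ok (?s i)" if "i \<le> ?k" for i
    using *(5) that iter_ok_mono unfolding exec_For by blast
  have ok_body: "ok (exec xs M c (?s i))" if "i < ?k" for i
    using ok[of "Suc i"] that by simp
  have k_le: "?k \<le> M" using *(3) assms(3) by (rule bounded_reg)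
  \<comment> \<open>Where control stands after \<open>i\<close> rounds: at the body if another round
    is due, behind the loop otherwise.\<close>
  define pos where "pos i = (if i < ?k then pc + 3 else pc + 8 + ?n)" for i
  have "\<exists>m'. runs P xs (pc, m) (pos i, m') ((5 + (\<Sum>j<i. 5 + steps xs M c (?s j))) * width M) \<and>
      represents (?s i) m' \<and> bounded_state M (?s i) \<and> mem_le m'" if "i \<le> ?k" for i
    using that
  proof (induction i)
    case 0
    define m0 where "m0 = m(r := 0, 61 := m l)"
    have m: "m l = ?k" using * assms by (simp add: rel_reg)
    have rel0: "represents (?s 0) m0" "mem_le m0" "bounded_state M (?s 0)"
      using * assms(2) by (auto simp: m0_def intro!: rel_intros bounded_set_reg)
    have b: "block ?is m = m0" using assms(2-4) by (auto simp: m0_def fun_eq_iff)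
    have "runs P xs (pc, m) (pc + 2, m0) (2 * width M)"
      using runs_block[OF code(1), of m] assms(2,3) *(4) k_le unfolding b
      by (simp add: small_instr_def numeral_2_eq_2)
    moreover have "runs P xs (pc + 2, m0) (pos 0, m0) (1 * width M)"
      by (rule runs_jump[OF code(2) rel0(2)]) (use m in \<open>auto simp: m0_def pos_def\<close>)
    ultimately have "runs P xs (pc, m) (pos 0, m0) (5 * width M)"
      using runs_trans runs_weaken[of _ _ 3 5] by fastforce
    then show ?case using rel0 by auto
  next
    case (Suc i)
    then obtain m1 where
      1: "runs P xs (pc, m) (pos i, m1) ((5 + (\<Sum>j<i. 5 + steps xs M c (?s j))) * width M)"
      and m1: "represents (?s i) m1" "bounded_state M (?s i)" "mem_le m1"
      by auto
    have i: "i < ?k" using Suc.prems by simp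
    from correctD[OF assms(1) code(3) m1 ok_body[OF i]] obtain m2 where
      2: "runs P xs (pos i, m1) (pc + 3 + ?n, m2) (steps xs M c (?s i) * width M)"
      and m2: "represents (exec xs M c (?s i)) m2" "bounded_state M (exec xs M c (?s i))" "mem_le m2"
      using i by (auto simp: pos_def)
    have m2r: "m2 r = i"
      using m2(1) assms(2,5) by (simp add: rel_reg exec_frame_reg iter_counter)
    have m2l: "m2 l = ?k"
      using m2(1) assms by (simp add: rel_reg exec_frame_reg iter_frame_reg)
    \<comment> \<open>Register 61 becomes zero, and control jumps back, iff \<open>Suc i\<close> is
      still below the limit.\<close>
    define m3 where "m3 = m2(60 := 1, r := Suc i, 61 := 1 - (?k - Suc i))"
    have b: "block ?js m2 = m3"
      using assms(2-4) by (auto simp: m3_def fun_eq_iff m2r m2l)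
    have s: "safe ?js m2"
      using assms(2-4) m2(3) k_le i M_ge by (auto simp: small_instr_def m2r m2l)
    have len: "length ?js * width M = 4 * width M" by simp
    have pos: "pc + 3 + ?n + length ?js = pc + 7 + ?n" by simp
    have 3: "runs P xs (pc + 3 + ?n, m2) (pc + 7 + ?n, m3) (4 * width M)" "mem_le m3"
      using runs_block[OF code(4) s] unfolding b len pos by auto
    have 4: "runs P xs (pc + 7 + ?n, m3) (pos (Suc i), m3) (1 * width M)"
      by (rule runs_jump[OF code(5) 3(2)]) (use i in \<open>auto simp: m3_def pos_def\<close>)
    have "runs P xs (pc, m) (pos (Suc i), m3)
        ((5 + (\<Sum>j<Suc i. 5 + steps xs M c (?s j))) * width M)"
      using runs_trans[OF runs_trans[OF runs_trans[OF 1 2] 3(1)] 4]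
      by (simp add: algebra_simps)
    moreover have "represents (?s (Suc i)) m3"
      using m2(1) assms(2,5) unfolding m3_def
      by (auto simp: iter_counter intro!: rel_intros)
    moreover have "bounded_state M (?s (Suc i))"
      using m2(2) assms(5) i k_le by (auto simp: iter_counter intro!: bounded_set_reg)
    ultimately show ?case using 3(2) by blast
  qed
  moreover have len: "pc + length (compile pc (For r l c)) = pc + 8 + ?n"
    by (simp add: Let_def)
  ultimately show "\<exists>m'. runs P xs (pc, m) (pc + length (compile pc (For r l c)), m')
        (steps xs M (For r l c) s * width M) \<and>
        represents (exec xs M (For r l c) s) m' \<and> bounded_state M (exec xs M (For r l c) s) \<and> mem_le m'"
    unfolding exec_For len by (force simp: pos_def)
qed

lemma wf_com_correct: "wf_com c \<Longrightarrow> correct c"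
  by (induction c)
    (simp_all add: correct_SetC correct_Copy correct_Inc correct_Plus correct_Minus correct_Equal
      correct_Get correct_Put correct_Inp correct_Seq correct_IfNZ correct_IfZ correct_For)

end

definition init_state :: state where
  "init_state = \<lparr>reg = \<lambda>_. 0, arr = \<lambda>_ _. 0, ok = True\<rparr>"

text \<open>The bridge to the machine model. As \<open>compile\<close> does not mention
  \<open>M\<close>, the bound may be chosen for each input separately.\<close>

theorem compiled_computes:
  assumes "wf_com c" "64 \<le> M" "\<And>k. input_at xs k \<le> M" "ok (exec xs M c init_state)"
  shows "\<exists>T. computes_in_time (compile 0 c) xs (reg (exec xs M c init_state) 0) T \<and>
           T \<le> steps xs M c init_state * width M"
proof -
  let ?P = "compile 0 c"
  interpret machine ?P xs M using assms by unfold_locales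
  have "code_at ?P 0 ?P" unfolding code_at_def by (intro exI[of _ "[]"]) simp
  moreover have "represents init_state (\<lambda>_. 0)" "bounded_state M init_state"
    by (simp_all add: represents_def bounded_state_def init_state_def)
  ultimately obtain m where
    "runs ?P xs (0, \<lambda>_. 0) (0 + length ?P, m) (steps xs M c init_state * width M)"
    and m: "represents (exec xs M c init_state) m"
    using correctD[OF wf_com_correct[OF assms(1)], of 0 init_state "\<lambda>_. 0"] assms(4) by auto
  then obtain t where t: "(step ?P xs ^^ t) (0, \<lambda>_. 0) = (length ?P, m)"
    "(\<Sum>s<t. step_cost ?P xs ((step ?P xs ^^ s) (0, \<lambda>_. 0))) \<le> steps xs M c init_state * width M"
    unfolding runs_def by auto
  show ?thesis
    unfolding computes_in_time_def config_at_def
    using t m by (intro exI conjI) (auto simp: halted_def represents_def)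
qed

section \<open>Step counts from loop nesting\<close>

primrec limits :: "com \<Rightarrow> nat set" where
  "limits (SetC r c) = {}"
| "limits (Copy r a) = {}"
| "limits (Inc r) = {}"
| "limits (Plus r a b) = {}"
| "limits (Minus r a b) = {}"
| "limits (Equal r a b) = {}"
| "limits (Get r k i) = {}"
| "limits (Put k i r) = {}"
| "limits (Inp r i) = {}"
| "limits (Seq c d) = limits c \<union> limits d"
| "limits (IfNZ r c) = limits c"
| "limits (IfZ r c) = limits c"
| "limits (For r l c) = insert l (limits c)"

text \<open>The 10 for a loop combines 5 for its entry with 5 per round; both are absorbed by one
  further factor \<open>B\<close>.\<close>

primrec coeff :: "com \<Rightarrow> nat" where
  "coeff (SetC r c) = 5"
| "coeff (Copy r a) = 5"
| "coeff (Inc r) = 5"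
| "coeff (Plus r a b) = 5"
| "coeff (Minus r a b) = 5"
| "coeff (Equal r a b) = 5"
| "coeff (Get r k i) = 5"
| "coeff (Put k i r) = 5"
| "coeff (Inp r i) = 5"
| "coeff (Seq c d) = coeff c + coeff d"
| "coeff (IfNZ r c) = 5 + coeff c"
| "coeff (IfZ r c) = 5 + coeff c"
| "coeff (For r l c) = 10 + coeff c"

primrec depth :: "com \<Rightarrow> nat" where
  "depth (SetC r c) = 0"
| "depth (Copy r a) = 0"
| "depth (Inc r) = 0"
| "depth (Plus r a b) = 0"
| "depth (Minus r a b) = 0"
| "depth (Equal r a b) = 0"
| "depth (Get r k i) = 0"
| "depth (Put k i r) = 0"
| "depth (Inp r i) = 0"
| "depth (Seq c d) = max (depth c) (depth d)"
| "depth (IfNZ r c) = depth c"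
| "depth (IfZ r c) = depth c"
| "depth (For r l c) = Suc (depth c)"

text \<open>
  Since no loop limit is modified, the values of the limits on entry bound the nested loops.
\<close>

lemma steps_le:
  assumes "1 \<le> B" "limits c \<inter> writes c = {}" "\<And>l. l \<in> limits c \<Longrightarrow> reg s l \<le> B"
  shows "steps xs M c s \<le> coeff c * B ^ depth c"
  using assms(2,3)
proof (induction c arbitrary: s)
  case (Seq c d)
  have "steps xs M c s \<le> coeff c * B ^ depth c"
    using Seq by auto
  also have "\<dots> \<le> coeff c * B ^ depth (c ;; d)"
    using assms(1) by (simp add: power_increasing)
  finally have 1: "steps xs M c s \<le> coeff c * B ^ depth (c ;; d)" .
  have "reg (exec xs M c s) l \<le> B" if "l \<in> limits d" for l
  proof -
    have "l \<notin> writes c" using Seq.prems(1) that by auto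
    then show ?thesis using Seq.prems(2) that by (simp add: exec_frame_reg)
  qed
  then have "steps xs M d (exec xs M c s) \<le> coeff d * B ^ depth d"
    using Seq by auto
  also have "\<dots> \<le> coeff d * B ^ depth (c ;; d)"
    using assms(1) by (simp add: power_increasing)
  finally show ?case using 1 by (simp add: algebra_simps)
next
  case (For r l c)
  let ?K = "coeff c * B ^ depth c"
  have "steps xs M c (iter xs M r c s i) \<le> ?K" for i
  proof (rule For.IH)
    show "limits c \<inter> writes c = {}" using For.prems(1) by auto
    fix x assume x: "x \<in> limits c"
    then have "x \<notin> writes c" "x \<noteq> r" using For.prems(1) by auto
    then show "reg (iter xs M r c s i) x \<le> B"
      using For.prems(2) x by (simp add: iter_frame_reg)
  qed
  then have "(\<Sum>i<reg s l. 5 + steps xs M c (iter xs M r c s i)) \<le> (\<Sum>i<reg s l. 5 + ?K)"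
    by (intro sum_mono) simp
  also have "\<dots> \<le> B * (5 + ?K)"
    using For.prems(2)[of l] by simp
  finally have "steps xs M (For r l c) s \<le> 5 + B * 5 + B * ?K"
    by (simp add: algebra_simps)
  also have "\<dots> \<le> 10 * (B * B ^ depth c) + B * ?K"
  proof -
    have "1 \<le> B ^ depth c" using assms(1) by simp
    then have "B * 1 \<le> B * B ^ depth c" by (rule mult_le_mono2)
    then show ?thesis using assms(1) by linarith
  qed
  finally show ?case by (simp add: algebra_simps)
next
  case (IfNZ r c)
  then have "steps xs M c s \<le> coeff c * B ^ depth c" by auto
  moreover have "1 \<le> B ^ depth c" using assms(1) by simp
  ultimately have "5 + steps xs M c s \<le> 5 * B ^ depth c + coeff c * B ^ depth c" by linarith
  then show ?case by (simp add: algebra_simps)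
next
  case (IfZ r c)
  then have "steps xs M c s \<le> coeff c * B ^ depth c" by auto
  moreover have "1 \<le> B ^ depth c" using assms(1) by simp
  ultimately have "5 + steps xs M c s \<le> 5 * B ^ depth c + coeff c * B ^ depth c" by linarith
  then show ?case by (simp add: algebra_simps)
qed simp_all

section \<open>Canonical listings of generated subgroups\<close>

definition insert_new :: "nat list \<Rightarrow> nat \<Rightarrow> nat list" where
  "insert_new L y = (if y \<in> set L then L else L @ [y])"

text \<open>Positions beyond the end are idle rounds: the number of rounds is fixed while the length
  of the listing is not.\<close>

definition expand :: "(nat \<Rightarrow> nat \<Rightarrow> nat) \<Rightarrow> nat list \<Rightarrow> nat list \<Rightarrow> nat \<Rightarrow> nat list" where
  "expand f w L a = (if a < length L then foldl insert_new L (map (f (L ! a)) w) else L)"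

text \<open>
  Breadth-first enumeration: only \<open>n\<close> rounds are needed, because a listing without repetitions of
  elements of a group of order \<open>n\<close> has at most \<open>n\<close> entries.  The result depends on the word and the
  multiplication only, hence isomorphisms carry listings to listings.
\<close>

definition closure_list :: "(nat \<Rightarrow> nat \<Rightarrow> nat) \<Rightarrow> nat \<Rightarrow> nat list \<Rightarrow> nat list" where
  "closure_list f n w = foldl (expand f w) (foldl insert_new [] w) [0..<n]"

text \<open>Positions are counted from one; zero means absent.\<close>

definition posn :: "nat list \<Rightarrow> nat \<Rightarrow> nat" where
  "posn L y = (if y \<in> set L then Suc (length (takeWhile (\<lambda>z. z \<noteq> y) L)) else 0)"

text \<open>Horner's scheme in base \<open>n\<close>. For a listing of the whole group the digits
  lie between 1 and \<open>n\<close>, so this is bijective numeration with \<open>n * n\<close>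
  digits, and the code determines the table.\<close>

definition table_code :: "(nat \<Rightarrow> nat \<Rightarrow> nat) \<Rightarrow> nat \<Rightarrow> nat list \<Rightarrow> nat" where
  "table_code f n L = foldl (\<lambda>k a. foldl (\<lambda>k b. k * n + posn L (f (L ! a) (L ! b))) k [0..<n]) 0 [0..<n]"

text \<open>The value is \<open>0\<close> if the word already generates the group.\<close>

definition missing :: "(nat \<Rightarrow> nat \<Rightarrow> nat) \<Rightarrow> nat \<Rightarrow> nat list \<Rightarrow> nat" where
  "missing f n w = foldl (\<lambda>x y. if y \<notin> set (closure_list f n w) then y else x) 0 [0..<n]"

text \<open>Exactly \<open>k\<close> letters are added in every case; once the group is generated
  the padding letter 0 is harmless. Thus all words have a length known in advance.\<close>

definition greedy_extend :: "(nat \<Rightarrow> nat \<Rightarrow> nat) \<Rightarrow> nat \<Rightarrow> nat \<Rightarrow> nat list \<Rightarrow> nat list" where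
  "greedy_extend f n k w = ((\<lambda>w. w @ [missing f n w]) ^^ k) w"

lemma greedy_extend_simps [simp]:
  "greedy_extend f n 0 w = w"
  "greedy_extend f n (Suc k) w = greedy_extend f n k w @ [missing f n (greedy_extend f n k w)]"
  by (simp_all add: greedy_extend_def)

lemma missing_lt:
  assumes "0 < n"
  shows "missing f n w < n"
proof -
  have "foldl (\<lambda>x y. if y \<notin> set (closure_list f n w) then y else x) 0 [0..<k] < n" if "k \<le> n" for k
    using that assms by (induction k) auto
  then show ?thesis by (simp add: missing_def)
qed

lemma greedy_extend_bounds:
  assumes "0 < n" "set w \<subseteq> {..<n}"
  shows "set (greedy_extend f n k w) \<subseteq> {..<n}" "length (greedy_extend f n k w) = length w + k"
  using assms missing_lt by (induction k) auto

section \<open>Positions, insertion and injectivity of codes\<close>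

lemma posn_append:
  "y \<notin> set L \<Longrightarrow> posn (L @ [y]) z = (if z = y then Suc (length L) else posn L z)"
  by (auto simp: posn_def takeWhile_append)

lemma posn_nth:
  assumes "distinct L" "i < length L"
  shows "posn L (L ! i) = Suc i"
proof -
  have "takeWhile (\<lambda>z. z \<noteq> L ! i) L = take i L"
    using assms by (intro takeWhile_eq_take_P_nth) (auto simp: nth_eq_iff_index_eq)
  then show ?thesis using assms by (simp add: posn_def)
qed

lemma posn_le: "posn L y \<le> length L"
  by (induction L) (auto simp: posn_def)

lemma posn_map:
  assumes "inj_on \<phi> (insert y (set L))"
  shows "posn (map \<phi> L) (\<phi> y) = posn L y"
proof -
  have "takeWhile ((\<lambda>z. z \<noteq> \<phi> y) \<circ> \<phi>) L = takeWhile (\<lambda>z. z \<noteq> y) L"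
    using inj_onD[OF assms] by (intro takeWhile_cong) auto
  moreover have "\<phi> y \<in> \<phi> ` set L \<longleftrightarrow> y \<in> set L"
    using assms by (auto dest: inj_onD)
  ultimately show ?thesis
    by (simp add: posn_def takeWhile_map)
qed

lemma set_foldl_ins: "set (foldl insert_new L ys) = set L \<union> set ys"
  by (induction ys arbitrary: L) (auto simp: insert_new_def)

lemma distinct_foldl_ins: "distinct L \<Longrightarrow> distinct (foldl insert_new L ys)"
  by (induction ys arbitrary: L) (auto simp: insert_new_def)

text \<open>Insertion only appends, so entries keep their positions, and what holds for positions
  already expanded stays true.\<close>

lemma foldl_ins_prefix: "\<exists>zs. foldl insert_new L ys = L @ zs"
proof (induction ys arbitrary: L)
  case (Cons y ys)
  from Cons[of "insert_new L y"] show ?case by (auto simp: insert_new_def)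
qed simp

lemma foldl_ins_nth: "i < length L \<Longrightarrow> foldl insert_new L ys ! i = L ! i"
  using foldl_ins_prefix[of L ys] by (auto simp: nth_append)

lemma foldl_ins_map:
  assumes "inj_on \<phi> (set L \<union> set ys)"
  shows "foldl insert_new (map \<phi> L) (map \<phi> ys) = map \<phi> (foldl insert_new L ys)"
  using assms
proof (induction ys arbitrary: L)
  case (Cons y ys)
  have "insert_new (map \<phi> L) (\<phi> y) = map \<phi> (insert_new L y)"
    using Cons.prems by (auto simp: insert_new_def dest: inj_onD)
  moreover have "set (insert_new L y) \<union> set ys = set L \<union> set (y # ys)" by (auto simp: insert_new_def)
  ultimately show ?case using Cons by simp
qed simp

lemma closure_list_Suc:
  "closure_list f (Suc n) w = expand f w (closure_list f n w) n"
  by (simp add: closure_list_def)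

text \<open>Lowering the digits by one turns them into remainders modulo \<open>n\<close>, and
  division with remainder is unique.\<close>

lemma horner_inject:
  fixes n :: nat
  assumes "k * n + d = k' * n + d'" "1 \<le> d" "d \<le> n" "1 \<le> d'" "d' \<le> n"
  shows "k = k' \<and> d = d'"
proof -
  obtain e e' where e: "d = Suc e" "d' = Suc e'" using assms by (cases d; cases d') auto
  then have *: "k * n + e = k' * n + e'" "e < n" "e' < n" using assms by auto
  then have "(k * n + e) div n = (k' * n + e') div n" "(k * n + e) mod n = (k' * n + e') mod n"
    by simp_all
  with *(2,3) e show ?thesis by (simp add: div_mult_self3)
qed

lemma horner_foldl_inject:
  fixes n :: nat
  assumes "foldl (\<lambda>k b. k * n + d b) k bs = foldl (\<lambda>k b. k * n + d' b) k' bs"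
    and "\<And>b. b \<in> set bs \<Longrightarrow> 1 \<le> d b \<and> d b \<le> n \<and> 1 \<le> d' b \<and> d' b \<le> n"
  shows "k = k' \<and> (\<forall>b\<in>set bs. d b = d' b)"
  using assms
proof (induction bs rule: rev_induct)
  case (snoc b bs)
  have "foldl (\<lambda>k b. k * n + d b) k bs = foldl (\<lambda>k b. k * n + d' b) k' bs \<and> d b = d' b"
    using snoc.prems by (intro horner_inject) auto
  with snoc show ?case by auto
qed simp

text \<open>Both codes have the same number of digits, so these can be compared from the last one
  backwards, row by row; the inner rows are handled by \<open>horner_foldl_inject\<close>.\<close>

lemma table_code_inject:
  assumes "table_code f n L = table_code g n L'"
    and "\<And>a b. a < n \<Longrightarrow> b < n \<Longrightarrow> f (L ! a) (L ! b) \<in> set L \<and> g (L' ! a) (L' ! b) \<in> set L'"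
    and "length L = n" "length L' = n" "a < n" "b < n"
  shows "posn L (f (L ! a) (L ! b)) = posn L' (g (L' ! a) (L' ! b))"
proof -
  let ?d = "\<lambda>a b. posn L (f (L ! a) (L ! b))" and ?d' = "\<lambda>a b. posn L' (g (L' ! a) (L' ! b))"
  have d: "1 \<le> ?d a b \<and> ?d a b \<le> n \<and> 1 \<le> ?d' a b \<and> ?d' a b \<le> n" if "a < n" "b < n" for a b
    using assms(2)[OF that] posn_le[of L "f (L ! a) (L ! b)"] posn_le[of L' "g (L' ! a) (L' ! b)"]
      assms(3,4) by (auto simp: posn_def)
  have "foldl (\<lambda>k a. foldl (\<lambda>k b. k * n + ?d a b) k [0..<n]) 0 as =
      foldl (\<lambda>k a. foldl (\<lambda>k b. k * n + ?d' a b) k [0..<n]) 0 as \<Longrightarrow> set as \<subseteq> {..<n} \<Longrightarrow>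
      \<forall>a\<in>set as. \<forall>b<n. ?d a b = ?d' a b" for as
  proof (induction as rule: rev_induct)
    case (snoc a as)
    from snoc.prems have "foldl (\<lambda>k b. k * n + ?d a b)
        (foldl (\<lambda>k a. foldl (\<lambda>k b. k * n + ?d a b) k [0..<n]) 0 as) [0..<n] =
      foldl (\<lambda>k b. k * n + ?d' a b)
        (foldl (\<lambda>k a. foldl (\<lambda>k b. k * n + ?d' a b) k [0..<n]) 0 as) [0..<n]"
      by simp
    then have "foldl (\<lambda>k a. foldl (\<lambda>k b. k * n + ?d a b) k [0..<n]) 0 as =
        foldl (\<lambda>k a. foldl (\<lambda>k b. k * n + ?d' a b) k [0..<n]) 0 as \<and>
      (\<forall>b\<in>set [0..<n]. ?d a b = ?d' a b)"
      by (rule horner_foldl_inject) (use d[of a] snoc.prems(2) in simp)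
    then have "foldl (\<lambda>k a. foldl (\<lambda>k b. k * n + ?d a b) k [0..<n]) 0 as =
        foldl (\<lambda>k a. foldl (\<lambda>k b. k * n + ?d' a b) k [0..<n]) 0 as"
      and a: "\<forall>b<n. ?d a b = ?d' a b" by simp_all
    from snoc.IH[OF this(1)] snoc.prems(2) have "\<forall>a\<in>set as. \<forall>b<n. ?d a b = ?d' a b" by simp
    with a show ?case by simp
  qed simp
  from this[of "[0..<n]"] have "\<forall>a\<in>set [0..<n]. \<forall>b<n. ?d a b = ?d' a b"
    using assms(1) unfolding table_code_def by fastforce
  then show ?thesis using assms(5,6) by simp
qed

lemma foldl_cong_set:
  assumes "\<And>k a. a \<in> set as \<Longrightarrow> F k a = F' k a"
  shows "foldl F k as = foldl F' k as"
  using assms by (induction as arbitrary: k) auto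

text \<open>Left multiplication by an element of \<open>K\<close> is injective on the finite set
  \<open>K\<close>, hence onto; a preimage of the identity is the inverse.\<close>

lemma (in group) finite_closed_subgroup:
  assumes "finite K" "K \<subseteq> carrier G" "\<one> \<in> K" "\<And>x y. x \<in> K \<Longrightarrow> y \<in> K \<Longrightarrow> x \<otimes> y \<in> K"
  shows "subgroup K G"
proof (rule subgroup.intro)
  fix x assume x: "x \<in> K"
  have "inj_on ((\<otimes>) x) K" using x assms(2) by (intro inj_onI) (metis Units_eq Units_l_cancel subsetD)
  then have "(\<otimes>) x ` K = K"
    using assms(1,4) x by (intro endo_inj_surj) auto
  then obtain y where "y \<in> K" "x \<otimes> y = \<one>" using assms(3) by (metis imageE)
  moreover from this have "inv x = y" using x assms(2) inv_solve_left[of y x \<one>] by auto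
  ultimately show "inv x \<in> K" by simp
qed (use assms in auto)

section \<open>Listings and chains of subgroups in a single group\<close>

locale table_group =
  fixes n :: nat and G :: "nat monoid" (structure)
  assumes group: "group G" and carrier: "carrier G = {..<n}"
begin

sublocale group G by (rule group)

abbreviation f where "f \<equiv> mult G"
abbreviation cl where "cl \<equiv> closure_list f n"

lemma n_pos: "0 < n"
  using one_closed carrier by auto

lemma f_lt: "a < n \<Longrightarrow> b < n \<Longrightarrow> f a b < n"
  using m_closed[of a b] carrier by simp

text \<open>The invariant of the enumeration: the positions below \<open>k\<close> have been
  multiplied by all letters, and nothing outside the generated subgroup has been listed.\<close>

lemma cl_invariant:
  assumes "set w \<subseteq> {..<n}" "w \<noteq> []"
  shows "distinct (closure_list f k w) \<and> set w \<subseteq> set (closure_list f k w) \<and>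
    set (closure_list f k w) \<subseteq> generate G (set w) \<and>
    (\<forall>a<k. a < length (closure_list f k w) \<longrightarrow>
      (\<forall>x\<in>set w. f (closure_list f k w ! a) x \<in> set (closure_list f k w)))"
proof (induction k)
  case 0
  show ?case
    by (auto simp: closure_list_def set_foldl_ins distinct_foldl_ins intro: generate.incl)
next
  case (Suc k)
  let ?L = "closure_list f k w"
  show ?case
  proof (cases "k < length ?L")
    case False
    then show ?thesis using Suc by (auto simp: closure_list_Suc expand_def less_Suc_eq)
  next
    case True
    let ?L' = "foldl insert_new ?L (map (f (?L ! k)) w)"
    have L': "closure_list f (Suc k) w = ?L'" using True by (simp add: closure_list_Suc expand_def)
    have "?L ! k \<in> generate G (set w)" using True Suc by auto
    then have "set ?L' \<subseteq> generate G (set w)"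
      using Suc by (auto simp: set_foldl_ins intro: generate.eng generate.incl)
    moreover have "f (?L' ! a) x \<in> set ?L'" if "a < Suc k" "x \<in> set w" for a x
      using that True Suc by (auto simp: foldl_ins_nth set_foldl_ins less_Suc_eq)
    ultimately show ?thesis
      using Suc unfolding L' by (auto simp: set_foldl_ins distinct_foldl_ins)
  qed
qed

lemma generate_subset: "set w \<subseteq> {..<n} \<Longrightarrow> generate G (set w) \<subseteq> {..<n}"
  using generate_incl[of "set w"] carrier by simp

lemma distinct_cl:
  assumes "set w \<subseteq> {..<n}"
  shows "distinct (cl w)" "set (cl w) \<subseteq> {..<n}" "length (cl w) \<le> n"
proof -
  have *: "distinct (cl w) \<and> set (cl w) \<subseteq> {..<n}"
  proof (cases "w = []")
    case True
    have "closure_list f k [] = []" for k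
      by (induction k) (auto simp: closure_list_Suc expand_def closure_list_def)
    then show ?thesis using True by simp
  next
    case False
    then show ?thesis using cl_invariant[OF assms, of n] generate_subset[OF assms] by auto
  qed
  then show "distinct (cl w)" "set (cl w) \<subseteq> {..<n}" by auto
  then show "length (cl w) \<le> n"
    using card_mono[of "{..<n}" "set (cl w)"] by (simp add: distinct_card)
qed

text \<open>A full enumeration is closed under right multiplication by letters, and finiteness
  supplies the inverses. The empty word has an empty listing, whereas the subgroup generated by the
  empty set contains the identity.\<close>

lemma set_cl:
  assumes "set w \<subseteq> {..<n}" "w \<noteq> []"
  shows "set (cl w) = generate G (set w)"
proof
  let ?S = "set (cl w)"
  note inv = cl_invariant[OF assms, of n]
  show "?S \<subseteq> generate G (set w)" using inv by simp
  have closed: "f s x \<in> ?S" if s: "s \<in> ?S" and x: "x \<in> set w" for s x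
  proof -
    obtain a where "a < length (cl w)" "s = cl w ! a"
      using s unfolding in_set_conv_nth by auto
    moreover from this have "a < n" using distinct_cl(3)[OF assms(1)] by simp
    ultimately show ?thesis using inv x by simp
  qed
  txt \<open>The right multipliers that preserve the listing form a subgroup containing the word.\<close>
  define K where "K = {g \<in> carrier G. \<forall>s\<in>?S. f s g \<in> ?S}"
  have S: "?S \<subseteq> carrier G" using distinct_cl(2)[OF assms(1)] carrier by simp
  have "subgroup K G"
  proof (rule finite_closed_subgroup)
    show "finite K" using carrier by (auto simp: K_def)
    show "K \<subseteq> carrier G" "\<one> \<in> K" using S by (auto simp: K_def)
    show "x \<otimes> y \<in> K" if "x \<in> K" "y \<in> K" for x y
    proof -
      have xy: "x \<in> carrier G" "y \<in> carrier G" using that by (simp_all add: K_def)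
      have "f s (f x y) \<in> ?S" if s: "s \<in> ?S" for s
      proof -
        have "f s x \<in> ?S" using \<open>x \<in> K\<close> s by (simp add: K_def)
        then have *: "f (f s x) y \<in> ?S" using \<open>y \<in> K\<close> by (simp add: K_def)
        have "s \<in> carrier G" using s S by blast
        then have "f (f s x) y = f s (f x y)" using xy by (rule m_assoc)
        with * show ?thesis by (rule subst[of _ _ "\<lambda>z. z \<in> ?S", rotated])
      qed
      with xy show ?thesis by (simp add: K_def)
    qed
  qed
  moreover have wK: "set w \<subseteq> K" using closed assms(1) carrier by (auto simp: K_def)
  ultimately have gK: "generate G (set w) \<subseteq> K" by (rule generate_subgroup_incl[rotated])
  \<comment> \<open>Since \<open>inv x\<close> lies in \<open>K\<close> and \<open>x\<close> is
    listed, the identity is listed; then each \<open>g\<close> in \<open>K\<close> is listed, being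
    \<open>\<one> \<otimes> g\<close>.\<close>
  obtain x where x: "x \<in> set w" using assms(2) by (cases w) auto
  then have "inv x \<in> K" using gK generate.inv[of x "set w" G] by auto
  moreover have "x \<in> ?S" using inv x by auto
  ultimately have "f x (inv x) \<in> ?S" by (simp add: K_def)
  then have "\<one> \<in> ?S" using x assms(1) carrier by (auto simp: subset_iff)
  then show "generate G (set w) \<subseteq> ?S" using gK by (force simp: K_def)
qed

text \<open>The index of \<open>K\<close> in \<open>K'\<close> divides \<open>n\<close> and differs
  from 1. Each of its prime factors divides \<open>n\<close>, so the index is at least the smallest
  such prime.\<close>

lemma card_proper_subgroup:
  assumes "subgroup K G" "subgroup K' G" "K \<subset> K'"
  shows "smallest_prime_divisor n * card K \<le> card K'"
proof -
  have fin: "finite K'" using subgroup.subset[OF assms(2)] carrier finite_subset by auto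
  have ord: "order G = n" using carrier by (simp add: order_def)
  let ?G = "G\<lparr>carrier := K'\<rparr>"
  interpret K': group ?G using assms(2) by (rule subgroup_imp_group)
  have "subgroup K ?G" using assms by (intro subgroup_incl) auto
  then have d: "card (rcosets\<^bsub>?G\<^esub> K) * card K = card K'"
    using K'.lagrange_finite[of K] fin by (simp add: order_def)
  have "card K' dvd n"
    using lagrange_finite[OF _ assms(2)] carrier ord by (metis dvd_triv_right finite_lessThan)
  then have dn: "card (rcosets\<^bsub>?G\<^esub> K) dvd n" using d by (metis dvd_mult_left)
  have "card (rcosets\<^bsub>?G\<^esub> K) \<noteq> 1"
    using d psubset_card_mono[OF fin assms(3)] by auto
  then obtain q where q: "prime q" "q dvd card (rcosets\<^bsub>?G\<^esub> K)" using prime_factor_nat by blast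
  have "smallest_prime_divisor n \<le> q"
    unfolding smallest_prime_divisor_def by (intro Least_le conjI) (use q dn in auto)
  also have "q \<le> card (rcosets\<^bsub>?G\<^esub> K)"
    using q dn n_pos by (auto intro!: dvd_imp_le intro: Nat.gr0I)
  finally show ?thesis using d by (metis mult_le_mono1)
qed

lemma missing_notin_cl:
  assumes "set w \<subseteq> {..<n}" "length (cl w) < n"
  shows "missing f n w \<notin> set (cl w)"
proof -
  let ?F = "\<lambda>x y. if y \<notin> set (cl w) then y else x"
  \<comment> \<open>Stated for all initial segments to allow induction: an absent element is only
    ever replaced by another absent one.\<close>
  have *: "(\<exists>y<k. y \<notin> set (cl w)) \<longrightarrow> foldl ?F 0 [0..<k] \<notin> set (cl w)" for k
    by (induction k) (auto simp: less_Suc_eq)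
  have "set (cl w) \<noteq> {..<n}" using distinct_card[OF distinct_cl(1)[OF assms(1)]] assms(2) by force
  then have "\<exists>y<n. y \<notin> set (cl w)" using distinct_cl(2)[OF assms(1)] by auto
  then show ?thesis using *[of n] unfolding missing_def by simp
qed

lemma greedy_extend_prefix: "\<exists>v. greedy_extend f n k w = w @ v"
  by (induction k) auto

lemma cl_step:
  assumes "set w \<subseteq> {..<n}" "w \<noteq> []" "length (cl w) < n"
  shows "smallest_prime_divisor n * length (cl w) \<le> length (cl (w @ [missing f n w]))"
proof -
  let ?w = "w @ [missing f n w]"
  have w': "set ?w \<subseteq> {..<n}" "?w \<noteq> []" using assms missing_lt[OF n_pos] by auto
  have "missing f n w \<in> set (cl ?w)"
    using set_cl[OF w'] by (simp add: generate.incl)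
  then have "generate G (set w) \<noteq> generate G (set ?w)"
    using missing_notin_cl[OF assms(1,3)] set_cl[OF w'] set_cl[OF assms(1,2)] by auto
  moreover have "generate G (set w) \<subseteq> generate G (set ?w)" by (rule mono_generate) auto
  ultimately have "generate G (set w) \<subset> generate G (set ?w)" by auto
  then have "smallest_prime_divisor n * card (generate G (set w)) \<le> card (generate G (set ?w))"
    using assms(1) w'(1) carrier by (intro card_proper_subgroup generate_is_subgroup) auto
  then show ?thesis
    using set_cl[OF w'] set_cl[OF assms(1,2)] distinct_card[OF distinct_cl(1)[OF w'(1)]]
      distinct_card[OF distinct_cl(1)[OF assms(1)]] by simp
qed

lemma cl_append_full:
  assumes "set (w @ v) \<subseteq> {..<n}" "w \<noteq> []" "length (cl w) = n"
  shows "length (cl (w @ v)) = n"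
proof -
  have w: "set w \<subseteq> {..<n}" using assms by auto
  have "set (cl w) = {..<n}"
    using distinct_cl[OF w] assms(3) distinct_card[of "cl w"]
    by (intro card_subset_eq) auto
  moreover have "set (cl w) \<subseteq> set (cl (w @ v))"
    using set_cl[OF w assms(2)] set_cl[OF assms(1)] assms(2) mono_generate[of "set w" "set (w @ v)"]
    by auto
  ultimately have "set (cl (w @ v)) = {..<n}" using distinct_cl(2)[OF assms(1)] by auto
  then show ?thesis using distinct_card[OF distinct_cl(1)[OF assms(1)]] by simp
qed

text \<open>Generating the whole group is permanent by \<open>cl_append_full\<close>; until then
  each letter contributes a factor \<open>p\<close> by \<open>cl_step\<close>.\<close>

lemma greedy_extend_growth:
  assumes "set w \<subseteq> {..<n}" "w \<noteq> []"
  shows "length (cl (greedy_extend f n k w)) = n \<or>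
    smallest_prime_divisor n ^ k * length (cl w) \<le> length (cl (greedy_extend f n k w))"
proof (induction k)
  case (Suc k)
  let ?w = "greedy_extend f n k w" and ?p = "smallest_prime_divisor n"
  have w': "set ?w \<subseteq> {..<n}" "?w \<noteq> []"
    using greedy_extend_bounds[OF n_pos assms(1), of f k] assms(2) by auto
  show ?case
  proof (cases "length (cl ?w) = n")
    case True
    then have "length (cl (?w @ [missing f n ?w])) = n"
      using w' missing_lt[OF n_pos] by (intro cl_append_full) auto
    then show ?thesis by simp
  next
    case False
    then have "?p ^ k * length (cl w) \<le> length (cl ?w)" using Suc by simp
    then have "?p * (?p ^ k * length (cl w)) \<le> ?p * length (cl ?w)" by simp
    also have "\<dots> \<le> length (cl (?w @ [missing f n ?w]))"
      using False distinct_cl(3)[OF w'(1)] by (intro cl_step w') simp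
    finally show ?thesis by (simp add: mult.assoc)
  qed
qed simp

end


section \<open>Isomorphisms and codes\<close>

context
  fixes n :: nat and G H :: "nat monoid" and \<phi> :: "nat \<Rightarrow> nat"
  assumes G: "table_group n G" and H: "table_group n H" and iso: "\<phi> \<in> iso G H"
begin

interpretation G: table_group n G by (rule G)
interpretation H: table_group n H by (rule H)

lemma iso_mult: "a < n \<Longrightarrow> b < n \<Longrightarrow> \<phi> (a \<otimes>\<^bsub>G\<^esub> b) = \<phi> a \<otimes>\<^bsub>H\<^esub> \<phi> b"
  using iso G.carrier by (auto simp: iso_def hom_def)

lemma iso_bij: "bij_betw \<phi> {..<n} {..<n}"
  using iso G.carrier H.carrier by (simp add: iso_def)

lemma iso_inj: "A \<subseteq> {..<n} \<Longrightarrow> inj_on \<phi> A"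
  using iso_bij by (meson bij_betw_def inj_on_subset)

text \<open>The range of the listing is part of the induction because \<open>\<phi>\<close> is known
  to be multiplicative and injective only below \<open>n\<close>.\<close>

lemma closure_list_map:
  assumes "set w \<subseteq> {..<n}"
  shows "closure_list (mult H) k (map \<phi> w) = map \<phi> (closure_list (mult G) k w) \<and>
    set (closure_list (mult G) k w) \<subseteq> {..<n}"
proof (induction k)
  case 0
  show ?case
    using assms foldl_ins_map[of \<phi> "[]" w] iso_inj[OF assms]
    by (auto simp: closure_list_def set_foldl_ins)
next
  case (Suc k)
  let ?L = "closure_list (mult G) k w"
  show ?case
  proof (cases "k < length ?L")
    case False
    then show ?thesis using Suc by (simp add: closure_list_Suc expand_def)
  next
    case True
    have L: "?L ! k < n" using True Suc by (auto simp: subset_iff)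
    let ?ys = "map (mult G (?L ! k)) w"
    have ys: "set ?ys \<subseteq> {..<n}" using G.f_lt[OF L] assms by auto
    have "map (mult H (map \<phi> ?L ! k)) (map \<phi> w) = map \<phi> ?ys"
      using True iso_mult[OF L] assms by (auto simp: subset_iff)
    moreover have "foldl insert_new (map \<phi> ?L) (map \<phi> ?ys) = map \<phi> (foldl insert_new ?L ?ys)"
      using ys Suc by (intro foldl_ins_map iso_inj) auto
    ultimately have "foldl insert_new (map \<phi> ?L) (map (mult H (map \<phi> ?L ! k)) (map \<phi> w)) =
        map \<phi> (foldl insert_new ?L ?ys)"
      by (simp only:)
    moreover have "set (foldl insert_new ?L ?ys) \<subseteq> {..<n}" using Suc ys by (simp add: set_foldl_ins)
    ultimately show ?thesis
      using True Suc by (simp add: closure_list_Suc expand_def del: map_map)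
  qed
qed

lemma table_code_map:
  assumes "set L \<subseteq> {..<n}" "length L = n"
  shows "table_code (mult H) n (map \<phi> L) = table_code (mult G) n L"
proof -
  have "posn (map \<phi> L) (map \<phi> L ! a \<otimes>\<^bsub>H\<^esub> map \<phi> L ! b) = posn L (L ! a \<otimes>\<^bsub>G\<^esub> L ! b)"
    if "a < n" "b < n" for a b
  proof -
    have "L ! a < n" "L ! b < n" using that assms by (auto simp: subset_iff)
    then have "map \<phi> L ! a \<otimes>\<^bsub>H\<^esub> map \<phi> L ! b = \<phi> (L ! a \<otimes>\<^bsub>G\<^esub> L ! b)" "L ! a \<otimes>\<^bsub>G\<^esub> L ! b < n"
      using that assms iso_mult G.f_lt by auto
    then show ?thesis using posn_map[OF iso_inj, of "L ! a \<otimes>\<^bsub>G\<^esub> L ! b" L] assms by simp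
  qed
  then show ?thesis unfolding table_code_def by (intro foldl_cong_set) auto
qed

end

text \<open>Send the entry at each position of \<open>L\<close> to the entry at the same position of
  \<open>L'\<close>. Equal codes say that the two tables, written in terms of positions, coincide,
  so this map is multiplicative.\<close>

lemma table_code_eq_imp_iso:
  assumes "table_group n G" "table_group n H"
    and L: "distinct L" "set L \<subseteq> {..<n}" "length L = n"
    and L': "distinct L'" "set L' \<subseteq> {..<n}" "length L' = n"
    and eq: "table_code (mult G) n L = table_code (mult H) n L'"
  shows "G \<cong> H"
proof -
  interpret G: table_group n G by fact
  interpret H: table_group n H by fact
  have full: "set L = {..<n}" "set L' = {..<n}"
    using card_subset_eq[OF _ L(2)] card_subset_eq[OF _ L'(2)] L L'
      distinct_card[of L] distinct_card[of L'] by simp_all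
  have in_L: "L ! a < n" "L' ! a < n" if "a < n" for a
    using that full L L' by (metis lessThan_iff nth_mem)+
  have pos: "posn L (L ! a \<otimes>\<^bsub>G\<^esub> L ! b) = posn L' (L' ! a \<otimes>\<^bsub>H\<^esub> L' ! b)"
    if "a < n" "b < n" for a b
    using eq L(3) L'(3) that by (intro table_code_inject) (auto simp: full G.f_lt H.f_lt in_L)
  define \<phi> where "\<phi> x = L' ! (posn L x - 1)" for x
  have phi: "\<phi> (L ! a) = L' ! a" if "a < n" for a
    using that L by (simp add: \<phi>_def posn_nth)
  have idx: "\<exists>a<n. x = L ! a" if "x < n" for x
    using that full(1) L(3) by (metis in_set_conv_nth lessThan_iff)
  have idx': "\<exists>a<n. x = L' ! a" if "x < n" for x
    using that full(2) L'(3) by (metis in_set_conv_nth lessThan_iff)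
  have "\<phi> \<in> hom G H"
  proof (rule homI)
    fix x assume "x \<in> carrier G"
    then show "\<phi> x \<in> carrier H" using idx phi in_L G.carrier H.carrier by fastforce
  next
    fix x y assume "x \<in> carrier G" "y \<in> carrier G"
    then obtain a b where ab: "a < n" "b < n" "x = L ! a" "y = L ! b"
      using idx G.carrier by (metis lessThan_iff)
    then obtain c c' where c: "c < n" "x \<otimes>\<^bsub>G\<^esub> y = L ! c" "c' < n" "L' ! a \<otimes>\<^bsub>H\<^esub> L' ! b = L' ! c'"
      using idx[of "x \<otimes>\<^bsub>G\<^esub> y"] idx'[of "L' ! a \<otimes>\<^bsub>H\<^esub> L' ! b"] G.f_lt H.f_lt in_L by metis
    then have "c = c'" using pos[OF ab(1,2)] ab L L' by (simp add: posn_nth)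
    then show "\<phi> (x \<otimes>\<^bsub>G\<^esub> y) = \<phi> x \<otimes>\<^bsub>H\<^esub> \<phi> y" using c ab by (simp add: phi)
  qed
  moreover have "bij_betw \<phi> {..<n} {..<n}"
  proof -
    have "{..<n} \<subseteq> \<phi> ` {..<n}"
    proof
      fix x assume "x \<in> {..<n}"
      then obtain a where "a < n" "x = L' ! a" using idx' by auto
      then have "x = \<phi> (L ! a)" "L ! a < n" using phi in_L by auto
      then show "x \<in> \<phi> ` {..<n}" by blast
    qed
    moreover have "\<phi> ` {..<n} \<subseteq> {..<n}" using idx phi in_L by fastforce
    ultimately show ?thesis
      by (auto simp: bij_betw_def intro!: eq_card_imp_inj_on)
  qed
  ultimately show ?thesis
    using G.carrier H.carrier by (intro is_isoI[of \<phi>]) (auto simp: iso_def)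
qed

text \<open>
  For the forward direction, the \<open>s\<close> that an isomorphism maps to the greedy prefix of \<open>H\<close> generates a
  subgroup of order at least \<open>p ^ (c - 1)\<close>, so \<open>c\<close> further greedy steps exhaust \<open>G\<close>; \<open>u\<close> is the image
  of these steps.
\<close>

theorem iso_iff_collision:
  assumes "table_group n G" "table_group n H"
    and c: "1 \<le> c" "n \<le> smallest_prime_divisor n ^ (2 * (c - 1))"
  shows "G \<cong> H \<longleftrightarrow> (\<exists>s u. length s = c \<and> set s \<subseteq> {..<n} \<and> length u = c \<and> set u \<subseteq> {..<n} \<and>
      length (closure_list (mult G) n (greedy_extend (mult G) n c s)) = n \<and>
      length (closure_list (mult H) n (greedy_extend (mult H) n c [] @ u)) = n \<and>
      table_code (mult G) n (closure_list (mult G) n (greedy_extend (mult G) n c s)) =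
      table_code (mult H) n (closure_list (mult H) n (greedy_extend (mult H) n c [] @ u)))"
    (is "_ \<longleftrightarrow> ?R")
proof
  interpret G: table_group n G by fact
  interpret H: table_group n H by fact
  let ?t = "greedy_extend (mult H) n c []" and ?p = "smallest_prime_divisor n"
  {
    assume ?R
    then obtain s u where su: "set s \<subseteq> {..<n}" "set u \<subseteq> {..<n}"
      "length (G.cl (greedy_extend (mult G) n c s)) = n" "length (H.cl (?t @ u)) = n"
      "table_code (mult G) n (G.cl (greedy_extend (mult G) n c s)) = table_code (mult H) n (H.cl (?t @ u))"
      by blast
    have "set (greedy_extend (mult G) n c s) \<subseteq> {..<n}" "set (?t @ u) \<subseteq> {..<n}"
      using greedy_extend_bounds(1)[OF G.n_pos su(1)] greedy_extend_bounds(1)[OF G.n_pos, of "[]"] su(2) by auto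
    then show "G \<cong> H"
      by (intro table_code_eq_imp_iso[OF assms(1,2) _ _ su(3) _ _ su(4,5)]
        G.distinct_cl H.distinct_cl)
  }
  assume "G \<cong> H"
  then have "H \<cong> G" by (rule G.iso_sym)
  then obtain \<psi> where psi: "\<psi> \<in> iso H G" by (auto simp: is_iso_def)
  obtain \<phi> where phi: "\<phi> \<in> iso G H" and inv: "\<And>x. x < n \<Longrightarrow> \<phi> (\<psi> x) = x"
  proof
    show "inv_into (carrier H) \<psi> \<in> iso G H" using psi by (rule H.iso_set_sym)
    show "inv_into (carrier H) \<psi> (\<psi> x) = x" if "x < n" for x
      using that psi H.carrier by (auto simp: iso_def bij_betw_def)
  qed
  define s where "s = map \<psi> ?t"
  have t: "set ?t \<subseteq> {..<n}" "length ?t = c" using greedy_extend_bounds[OF G.n_pos, of "[]" "mult H" c] by auto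
  have psi_lt: "\<psi> x < n" if "x < n" for x
    using iso_bij[OF assms(2,1) psi] that by (auto simp: bij_betw_def)
  have phi_lt: "\<phi> x < n" if "x < n" for x
    using iso_bij[OF assms(1,2) phi] that by (auto simp: bij_betw_def)
  have s: "set s \<subseteq> {..<n}" "length s = c" "s \<noteq> []" and t0: "?t \<noteq> []"
    using t psi_lt c by (auto simp: s_def subset_iff)
  have phi_s: "map \<phi> s = ?t" using t(1) inv by (auto simp: s_def o_def intro!: map_idI)
  obtain v where v: "greedy_extend (mult G) n c s = s @ v" using G.greedy_extend_prefix by blast
  define u where "u = map \<phi> v"
  have sv: "set (s @ v) \<subseteq> {..<n}" "length v = c"
    using greedy_extend_bounds[OF G.n_pos s(1), of "mult G" c] unfolding v using s by auto
  have cl_eq: "H.cl (?t @ u) = map \<phi> (G.cl (s @ v))" "H.cl ?t = map \<phi> (G.cl s)"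
    using closure_list_map[OF assms(1,2) phi sv(1), of n] closure_list_map[OF assms(1,2) phi s(1), of n]
    by (simp_all add: u_def phi_s)
  have full: "length (G.cl (s @ v)) = n"
  proof (rule ccontr)
    assume neq: "length (G.cl (s @ v)) \<noteq> n"
    then have not_full: "length (G.cl s) \<noteq> n" using G.cl_append_full[OF sv(1) s(3)] by auto
    then have "length (H.cl ?t) \<noteq> n" using cl_eq(2) by simp
    \<comment> \<open>The first letter is split off because growth is guaranteed only from a
      nonempty word. It secures order at least 1, so \<open>c - 1\<close> factors \<open>p\<close>
      remain.\<close>
    have "?t = greedy_extend (mult H) n (c - 1) [missing (mult H) n []]"
    proof -
      have "greedy_extend (mult H) n (Suc k) [] = greedy_extend (mult H) n k [missing (mult H) n []]" for k
        by (induction k) auto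
      from this[of "c - 1"] show ?thesis using c(1) by simp
    qed
    moreover have e: "set [missing (mult H) n []] \<subseteq> {..<n}" using missing_lt[OF H.n_pos] by simp
    ultimately have "?p ^ (c - 1) * length (H.cl [missing (mult H) n []]) \<le> length (H.cl ?t)"
      using H.greedy_extend_growth[OF e, of "c - 1"] \<open>length (H.cl ?t) \<noteq> n\<close> by auto
    moreover have "length (H.cl [missing (mult H) n []]) \<ge> 1"
      using H.set_cl[OF e] generate.one[of H "set [missing (mult H) n []]"]
      by (cases "H.cl [missing (mult H) n []]") auto
    ultimately have "?p ^ (c - 1) \<le> length (H.cl ?t)"
      by (metis le_trans mult.right_neutral mult_le_mono2)
    \<comment> \<open>Were the completion of \<open>s\<close> not full, its \<open>c\<close> letters
      would multiply an order of at least \<open>p ^ (c - 1)\<close> by \<open>p ^ c\<close>, which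
      overshoots \<open>n\<close>.\<close>
    then have "?p ^ c * ?p ^ (c - 1) \<le> ?p ^ c * length (G.cl s)" using cl_eq(2) by simp
    also have "\<dots> \<le> length (G.cl (s @ v))"
      using G.greedy_extend_growth[OF s(1,3), of c] neq unfolding v by simp
    also have "\<dots> < n" using neq G.distinct_cl(3)[OF sv(1)] by simp
    also have "\<dots> \<le> ?p ^ (2 * (c - 1))" by (rule c(2))
    also have "\<dots> = ?p ^ (c - 1) * ?p ^ (c - 1)" by (simp add: mult_2 power_add)
    also have "\<dots> \<le> ?p ^ c * ?p ^ (c - 1)"
    proof (cases "?p = 0")
      case False
      then show ?thesis by (intro mult_le_mono1 power_increasing) auto
    next
      \<comment> \<open>No prime divides 1, so for \<open>n = 1\<close> the \<open>LEAST\<close> in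
        \<open>smallest_prime_divisor\<close> is unspecified and might be 0. In that case the
        one-element group is already generated by \<open>s\<close>.\<close>
      case True
      then have "n \<le> 1" using c(2) by (simp add: power_0_left split: if_splits)
      with not_full G.set_cl[OF s(1,3)] G.distinct_cl(3)[OF s(1)] generate.one[of G "set s"]
      show ?thesis by (cases "G.cl s") auto
    qed
    finally show False by simp
  qed
  have "table_code (mult H) n (map \<phi> (G.cl (s @ v))) = table_code (mult G) n (G.cl (s @ v))"
    using G.distinct_cl(2)[OF sv(1)] full by (rule table_code_map[OF assms(1,2) phi])
  moreover have "length u = c" "set u \<subseteq> {..<n}" using sv phi_lt by (auto simp: u_def)
  ultimately show ?R
    using s sv full cl_eq(1) by (intro exI[of _ s] exI[of _ u]) (simp add: v)
qed

section \<open>Subroutines\<close>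

declare exec.simps(13) [simp del]

text \<open>The proof rule for all loops below. The frame facts are handed to the induction step, so
  invariants need to mention only what the body changes.\<close>

lemma For_invariant:
  assumes "r \<notin> writes c" "r \<noteq> l" "l \<notin> writes c" "reg s l = k"
    and "I 0 (set_reg r 0 s)"
    and "\<And>i t. i < k \<Longrightarrow> I i t \<Longrightarrow> reg t r = i \<Longrightarrow>
      (\<And>x. x \<notin> writes c \<Longrightarrow> x \<noteq> r \<Longrightarrow> reg t x = reg s x) \<Longrightarrow>
      (\<And>a. a \<notin> array_writes c \<Longrightarrow> arr t a = arr s a) \<Longrightarrow>
      I (Suc i) (set_reg r (Suc i) (exec xs M c t))"
  shows "I k (exec xs M (For r l c) s)"
proof -
  have "I i (iter xs M r c s i)" if "i \<le> k" for i
    using that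
  proof (induction i)
    case (Suc i)
    have "I (Suc i) (set_reg r (Suc i) (exec xs M c (iter xs M r c s i)))"
      using Suc assms(1) by (intro assms(6)) (auto simp: iter_counter iter_frame_reg iter_frame_arr)
    then show ?case using assms(1) by (simp add: iter_counter)
  qed (use assms(5) in simp)
  then show ?thesis using assms(4) by (simp add: exec_For)
qed

text \<open>Multiplication by repeated addition; a bound on the final sum suffices, since the
  partial sums are smaller.\<close>

lemma add_loop:
  assumes "distinct [r, l, a]" "b \<noteq> r" "b \<noteq> a" "reg s a + reg s l * reg s b \<le> M" "ok s"
  shows "reg (exec xs M (For r l (Plus a a b)) s) a = reg s a + reg s l * reg s b"
    "ok (exec xs M (For r l (Plus a a b)) s)"
proof -
  have "reg (exec xs M (For r l (Plus a a b)) s) a = reg s a + reg s l * reg s b \<and>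
      ok (exec xs M (For r l (Plus a a b)) s)"
  proof (rule For_invariant[where I = "\<lambda>i t. reg t a = reg s a + i * reg s b \<and> ok t"])
    fix i and t :: state
    assume *: "i < reg s l" "reg t a = reg s a + i * reg s b \<and> ok t"
      "\<And>x. x \<notin> writes (Plus a a b) \<Longrightarrow> x \<noteq> r \<Longrightarrow> reg t x = reg s x"
    have "Suc i * reg s b \<le> reg s l * reg s b" using *(1) by (intro mult_le_mono1) simp
    then have "reg s a + i * reg s b + reg s b \<le> M" using assms(4) by simp
    then show "reg (set_reg r (Suc i) (exec xs M (Plus a a b) t)) a = reg s a + Suc i * reg s b \<and>
        ok (set_reg r (Suc i) (exec xs M (Plus a a b) t))"
      using *(2) *(3)[of b] assms(1-3) by auto
  qed (use assms in auto)
  then show "reg (exec xs M (For r l (Plus a a b)) s) a = reg s a + reg s l * reg s b"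
    "ok (exec xs M (For r l (Plus a a b)) s)" by auto
qed

text \<open>
  Arrays: the current word, the listing of the subgroup it generates, the position of each element in
  that listing, and the table of codes seen so far.  The last one is indexed by the codes themselves,
  which have polynomially many bits; this is affordable under logarithmic cost.
\<close>

abbreviation (input) "WRD \<equiv> 0 :: nat"
abbreviation (input) "LST \<equiv> 1 :: nat"
abbreviation (input) "POS \<equiv> 2 :: nat"
abbreviation (input) "HSH \<equiv> 3 :: nat"

abbreviation (input) "rRes \<equiv> 0 :: nat"
abbreviation (input) "rN \<equiv> 1 :: nat"
abbreviation (input) "rOff \<equiv> 2 :: nat"
abbreviation (input) "rC \<equiv> 3 :: nat"
abbreviation (input) "rTuples \<equiv> 4 :: nat"
abbreviation (input) "rCnt \<equiv> 5 :: nat"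
abbreviation (input) "rP \<equiv> 6 :: nat"
abbreviation (input) "rPow \<equiv> 7 :: nat"
abbreviation (input) "rLen \<equiv> 9 :: nat"
abbreviation (input) "rX \<equiv> 10 :: nat"
abbreviation (input) "rY \<equiv> 11 :: nat"
abbreviation (input) "rZ \<equiv> 12 :: nat"
abbreviation (input) "r2C \<equiv> 22 :: nat"
abbreviation (input) "rCode \<equiv> 24 :: nat"
abbreviation (input) "rBase \<equiv> 27 :: nat"

text \<open>The table entry sits at offset plus \<open>b + a * n\<close>. The row number changes
  from call to call and so cannot be a loop limit; the loop runs to \<open>n\<close> and adds only
  while its counter is below \<open>a\<close>.\<close>

definition mul_com :: com where
  "mul_com =
     Plus rZ rOff rY ;;
     For 13 rN (Minus 14 rX 13 ;; IfNZ 14 (Plus rZ rZ rN)) ;;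
     Inp rZ rZ"

text \<open>The count is increased before it is stored, because positions start at one.\<close>

definition insert_com :: com where
  "insert_com = Get 15 POS rZ ;; IfZ 15 (Put LST rCnt rZ ;; Inc rCnt ;; Put POS rZ rCnt)"

text \<open>
  The loops over the word run to the fixed limit \<open>r2C\<close> and test the current length, because loop
  limits that are never written make the step count syntactic.
\<close>

definition build_com :: com where
  "build_com =
     SetC 15 0 ;; For 17 rN (Put POS 17 15) ;;
     SetC rCnt 0 ;;
     For 17 r2C (Minus 18 rLen 17 ;; IfNZ 18 (Get rZ WRD 17 ;; insert_com)) ;;
     For 17 rN (Minus 18 rCnt 17 ;; IfNZ 18 (Get rX LST 17 ;;
       For 19 r2C (Minus 20 rLen 19 ;; IfNZ 20 (Get rY WRD 19 ;; mul_com ;; insert_com))))"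

definition extend_com :: com where
  "extend_com =
     build_com ;;
     SetC 21 0 ;; For 17 rN (Get 15 POS 17 ;; IfZ 15 (Copy 21 17)) ;;
     Put WRD rLen 21 ;; Inc rLen"

definition extends_com :: com where
  "extends_com = For 23 rC extend_com"

definition code_com :: com where
  "code_com =
     SetC rCode 0 ;;
     For 17 rN (Get rX LST 17 ;;
       For 19 rN (Get rY LST 19 ;; mul_com ;; Get 15 POS rZ ;;
         SetC 25 0 ;; For 26 rN (Plus 25 25 rCode) ;; Plus rCode 25 15))"

text \<open>Increments a counter in base \<open>n\<close>, least significant digit first, whose
  digits are the letters of the word; register 28 is the carry. This enumerates all words in place
  and without division.\<close>

definition odometer_com :: com where
  "odometer_com =
     SetC 28 1 ;;
     For 17 rC (Plus 29 rBase 17 ;; Get 30 WRD 29 ;; Plus 30 30 28 ;; SetC 28 0 ;;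
       Equal 31 30 rN ;; IfNZ 31 (SetC 30 0 ;; SetC 28 1) ;; Put WRD 29 30)"

lemma writes_coms [simp]:
  "writes mul_com = {12, 13, 14}"
  "writes insert_com = {5, 15}"
  "writes build_com = {5, 10, 11, 12, 13, 14, 15, 17, 18, 19, 20}"
  "writes extend_com = {5, 9, 10, 11, 12, 13, 14, 15, 17, 18, 19, 20, 21}"
  "writes extends_com = {5, 9, 10, 11, 12, 13, 14, 15, 17, 18, 19, 20, 21, 23}"
  "writes code_com = {10, 11, 12, 13, 14, 15, 17, 19, 24, 25, 26}"
  "writes odometer_com = {17, 28, 29, 30, 31}"
  by (auto simp: mul_com_def insert_com_def build_com_def extend_com_def extends_com_def
      code_com_def odometer_com_def)

lemma array_writes_coms [simp]:
  "array_writes mul_com = {}"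
  "array_writes insert_com = {1, 2}"
  "array_writes build_com = {1, 2}"
  "array_writes extend_com = {0, 1, 2}"
  "array_writes extends_com = {0, 1, 2}"
  "array_writes code_com = {}"
  "array_writes odometer_com = {0}"
  by (auto simp: mul_com_def insert_com_def build_com_def extend_com_def extends_com_def
      code_com_def odometer_com_def)

section \<open>Correctness of the subroutines\<close>

definition holds_word :: "state \<Rightarrow> nat list \<Rightarrow> bool" where
  "holds_word s w \<longleftrightarrow> reg s rLen = length w \<and> (\<forall>i<length w. arr s WRD i = w ! i)"

definition digits :: "nat \<Rightarrow> nat \<Rightarrow> nat \<Rightarrow> nat list" where
  "digits n c k = map (\<lambda>i. k div n ^ i mod n) [0..<c]"

text \<open>The exponent covers every use at once: \<open>n * n\<close> for codes, at most
  \<open>n + 1\<close> for the number of words, and 3 for the polynomial bounds on addresses and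
  products. The factor 8 leaves room for small multiples.\<close>

locale program =
  fixes xs :: "nat list" and M n :: nat
  assumes n_pos: "0 < n" and M_big: "8 * (n + 1) ^ (n * n + n + 3) \<le> M"
begin

lemma M_ge_power: "k \<le> n * n + n + 3 \<Longrightarrow> 8 * (n + 1) ^ k \<le> M"
proof -
  assume "k \<le> n * n + n + 3"
  then have "(n + 1) ^ k \<le> (n + 1) ^ (n * n + n + 3)" by (intro power_increasing) auto
  with M_big show ?thesis by linarith
qed

lemma M_ge: "8 * (n * n * n + n * n + n + 1) \<le> M" "8 * (n * n + n + 1) \<le> M" "8 * (n + 1) \<le> M"
proof -
  have "(n + 1) ^ 3 = n * n * n + 3 * (n * n) + 3 * n + 1"
    by (simp add: power3_eq_cube algebra_simps)
  moreover have "8 * (p + q + n + 1) \<le> 8 * (p + 3 * q + 3 * n + 1)" for p q by simp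
  ultimately show *: "8 * (n * n * n + n * n + n + 1) \<le> M"
    using M_ge_power[of 3] le_trans by simp
  have "8 * (q + n + 1) \<le> 8 * (p + q + n + 1)" "8 * (n + 1) \<le> 8 * (p + q + n + 1)" for p q
    by simp_all
  with * show "8 * (n * n + n + 1) \<le> M" "8 * (n + 1) \<le> M" using le_trans by blast+
qed

abbreviation ex :: "com \<Rightarrow> state \<Rightarrow> state" where
  "ex \<equiv> exec xs M"

definition repr :: "state \<Rightarrow> nat list \<Rightarrow> bool" where
  "repr s L \<longleftrightarrow> reg s rCnt = length L \<and> (\<forall>i<length L. arr s LST i = L ! i) \<and>
     (\<forall>y<n. arr s POS y = posn L y) \<and> distinct L \<and> set L \<subseteq> {..<n}"

lemma repr_length: "repr s L \<Longrightarrow> length L \<le> n"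
  using card_mono[of "{..<n}" "set L"] by (auto simp: repr_def distinct_card)

lemma repr_cong:
  "reg s rCnt = reg t rCnt \<Longrightarrow> arr s LST = arr t LST \<Longrightarrow> arr s POS = arr t POS \<Longrightarrow>
     repr s L = repr t L"
  by (simp add: repr_def)

lemma insert_com_correct:
  assumes "repr s L" "reg s rZ = y" "y < n" "ok s"
  shows "repr (ex insert_com s) (insert_new L y)" "ok (ex insert_com s)"
proof -
  have *: "posn L y = 0 \<longleftrightarrow> y \<notin> set L" by (simp add: posn_def)
  show "repr (ex insert_com s) (insert_new L y)" "ok (ex insert_com s)"
    using assms repr_length[OF assms(1)] M_ge(3)
    by (auto simp: insert_com_def repr_def insert_new_def * posn_append nth_append less_Suc_eq)
qed

end

text \<open>Both tables lie in one input, so \<open>off\<close> selects a table: 1 for the first,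
  behind the entry \<open>n\<close>, and \<open>n * n + 1\<close> for the second. Each subroutine is
  thus verified only once.\<close>

locale table_program = program +
  fixes off :: nat and f :: "nat \<Rightarrow> nat \<Rightarrow> nat"
  assumes off_le: "off \<le> n * n + 1"
    and f_lt: "\<And>a b. a < n \<Longrightarrow> b < n \<Longrightarrow> f a b < n"
    and table: "\<And>a b. a < n \<Longrightarrow> b < n \<Longrightarrow> input_at xs (off + b + a * n) = f a b"
begin

lemma mul_com_correct:
  assumes "reg s rN = n" "reg s rOff = off" "reg s rX = a" "reg s rY = b" "a < n" "b < n" "ok s"
  shows "reg (ex mul_com s) rZ = f a b" "ok (ex mul_com s)"
proof -
  let ?s = "ex (Plus rZ rOff rY) s"
  let ?t = "ex (For 13 rN (Minus 14 rX 13 ;; IfNZ 14 (Plus rZ rZ rN))) ?s"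
  have b1: "off + b + i * n \<le> M" if "i \<le> n" for i
  proof -
    have "off + b + i * n \<le> (n * n + 1) + n + n * n"
      using off_le assms(6) that by (intro add_mono mult_le_mono1) simp_all
    also have "\<dots> \<le> 8 * (n * n + n + 1)" by simp
    finally show ?thesis using M_ge(2) by simp
  qed
  \<comment> \<open>The minimum records that additions cease after \<open>a\<close> rounds.\<close>
  have "reg ?t rZ = off + b + min n a * n \<and> ok ?t"
  proof (rule For_invariant[where I = "\<lambda>i t. reg t rZ = off + b + min i a * n \<and> ok t"])
    show "reg (set_reg 13 0 ?s) rZ = off + b + min 0 a * n \<and> ok (set_reg 13 0 ?s)"
      using assms b1[of 0] by simp
  next
    fix i and t :: state
    assume *: "i < n" "reg t rZ = off + b + min i a * n \<and> ok t" "reg t 13 = i"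
      "\<And>x. x \<notin> writes (Minus 14 rX 13 ;; IfNZ 14 (Plus rZ rZ rN)) \<Longrightarrow> x \<noteq> 13 \<Longrightarrow> reg t x = reg ?s x"
    have "reg t rX = a" "reg t rN = n" using *(4)[of rX] *(4)[of rN] assms by simp_all
    moreover have "min (Suc i) a = Suc (min i a)" if "i < a" using that by simp
    moreover have "min (Suc i) a = min i a" if "\<not> i < a" using that by simp
    ultimately show "reg (set_reg 13 (Suc i) (ex (Minus 14 rX 13 ;; IfNZ 14 (Plus rZ rZ rN)) t)) rZ =
        off + b + min (Suc i) a * n \<and>
        ok (set_reg 13 (Suc i) (ex (Minus 14 rX 13 ;; IfNZ 14 (Plus rZ rZ rN)) t))"
      using *(1-3) b1[of "Suc (min i a)"] by (auto simp: algebra_simps)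
  qed (use assms in auto)
  then show "reg (ex mul_com s) rZ = f a b" "ok (ex mul_com s)"
    using table[OF assms(5,6)] assms(5) by (simp_all add: mul_com_def)
qed

lemma build_com_correct:
  assumes "reg s rN = n" "reg s rOff = off" "holds_word s w" "set w \<subseteq> {..<n}" "length w \<le> reg s r2C" "ok s"
  shows "repr (ex build_com s) (closure_list f n w)" "ok (ex build_com s)"
proof -
  define s1 where "s1 = ex (SetC 15 0 ;; For 17 rN (Put POS 17 15) ;; SetC rCnt 0) s"
  let ?b2 = "Minus 18 rLen 17 ;; IfNZ 18 (Get rZ WRD 17 ;; insert_com)"
  define s2 where "s2 = ex (For 17 r2C ?b2) s1"
  let ?b4 = "Minus 20 rLen 19 ;; IfNZ 20 (Get rY WRD 19 ;; mul_com ;; insert_com)"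
  let ?b3 = "Minus 18 rCnt 17 ;; IfNZ 18 (Get rX LST 17 ;; For 19 r2C ?b4)"
  have w_lt: "w ! i < n" if "i < length w" for i using that assms(4) by (auto simp: subset_iff)
  have "(\<forall>y<n. arr (ex (For 17 rN (Put POS 17 15)) (set_reg 15 0 s)) POS y = 0) \<and>
      ok (ex (For 17 rN (Put POS 17 15)) (set_reg 15 0 s))"
    by (rule For_invariant[where I = "\<lambda>i t. (\<forall>y<i. arr t POS y = 0) \<and> ok t"])
      (use assms in \<open>auto simp: less_Suc_eq\<close>)
  then have "repr s1 []" and ok1: "ok s1" by (simp_all add: s1_def repr_def posn_def)
  have s1: "reg s1 rN = n" "reg s1 rOff = off" "holds_word s1 w" "reg s1 r2C = reg s r2C"
    unfolding s1_def holds_word_def using assms(1-3)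
    by (simp_all add: exec_frame_reg exec_frame_arr holds_word_def)
  \<comment> \<open>\<open>take i w\<close> no longer changes beyond the end of the word, so the
    invariant also covers the idle rounds up to \<open>r2C\<close>.\<close>
  have "repr s2 (foldl insert_new [] (take (reg s r2C) w)) \<and> ok s2"
    unfolding s2_def
  proof (rule For_invariant[where I = "\<lambda>i t. repr t (foldl insert_new [] (take i w)) \<and> ok t"])
    show "repr (set_reg 17 0 s1) (foldl insert_new [] (take 0 w)) \<and> ok (set_reg 17 0 s1)"
      using \<open>repr s1 []\<close> ok1 by (simp add: repr_def)
  next
    fix i and t :: state
    assume *: "repr t (foldl insert_new [] (take i w)) \<and> ok t" "reg t 17 = i"
      "\<And>x. x \<notin> writes ?b2 \<Longrightarrow> x \<noteq> 17 \<Longrightarrow> reg t x = reg s1 x"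
      "\<And>a. a \<notin> array_writes ?b2 \<Longrightarrow> arr t a = arr s1 a"
    have t: "reg t rLen = length w" "\<And>j. j < length w \<Longrightarrow> arr t WRD j = w ! j"
      using *(3)[of rLen] *(4)[of WRD] s1(3) by (simp_all add: holds_word_def)
    show "repr (set_reg 17 (Suc i) (ex ?b2 t)) (foldl insert_new [] (take (Suc i) w)) \<and>
        ok (set_reg 17 (Suc i) (ex ?b2 t))"
    proof (cases "i < length w")
      case False
      then show ?thesis using * t(1) by (simp add: repr_def)
    next
      case True
      let ?u = "set_reg rZ (w ! i) (set_reg 18 (length w - i) t)"
      have "repr ?u (foldl insert_new [] (take i w))" "reg ?u rZ = w ! i" "w ! i < n" "ok ?u"
        using * w_lt[OF True] by (simp_all add: repr_def)
      note ins = insert_com_correct[OF this]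
      have "ex ?b2 t = ex insert_com ?u" using True t * by simp
      then show ?thesis using ins True by (simp add: take_Suc_conv_app_nth repr_def)
    qed
  qed (use s1 in auto)
  then have s2: "repr s2 (closure_list f 0 w)" "ok s2"
    using assms(5) by (simp_all add: closure_list_def)
  have s2': "reg s2 rN = n" "reg s2 rOff = off" "holds_word s2 w" "reg s2 r2C = reg s r2C"
    unfolding s2_def holds_word_def using s1
    by (simp_all add: exec_frame_reg exec_frame_arr holds_word_def)
  have "repr (ex (For 17 rN ?b3) s2) (closure_list f n w) \<and> ok (ex (For 17 rN ?b3) s2)"
  proof (rule For_invariant[where I = "\<lambda>a t. repr t (closure_list f a w) \<and> ok t"])
    show "repr (set_reg 17 0 s2) (closure_list f 0 w) \<and> ok (set_reg 17 0 s2)"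
      using s2 by (simp add: repr_def)
  next
    fix a and t :: state
    assume *: "repr t (closure_list f a w) \<and> ok t" "reg t 17 = a"
      "\<And>x. x \<notin> writes ?b3 \<Longrightarrow> x \<noteq> 17 \<Longrightarrow> reg t x = reg s2 x"
      "\<And>a. a \<notin> array_writes ?b3 \<Longrightarrow> arr t a = arr s2 a"
    let ?L = "closure_list f a w"
    have t: "reg t rLen = length w" "\<And>j. j < length w \<Longrightarrow> arr t WRD j = w ! j"
      "reg t rN = n" "reg t rOff = off" "reg t r2C = reg s r2C"
      using *(3)[of rLen] *(3)[of rN] *(3)[of rOff] *(3)[of r2C] *(4)[of WRD] s2'
      by (simp_all add: holds_word_def)
    show "repr (set_reg 17 (Suc a) (ex ?b3 t)) (closure_list f (Suc a) w) \<and>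
        ok (set_reg 17 (Suc a) (ex ?b3 t))"
    proof (cases "a < length ?L")
      case False
      then show ?thesis using *(1,2) by (simp add: closure_list_Suc expand_def repr_def)
    next
      case True
      define u where "u = set_reg rX (?L ! a) (set_reg 18 (length ?L - a) t)"
      have u: "reg u rLen = length w" "\<And>j. j < length w \<Longrightarrow> arr u WRD j = w ! j"
        "reg u rN = n" "reg u rOff = off" "reg u r2C = reg s r2C" "reg u rX = ?L ! a"
        "repr u ?L" "ok u"
        using t * by (simp_all add: u_def repr_def)
      have La: "?L ! a < n" using True u(7) by (auto simp: repr_def subset_iff)
      have "repr (ex (For 19 r2C ?b4) u) (foldl insert_new ?L (map (f (?L ! a)) (take (reg s r2C) w))) \<and>
        ok (ex (For 19 r2C ?b4) u)"
      proof (rule For_invariant[where I = "\<lambda>j v. repr v (foldl insert_new ?L (map (f (?L ! a)) (take j w))) \<and> ok v"])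
        show "repr (set_reg 19 0 u) (foldl insert_new ?L (map (f (?L ! a)) (take 0 w))) \<and> ok (set_reg 19 0 u)"
          using u by (simp add: repr_def)
      next
        fix j and v :: state
        assume **: "repr v (foldl insert_new ?L (map (f (?L ! a)) (take j w))) \<and> ok v" "reg v 19 = j"
          "\<And>x. x \<notin> writes ?b4 \<Longrightarrow> x \<noteq> 19 \<Longrightarrow> reg v x = reg u x"
          "\<And>a. a \<notin> array_writes ?b4 \<Longrightarrow> arr v a = arr u a"
        have v: "reg v rLen = length w" "\<And>j. j < length w \<Longrightarrow> arr v WRD j = w ! j"
          "reg v rN = n" "reg v rOff = off" "reg v rX = ?L ! a"
          using **(3)[of rLen] **(3)[of rN] **(3)[of rOff] **(3)[of rX] **(4)[of WRD] u
          by simp_all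
        show "repr (set_reg 19 (Suc j) (ex ?b4 v)) (foldl insert_new ?L (map (f (?L ! a)) (take (Suc j) w))) \<and>
          ok (set_reg 19 (Suc j) (ex ?b4 v))"
        proof (cases "j < length w")
          case False
          then show ?thesis using **(1,2) v(1) by (simp add: repr_def)
        next
          case True
          define x where "x = set_reg rY (w ! j) (set_reg 20 (length w - j) v)"
          have x: "reg x rN = n" "reg x rOff = off" "reg x rX = ?L ! a" "reg x rY = w ! j"
            "repr x (foldl insert_new ?L (map (f (?L ! a)) (take j w)))" "ok x"
            using v ** by (simp_all add: x_def repr_def)
          note mul = mul_com_correct[OF x(1-4) La w_lt[OF True] x(6)]
          have "repr (ex mul_com x) (foldl insert_new ?L (map (f (?L ! a)) (take j w)))"
            using x(5) by (subst repr_cong[of _ x]) (simp_all add: exec_frame_reg exec_frame_arr)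
          note ins = insert_com_correct[OF this mul(1) f_lt[OF La w_lt[OF True]] mul(2)]
          have "ex ?b4 v = ex insert_com (ex mul_com x)" using True v ** by (simp add: x_def)
          then show ?thesis using ins True by (simp add: take_Suc_conv_app_nth repr_def)
        qed
      qed (use u in auto)
      then have "repr (ex (For 19 r2C ?b4) u) (closure_list f (Suc a) w)" "ok (ex (For 19 r2C ?b4) u)"
        using True assms(5) by (simp_all add: closure_list_Suc expand_def)
      moreover have "ex ?b3 t = ex (For 19 r2C ?b4) u"
        using True * by (simp add: u_def repr_def)
      ultimately show ?thesis by (simp add: repr_def)
    qed
  qed (use s2' in auto)
  then show "repr (ex build_com s) (closure_list f n w)" "ok (ex build_com s)"
    by (simp_all add: build_com_def s1_def s2_def)
qed

lemma extend_com_correct: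
  assumes "reg s rN = n" "reg s rOff = off" "holds_word s w" "set w \<subseteq> {..<n}" "length w \<le> reg s r2C" "ok s"
    "length w < M"
  shows "holds_word (ex extend_com s) (w @ [missing f n w])" "ok (ex extend_com s)"
    "i \<noteq> length w \<Longrightarrow> arr (ex extend_com s) WRD i = arr s WRD i"
proof -
  let ?s = "ex build_com s" and ?L = "closure_list f n w"
  let ?b = "Get 15 POS 17 ;; IfZ 15 (Copy 21 17)"
  let ?F = "\<lambda>x y. if y \<notin> set ?L then y else x"
  define t where "t = ex (For 17 rN ?b) (set_reg 21 0 ?s)"
  note build = build_com_correct[OF assms(1-6)]
  have "reg t 21 = foldl ?F 0 [0..<n] \<and> ok t"
    unfolding t_def
  proof (rule For_invariant[where I = "\<lambda>i t. reg t 21 = foldl ?F 0 [0..<i] \<and> ok t"])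
    fix i and u :: state
    assume *: "i < n" "reg u 21 = foldl ?F 0 [0..<i] \<and> ok u" "reg u 17 = i"
      "\<And>a. a \<notin> array_writes ?b \<Longrightarrow> arr u a = arr (set_reg 21 0 ?s) a"
    have "arr u POS i = posn ?L i" using *(4)[of POS] build(1) *(1) by (simp add: repr_def)
    then show "reg (set_reg 17 (Suc i) (ex ?b u)) 21 = foldl ?F 0 [0..<Suc i] \<and>
        ok (set_reg 17 (Suc i) (ex ?b u))"
      using * by (auto simp: posn_def)
  qed (use assms(1) build(2) in \<open>auto simp: exec_frame_reg\<close>)
  then have t: "reg t 21 = missing f n w" "ok t" by (simp_all add: missing_def)
  have t': "reg t rLen = length w" "arr t WRD = arr s WRD"
    unfolding t_def using assms(3) by (simp_all add: exec_frame_reg exec_frame_arr holds_word_def)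
  have e: "ex extend_com s = ex (Put WRD rLen 21 ;; Inc rLen) t"
    by (simp add: extend_com_def t_def)
  show "holds_word (ex extend_com s) (w @ [missing f n w])" "ok (ex extend_com s)"
    unfolding e using t t' assms(3,7) by (auto simp: holds_word_def nth_append less_Suc_eq)
  show "arr (ex extend_com s) WRD i = arr s WRD i" if "i \<noteq> length w"
    unfolding e using t' that by simp
qed

text \<open>The third claim keeps the initial letters, which serve as the digits of the odometer,
  intact for the next increment.\<close>

lemma extends_com_correct:
  assumes "reg s rN = n" "reg s rOff = off" "holds_word s w" "set w \<subseteq> {..<n}" "reg s rC = c"
    "length w + c \<le> reg s r2C" "ok s" "length w + c \<le> M"
  shows "holds_word (ex extends_com s) (greedy_extend f n c w)" "ok (ex extends_com s)"
    "i < length w \<Longrightarrow> arr (ex extends_com s) WRD i = arr s WRD i"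
proof -
  have "holds_word (ex extends_com s) (greedy_extend f n c w) \<and> ok (ex extends_com s) \<and>
      (\<forall>i<length w. arr (ex extends_com s) WRD i = arr s WRD i)"
    unfolding extends_com_def
  proof (rule For_invariant[where I = "\<lambda>k t. holds_word t (greedy_extend f n k w) \<and> ok t \<and>
      (\<forall>i<length w. arr t WRD i = arr s WRD i)"])
    fix k and t :: state
    assume *: "k < c" "holds_word t (greedy_extend f n k w) \<and> ok t \<and> (\<forall>i<length w. arr t WRD i = arr s WRD i)"
      "\<And>x. x \<notin> writes extend_com \<Longrightarrow> x \<noteq> 23 \<Longrightarrow> reg t x = reg s x"
    have t: "reg t rN = n" "reg t rOff = off" "reg t r2C = reg s r2C"
      using *(3)[of rN] *(3)[of rOff] *(3)[of r2C] assms by simp_all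
    note b = greedy_extend_bounds[OF n_pos assms(4), of f k]
    have "length (greedy_extend f n k w) \<le> reg t r2C" "length (greedy_extend f n k w) < M"
      using b t(3) assms(6,8) *(1) by simp_all
    note e = extend_com_correct[OF t(1,2) _ _ this(1) _ this(2)]
    show "holds_word (set_reg 23 (Suc k) (ex extend_com t)) (greedy_extend f n (Suc k) w) \<and>
        ok (set_reg 23 (Suc k) (ex extend_com t)) \<and>
        (\<forall>i<length w. arr (set_reg 23 (Suc k) (ex extend_com t)) WRD i = arr s WRD i)"
    proof (intro conjI allI impI)
      fix i assume "i < length w"
      then show "arr (set_reg 23 (Suc k) (ex extend_com t)) WRD i = arr s WRD i"
        using e(3)[of i] *(2) b by simp
    qed (use e(1,2) *(2) b in \<open>simp_all add: holds_word_def\<close>)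
  qed (use assms in \<open>auto simp: holds_word_def greedy_extend_def\<close>)
  then show "holds_word (ex extends_com s) (greedy_extend f n c w)" "ok (ex extends_com s)"
    "i < length w \<Longrightarrow> arr (ex extends_com s) WRD i = arr s WRD i" by auto
qed

text \<open>Besides the value, the invariants bound the code by \<open>(n + 1)\<close> to the number
  of digits read so far; this is what shows that no addition exceeds \<open>M\<close>.\<close>

lemma code_com_correct:
  assumes "reg s rN = n" "reg s rOff = off" "repr s L" "length L = n" "ok s"
  shows "reg (ex code_com s) rCode = table_code f n L" "ok (ex code_com s)"
proof -
  let ?b2 = "Get rY LST 19 ;; mul_com ;; Get 15 POS rZ ;;
         SetC 25 0 ;; For 26 rN (Plus 25 25 rCode) ;; Plus rCode 25 15"
  let ?b1 = "Get rX LST 17 ;; For 19 rN ?b2"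
  define F where "F a = (\<lambda>k b. k * n + posn L (f (L ! a) (L ! b)))" for a
  let ?s = "set_reg rCode 0 s"
  have L_lt: "L ! a < n" if "a < n" for a
    using that assms(3,4) by (auto simp: repr_def subset_iff)
  have pow_le: "(n + 1) ^ k \<le> M" if "k \<le> n * n" for k
    using M_ge_power[of k] that by simp
  have "(reg (ex (For 17 rN ?b1) ?s) rCode = foldl (\<lambda>k a. foldl (F a) k [0..<n]) 0 [0..<n] \<and>
      reg (ex (For 17 rN ?b1) ?s) rCode < (n + 1) ^ (n * n)) \<and> ok (ex (For 17 rN ?b1) ?s)"
  proof (rule For_invariant[where I = "\<lambda>a t. (reg t rCode = foldl (\<lambda>k a. foldl (F a) k [0..<n]) 0 [0..<a] \<and>
      reg t rCode < (n + 1) ^ (n * a)) \<and> ok t"])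
    fix a and t :: state
    assume *: "a < n" "(reg t rCode = foldl (\<lambda>k a. foldl (F a) k [0..<n]) 0 [0..<a] \<and>
      reg t rCode < (n + 1) ^ (n * a)) \<and> ok t" "reg t 17 = a"
      "\<And>x. x \<notin> writes ?b1 \<Longrightarrow> x \<noteq> 17 \<Longrightarrow> reg t x = reg ?s x"
      "\<And>k. k \<notin> array_writes ?b1 \<Longrightarrow> arr t k = arr ?s k"
    let ?k = "foldl (\<lambda>k a. foldl (F a) k [0..<n]) 0 [0..<a]"
    define u where "u = set_reg rX (L ! a) t"
    have arrs: "arr t LST = arr s LST" "arr t POS = arr s POS"
      using *(5)[of LST] *(5)[of POS] by simp_all
    have u: "reg u rN = n" "reg u rOff = off" "reg u rX = L ! a" "reg u rCode = ?k"
      "arr u LST = arr s LST" "arr u POS = arr s POS" "ok u" "?k < (n + 1) ^ (n * a)"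
      using *(2) *(4)[of rN] *(4)[of rOff] assms arrs by (simp_all add: u_def)
    have "(reg (ex (For 19 rN ?b2) u) rCode = foldl (F a) ?k [0..<n] \<and>
        reg (ex (For 19 rN ?b2) u) rCode < (n + 1) ^ (n * a + n)) \<and> ok (ex (For 19 rN ?b2) u)"
    proof (rule For_invariant[where I = "\<lambda>b v. (reg v rCode = foldl (F a) ?k [0..<b] \<and>
        reg v rCode < (n + 1) ^ (n * a + b)) \<and> ok v"])
      fix b and v :: state
      assume **: "b < n" "(reg v rCode = foldl (F a) ?k [0..<b] \<and>
          reg v rCode < (n + 1) ^ (n * a + b)) \<and> ok v" "reg v 19 = b"
        "\<And>x. x \<notin> writes ?b2 \<Longrightarrow> x \<noteq> 19 \<Longrightarrow> reg v x = reg u x"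
        "\<And>k. k \<notin> array_writes ?b2 \<Longrightarrow> arr v k = arr u k"
      let ?q = "reg v rCode" and ?d = "posn L (f (L ! a) (L ! b))"
      define x where "x = set_reg rY (L ! b) v"
      have arrs: "arr v LST = arr s LST" "arr v POS = arr s POS"
        using **(5)[of LST] **(5)[of POS] u by simp_all
      have x: "reg x rN = n" "reg x rOff = off" "reg x rX = L ! a" "reg x rY = L ! b" "ok x"
        using **(2) **(4)[of rN] **(4)[of rOff] **(4)[of rX] u by (simp_all add: x_def)
      note mul = mul_com_correct[OF x(1-4) L_lt[OF *(1)] L_lt[OF **(1)] x(5)]
      define y where "y = ex (Get 15 POS rZ ;; SetC 25 0) (ex mul_com x)"
      have y: "reg y 15 = ?d" "reg y 25 = 0" "reg y rCode = ?q" "reg y rN = n" "ok y"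
        using mul arrs assms(3) f_lt[OF L_lt[OF *(1)] L_lt[OF **(1)]] x(1)
        by (simp_all add: y_def exec_frame_reg exec_frame_arr x_def repr_def)
      \<comment> \<open>A digit is at most \<open>n\<close>, and \<open>?q * n + n\<close> is less
        than \<open>Suc ?q * (n + 1)\<close>; so one more digit costs one more factor
        \<open>n + 1\<close>.\<close>
      have "Suc ?q \<le> (n + 1) ^ (n * a + b)" using **(2) by simp
      then have "Suc ?q * (n + 1) \<le> (n + 1) ^ (n * a + b) * (n + 1)" by (rule mult_le_mono1)
      then have q: "?q * n + n < (n + 1) ^ (n * a + Suc b)" by (simp add: algebra_simps)
      also have "\<dots> \<le> M"
      proof (rule pow_le)
        have "n * a + Suc b \<le> n * a + n" using **(1) by simp
        also have "\<dots> = n * Suc a" by simp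
        also have "\<dots> \<le> n * n" using *(1) by (intro mult_le_mono2) simp
        finally show "n * a + Suc b \<le> n * n" .
      qed
      finally have qM: "?q * n + n \<le> M" by simp
      define z where "z = ex (For 26 rN (Plus 25 25 rCode)) y"
      have "reg z 25 = n * ?q" "ok z"
        unfolding z_def using add_loop[of 26 rN 25 rCode y M] y qM by (simp_all add: mult.commute)
      moreover have "reg z 15 = ?d" using y(1) by (simp add: z_def exec_frame_reg)
      moreover have "ex ?b2 v = ex (Plus rCode 25 15) z"
        using **(1,3) arrs assms(3,4) by (simp add: x_def y_def z_def repr_def)
      moreover have "?d \<le> n" using posn_le[of L] assms(4) by metis
      ultimately show "(reg (set_reg 19 (Suc b) (ex ?b2 v)) rCode = foldl (F a) ?k [0..<Suc b] \<and>
          reg (set_reg 19 (Suc b) (ex ?b2 v)) rCode < (n + 1) ^ (n * a + Suc b)) \<and>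
          ok (set_reg 19 (Suc b) (ex ?b2 v))"
        using **(2) q qM by (simp add: F_def mult.commute del: power_Suc add_Suc_right)
    qed (use u in auto)
    moreover have "ex ?b1 t = ex (For 19 rN ?b2) u"
      using *(1,3) arrs assms(3,4) by (simp add: u_def repr_def)
    ultimately show "(reg (set_reg 17 (Suc a) (ex ?b1 t)) rCode =
        foldl (\<lambda>k a. foldl (F a) k [0..<n]) 0 [0..<Suc a] \<and>
        reg (set_reg 17 (Suc a) (ex ?b1 t)) rCode < (n + 1) ^ (n * Suc a)) \<and>
        ok (set_reg 17 (Suc a) (ex ?b1 t))"
      by (simp add: add.commute)
  qed (use assms in auto)
  then show "reg (ex code_com s) rCode = table_code f n L" "ok (ex code_com s)"
    by (simp_all add: code_com_def table_code_def F_def)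
qed

end


context program
begin

text \<open>The carry into digit \<open>i\<close> is 1 iff \<open>n ^ i\<close> divides
  \<open>Suc k\<close>. Being stated through \<open>div\<close> and \<open>mod\<close>, the claim
  also allows the overflow after the last word.\<close>

lemma odometer_com_correct:
  assumes "reg s rN = n" "reg s rC = c" "reg s rBase = d" "d + c \<le> M" "ok s"
    and "\<And>i. i < c \<Longrightarrow> arr s WRD (d + i) = k div n ^ i mod n"
  shows "\<And>i. i < c \<Longrightarrow> arr (ex odometer_com s) WRD (d + i) = Suc k div n ^ i mod n"
    and "\<And>j. j < d \<or> d + c \<le> j \<Longrightarrow> arr (ex odometer_com s) WRD j = arr s WRD j"
    and "ok (ex odometer_com s)"
proof -
  let ?b = "Plus 29 rBase 17 ;; Get 30 WRD 29 ;; Plus 30 30 28 ;; SetC 28 0 ;;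
       Equal 31 30 rN ;; IfNZ 31 (SetC 30 0 ;; SetC 28 1) ;; Put WRD 29 30"
  let ?s = "set_reg 28 1 s"
  define I where "I i t \<longleftrightarrow> (\<forall>j<i. arr t WRD (d + j) = Suc k div n ^ j mod n) \<and>
    (\<forall>j. j < d \<or> d + i \<le> j \<longrightarrow> arr t WRD j = arr s WRD j) \<and>
    reg t 28 = (if Suc k mod n ^ i = 0 then 1 else 0) \<and> ok t" for i and t :: state
  have "I c (ex (For 17 rC ?b) ?s)"
  proof (rule For_invariant[where I = I])
    show "I 0 (set_reg 17 0 ?s)" using assms(5) by (simp add: I_def)
  next
    fix i and t :: state
    assume *: "i < c" "I i t" "reg t 17 = i"
      "\<And>x. x \<notin> writes ?b \<Longrightarrow> x \<noteq> 17 \<Longrightarrow> reg t x = reg ?s x"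
    let ?q = "n ^ i" and ?x = "k div n ^ i mod n"
    have t: "reg t rBase = d" "reg t rN = n" "arr t WRD (d + i) = ?x"
      using *(1,2) *(4)[of rBase] *(4)[of rN] assms by (simp_all add: I_def)
    have x: "?x < n" using n_pos by simp
    define e where "e = (if Suc k mod ?q = 0 then 1 else 0 :: nat)"
    have e: "reg t 28 = e" "ok t" using *(2) by (simp_all add: I_def e_def)
    have sk: "Suc k div ?q = k div ?q + e" by (simp add: div_Suc e_def)
    have new: "Suc k div ?q mod n = (if ?x + e = n then 0 else ?x + e)"
      unfolding sk using x by (auto simp: e_def mod_Suc)
    \<comment> \<open>\<open>mod_mult2_eq\<close> separates the new digit from the lower digits,
      which all vanish exactly when a carry came in.\<close>
    have carry: "Suc k mod n ^ Suc i = 0 \<longleftrightarrow> ?x + e = n"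
    proof -
      have "Suc k mod (?q * n) = ?q * (Suc k div ?q mod n) + Suc k mod ?q"
        by (rule mod_mult2_eq)
      then have "Suc k mod n ^ Suc i = 0 \<longleftrightarrow> Suc k div ?q mod n = 0 \<and> e = 1"
        using n_pos by (auto simp: e_def mult.commute)
      also have "\<dots> \<longleftrightarrow> ?x + e = n" using x unfolding new by (auto simp: e_def)
      finally show ?thesis .
    qed
    have di: "d + i \<le> M" using *(1) assms(4) by simp
    have xe: "?x + e \<le> M" using x M_ge(3) by (simp add: e_def)
    have st: "arr (ex ?b t) = (arr t)(WRD := (arr t WRD)(d + i := Suc k div ?q mod n))"
      "reg (ex ?b t) 28 = (if Suc k mod n ^ Suc i = 0 then 1 else 0)" "ok (ex ?b t)"
      unfolding carry new using e t *(3) di xe by (simp_all add: fun_eq_iff)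
    show "I (Suc i) (set_reg 17 (Suc i) (ex ?b t))"
    proof -
      have I: "\<And>j. j < i \<Longrightarrow> arr t WRD (d + j) = Suc k div n ^ j mod n"
        "\<And>j. j < d \<or> d + i \<le> j \<Longrightarrow> arr t WRD j = arr s WRD j"
        using *(2) unfolding I_def by blast+
      have "arr (ex ?b t) WRD (d + j) = Suc k div n ^ j mod n" if "j < Suc i" for j
        unfolding st(1) using that I(1)[of j] by (cases "j = i") simp_all
      moreover have "arr (ex ?b t) WRD j = arr s WRD j" if "j < d \<or> d + Suc i \<le> j" for j
        unfolding st(1) using that I(2)[of j] by auto
      ultimately show ?thesis unfolding I_def using st(2,3)
        by (simp del: power_Suc exec.simps)
    qed
  qed (use assms in auto)
  moreover have "ex odometer_com s = ex (For 17 rC ?b) ?s" by (simp add: odometer_com_def)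
  ultimately have "I c (ex odometer_com s)" by (simp only:)
  then show "\<And>i. i < c \<Longrightarrow> arr (ex odometer_com s) WRD (d + i) = Suc k div n ^ i mod n"
    and "\<And>j. j < d \<or> d + c \<le> j \<Longrightarrow> arr (ex odometer_com s) WRD j = arr s WRD j"
    and "ok (ex odometer_com s)"
    unfolding I_def by blast+
qed

end

section \<open>The isomorphism test\<close>

lemma digits_surj:
  fixes n :: nat
  assumes "set s \<subseteq> {..<n}"
  shows "\<exists>k < n ^ length s. digits n (length s) k = s"
  using assms
proof (induction s)
  case Nil
  then show ?case by (auto simp: digits_def)
next
  case (Cons x s)
  then obtain k where k: "k < n ^ length s" "digits n (length s) k = s" by auto
  have x: "x < n" using Cons.prems by simp
  let ?k = "x + n * k"
  have "?k div n ^ Suc i mod n = k div n ^ i mod n" for i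
    using x by (simp add: div_mult2_eq)
  then have "digits n (length (x # s)) ?k = x # digits n (length s) k"
    using x by (simp add: digits_def map_upt_Suc del: upt_Suc power_Suc)
  moreover have "?k < n ^ length (x # s)"
  proof -
    have "?k < n * Suc k" using x by simp
    also have "\<dots> \<le> n * n ^ length s" using k(1) by (intro mult_le_mono2) simp
    finally show ?thesis by simp
  qed
  ultimately show ?case using k(2) by auto
qed

lemma digits_bounds: "0 < n \<Longrightarrow> set (digits n c k) \<subseteq> {..<n}" "length (digits n c k) = c"
  by (auto simp: digits_def)

lemma digits_nth: "i < c \<Longrightarrow> digits n c k ! i = k div n ^ i mod n"
  by (simp add: digits_def)

definition read_com :: com where
  "read_com = SetC 16 0 ;; Inp rN 16 ;; SetC 16 1 ;; Minus 33 rN 16 ;; SetC rP 1"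

text \<open>Candidates descend from \<open>n\<close> to 2 and later divisors overwrite earlier ones,
  so the least divisor above 1 survives. Divisibility is tested by running through the
  multiples.\<close>

definition prime_com :: com where
  "prime_com = For 34 33 (Minus 35 rN 34 ;; SetC 36 0 ;;
     For 37 rN (Plus 36 36 35 ;; Equal 38 36 rN ;; IfNZ 38 (Copy rP 35)))"

text \<open>Finds the least \<open>e\<close> with \<open>n \<le> p ^ (2 * e)\<close> and returns
  \<open>c = e + 1\<close>, the extra unit paying for the first letter. Each active round multiplies
  by \<open>p\<close> twice; \<open>n\<close> rounds suffice since \<open>n < 2 ^ n\<close>.\<close>

definition half_com :: com where
  "half_com = SetC rC 1 ;; SetC rPow 1 ;;
     For 34 rN (Minus 35 rN rPow ;; IfNZ 35 (
       SetC 36 0 ;; For 37 rP (Plus 36 36 rPow) ;;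
       SetC rPow 0 ;; For 37 rP (Plus rPow rPow 36) ;; Inc rC))"

definition tuples_com :: com where
  "tuples_com = SetC rTuples 1 ;;
     For 34 rC (SetC 36 0 ;; For 37 rN (Plus 36 36 rTuples) ;; Copy rTuples 36) ;;
     Plus r2C rC rC ;; SetC rOff 1 ;; SetC rBase 0"

text \<open>Resetting the length discards the greedy letters of the previous round. The listing is
  rebuilt because \<open>extends_com\<close> does not relist after its last letter.\<close>

definition store_body :: com where
  "store_body = Copy rLen rC ;; extends_com ;; build_com ;; Equal 32 rCnt rN ;;
     IfNZ 32 (code_com ;; SetC 16 1 ;; Put HSH rCode 16) ;; odometer_com"

text \<open>Switches to the second table, fixes its greedy prefix, and clears the next
  \<open>c\<close> letters, which become the digits of the second odometer.\<close>

definition prefix_com :: com where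
  "prefix_com = For 34 rN (Plus rOff rOff rN) ;; SetC rLen 0 ;; extends_com ;;
     SetC 16 0 ;; For 34 rC (Plus 29 rC 34 ;; Put WRD 29 16) ;; Copy rBase rC ;; Copy rLen r2C"

definition lookup_body :: com where
  "lookup_body = build_com ;; Equal 32 rCnt rN ;;
     IfNZ 32 (code_com ;; Get 15 HSH rCode ;; IfNZ 15 (SetC rRes 1)) ;; odometer_com"

definition main_com :: com where
  "main_com = read_com ;; prime_com ;; half_com ;; tuples_com ;;
     For 40 rTuples store_body ;; prefix_com ;; For 40 rTuples lookup_body"

lemma writes_main [simp]:
  "writes read_com = {1, 6, 16, 33}"
  "writes prime_com = {6, 34, 35, 36, 37, 38}"
  "writes half_com = {3, 7, 34, 35, 36, 37}"
  "writes tuples_com = {2, 4, 22, 27, 34, 36, 37}"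
  "writes store_body = {5, 9, 10, 11, 12, 13, 14, 15, 16, 17, 18, 19, 20, 21, 23, 24, 25, 26, 28, 29, 30, 31, 32}"
  "writes prefix_com = {2, 5, 9, 10, 11, 12, 13, 14, 15, 16, 17, 18, 19, 20, 21, 23, 27, 29, 34}"
  "writes lookup_body = {0, 5, 10, 11, 12, 13, 14, 15, 17, 18, 19, 20, 24, 25, 26, 28, 29, 30, 31, 32}"
  by (auto simp: read_com_def prime_com_def half_com_def tuples_com_def store_body_def
      prefix_com_def lookup_body_def)

lemma array_writes_main [simp]:
  "array_writes read_com = {}" "array_writes prime_com = {}" "array_writes half_com = {}"
  "array_writes tuples_com = {}" "array_writes store_body = {0, 1, 2, 3}"
  "array_writes prefix_com = {0, 1, 2}" "array_writes lookup_body = {0, 1, 2}"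
  by (auto simp: read_com_def prime_com_def half_com_def tuples_com_def store_body_def
      prefix_com_def lookup_body_def)

lemma least_divisor_eq_smallest_prime_divisor:
  assumes "p dvd n" "1 < p" "\<And>q. 1 < q \<Longrightarrow> q dvd n \<Longrightarrow> q \<le> n \<Longrightarrow> p \<le> q" "0 < n"
  shows "p = smallest_prime_divisor n"
proof -
  obtain q where q: "prime q" "q dvd p" using assms(2) prime_factor_nat[of p] by auto
  then have "q dvd n" using assms(1) dvd_trans by blast
  then have "p \<le> q" using assms(3)[of q] assms(4) prime_gt_1_nat[OF q(1)] dvd_imp_le[of q n] by simp
  moreover have "q \<le> p" using q(2) assms(2) by (intro dvd_imp_le) auto
  ultimately have "prime p" using q(1) by (simp add: le_antisym)
  show ?thesis
    unfolding smallest_prime_divisor_def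
  proof (rule Least_equality[symmetric])
    fix q assume "prime q \<and> q dvd n"
    then show "p \<le> q" using assms(3)[of q] assms(4) prime_gt_1_nat[of q] dvd_imp_le[of q n] by simp
  qed (use assms(1) \<open>prime p\<close> in simp)
qed

section \<open>Correctness of the main program\<close>

context program
begin

lemma prime_com_correct:
  assumes "reg s rN = n" "reg s 33 = n - 1" "reg s rP = 1" "ok s"
  shows "ok (ex prime_com s)" "1 \<le> reg (ex prime_com s) rP" "reg (ex prime_com s) rP \<le> n"
    "2 \<le> n \<Longrightarrow> reg (ex prime_com s) rP = smallest_prime_divisor n"
proof -
  let ?b2 = "Plus 36 36 35 ;; Equal 38 36 rN ;; IfNZ 38 (Copy rP 35)"
  let ?b1 = "Minus 35 rN 34 ;; SetC 36 0 ;; For 37 rN ?b2"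
  \<comment> \<open>After \<open>i\<close> rounds the candidates above \<open>n - i\<close> have
    been tried. The initial value 1 is not among them, hence the separate clause for
    \<open>i = 0\<close>.\<close>
  define I where "I i t \<longleftrightarrow> (if i = 0 then reg t rP = 1 else reg t rP dvd n \<and> n - i < reg t rP \<and>
    (\<forall>q. n - i < q \<longrightarrow> q dvd n \<longrightarrow> q \<le> n \<longrightarrow> reg t rP \<le> q)) \<and> ok t" for i and t :: state
  have "I (n - 1) (ex prime_com s)"
    unfolding prime_com_def
  proof (rule For_invariant[where I = I])
    show "I 0 (set_reg 34 0 s)" using assms by (simp add: I_def)
  next
    fix i and t :: state
    assume *: "i < n - 1" "I i t" "reg t 34 = i"
      "\<And>x. x \<notin> writes ?b1 \<Longrightarrow> x \<noteq> 34 \<Longrightarrow> reg t x = reg s x"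
    let ?q = "n - i" and ?p = "reg t rP"
    define u where "u = set_reg 36 0 (set_reg 35 ?q t)"
    have u: "reg u rN = n" "reg u 35 = ?q" "reg u 36 = 0" "reg u rP = ?p" "ok u"
      using *(2) *(4)[of rN] assms(1) by (simp_all add: u_def I_def)
    define v where "v = ex (For 37 rN ?b2) u"
    have "(reg v 36 = n * ?q \<and> reg v rP = (if \<exists>j\<in>{1..n}. j * ?q = n then ?q else ?p)) \<and> ok v"
      unfolding v_def
    proof (rule For_invariant[where I = "\<lambda>k v. (reg v 36 = k * ?q \<and>
        reg v rP = (if \<exists>j\<in>{1..k}. j * ?q = n then ?q else ?p)) \<and> ok v"])
      fix k and w :: state
      assume **: "k < n" "(reg w 36 = k * ?q \<and>
        reg w rP = (if \<exists>j\<in>{1..k}. j * ?q = n then ?q else ?p)) \<and> ok w"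
        "\<And>x. x \<notin> writes ?b2 \<Longrightarrow> x \<noteq> 37 \<Longrightarrow> reg w x = reg u x"
      have w: "reg w rN = n" "reg w 35 = ?q" using **(3)[of rN] **(3)[of 35] u by simp_all
      have "Suc k * ?q \<le> n * n" using **(1) by (intro mult_le_mono) auto
      also have "\<dots> \<le> M" using M_ge(2) by simp
      finally have m: "k * ?q + ?q \<le> M" by simp
      have ivl: "{1..Suc k} = insert (Suc k) {1..k}" by auto
      show "(reg (set_reg 37 (Suc k) (ex ?b2 w)) 36 = Suc k * ?q \<and>
          reg (set_reg 37 (Suc k) (ex ?b2 w)) rP =
            (if \<exists>j\<in>{1..Suc k}. j * ?q = n then ?q else ?p)) \<and> ok (set_reg 37 (Suc k) (ex ?b2 w))"
        unfolding ivl using **(2) w m by (simp add: add.commute)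
    qed (use u in auto)
    moreover have "(\<exists>j\<in>{1..n}. j * ?q = n) \<longleftrightarrow> ?q dvd n"
    proof
      assume "?q dvd n"
      then obtain j where j: "n = ?q * j" by (rule dvdE)
      have "j \<noteq> 0" using j n_pos by (metis less_irrefl mult_0_right)
      moreover have "j \<le> n" using j n_pos by (metis dvd_imp_le dvd_triv_right)
      ultimately show "\<exists>j\<in>{1..n}. j * ?q = n" using j by (intro bexI[of _ j]) (auto simp: mult.commute)
    qed (metis dvd_triv_right)
    ultimately have v: "reg v rP = (if ?q dvd n then ?q else ?p)" "ok v" by simp_all
    have e: "ex ?b1 t = v" using *(3) *(4)[of rN] assms(1) by (simp add: v_def u_def)
    have q: "n - Suc i < q \<longleftrightarrow> q = ?q \<or> n - i < q" for q using *(1) by auto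
    show "I (Suc i) (set_reg 34 (Suc i) (ex ?b1 t))"
    proof (cases "i = 0")
      case True
      then show ?thesis unfolding e I_def using v *(1) by (auto simp: dvd_imp_le)
    next
      case False
      then have "?p dvd n" "n - i < ?p" "\<And>q. n - i < q \<Longrightarrow> q dvd n \<Longrightarrow> q \<le> n \<Longrightarrow> ?p \<le> q"
        using *(2) by (auto simp: I_def)
      then show ?thesis unfolding e I_def using v by (auto simp: q)
    qed
  qed (use assms in auto)
  then have I: "I (n - 1) (ex prime_com s)" .
  then show "ok (ex prime_com s)" by (simp add: I_def)
  let ?p = "reg (ex prime_com s) rP"
  show "1 \<le> ?p" using I by (auto simp: I_def split: if_splits)
  show "?p \<le> n" using I n_pos by (auto simp: I_def dvd_imp_le split: if_splits)
  show "?p = smallest_prime_divisor n" if "2 \<le> n"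
    using I that by (intro least_divisor_eq_smallest_prime_divisor) (auto simp: I_def)
qed

text \<open>The lower bound on the power makes the collision test correct; the last claim, that
  \<open>c\<close> is not too large, serves the running time. \<open>c \<le> n + 1\<close> bounds
  loop limits and intermediate values.\<close>

lemma half_com_correct:
  assumes "reg s rN = n" "1 \<le> reg s rP" "reg s rP \<le> n" "2 \<le> n \<Longrightarrow> 2 \<le> reg s rP" "ok s"
  shows "ok (ex half_com s)" "1 \<le> reg (ex half_com s) rC" "reg (ex half_com s) rC \<le> n + 1"
    "n \<le> reg s rP ^ (2 * (reg (ex half_com s) rC - 1))"
    "2 \<le> reg (ex half_com s) rC \<Longrightarrow> reg s rP ^ (2 * (reg (ex half_com s) rC - 2)) < n"
proof -
  let ?c = "SetC 36 0 ;; For 37 rP (Plus 36 36 rPow) ;;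
       SetC rPow 0 ;; For 37 rP (Plus rPow rPow 36) ;; Inc rC"
  let ?b = "Minus 35 rN rPow ;; IfNZ 35 (?c)"
  let ?p = "reg s rP" and ?s = "set_reg rPow 1 (set_reg rC 1 s)"
  define I where "I i t \<longleftrightarrow> (\<exists>e. reg t rC = Suc e \<and> reg t rPow = ?p ^ (2 * e) \<and> e \<le> i \<and>
    (1 \<le> e \<longrightarrow> ?p ^ (2 * (e - 1)) < n) \<and> (e = i \<or> n \<le> ?p ^ (2 * e)) \<and> ok t)" for i and t :: state
  have "I n (ex (For 34 rN ?b) ?s)"
  proof (rule For_invariant[where I = I])
    show "I 0 (set_reg 34 0 ?s)" using assms by (simp add: I_def)
  next
    fix i and t :: state
    assume *: "i < n" "I i t" "reg t 34 = i"
      "\<And>x. x \<notin> writes ?b \<Longrightarrow> x \<noteq> 34 \<Longrightarrow> reg t x = reg ?s x"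
    obtain e where e: "reg t rC = Suc e" "reg t rPow = ?p ^ (2 * e)" "e \<le> i"
      "1 \<le> e \<longrightarrow> ?p ^ (2 * (e - 1)) < n" "e = i \<or> n \<le> ?p ^ (2 * e)" "ok t"
      using *(2) unfolding I_def by blast
    have t: "reg t rN = n" "reg t rP = ?p" using *(4)[of rN] *(4)[of rP] assms(1) by simp_all
    show "I (Suc i) (set_reg 34 (Suc i) (ex ?b t))"
    proof (cases "n \<le> ?p ^ (2 * e)")
      case True
      then have "ex ?b t = set_reg 35 0 t" using t e by simp
      then show ?thesis unfolding I_def using e True by (intro exI[of _ e]) simp
    next
      case False
      let ?P = "?p ^ (2 * e)"
      have le: "?p * ?P \<le> n * n" "?p * (?p * ?P) \<le> n * (n * n)"
        using False assms(3) by (auto intro!: mult_le_mono)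
      have M: "n * n \<le> M" "n * (n * n) \<le> M"
        using M_ge(1,2) by (simp_all add: mult.assoc)
      define u where "u = set_reg 36 0 (set_reg 35 (n - ?P) t)"
      define v where "v = ex (For 37 rP (Plus 36 36 rPow)) u"
      have u: "reg u rP = ?p" "reg u 36 = 0" "reg u rPow = ?P" "ok u" "reg u rC = Suc e"
        using t e by (simp_all add: u_def)
      have v: "reg v 36 = ?p * ?P" "ok v" "reg v rP = ?p" "reg v rC = Suc e"
        unfolding v_def using add_loop[of 37 rP 36 rPow u M] u le M
        by (simp_all add: exec_frame_reg)
      define w where "w = ex (For 37 rP (Plus rPow rPow 36)) (set_reg rPow 0 v)"
      have w: "reg w rPow = ?p * (?p * ?P)" "ok w" "reg w rC = Suc e"
        unfolding w_def using add_loop[of 37 rP rPow 36 "set_reg rPow 0 v" M] v le M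
        by (simp_all add: exec_frame_reg)
      have ex: "ex ?b t = ex (Inc rC) w" using False t e by (simp add: u_def v_def w_def)
      have "Suc (Suc e) \<le> M" using e(3) *(1) M_ge(3) by simp
      then show ?thesis
        unfolding I_def ex using w e(3,5) False by (intro exI[of _ "Suc e"]) (auto simp: mult.assoc)
    qed
  qed (use assms in auto)
  moreover have "ex half_com s = ex (For 34 rN ?b) ?s" by (simp add: half_com_def)
  ultimately have "I n (ex half_com s)" by (simp only:)
  then obtain e where e: "reg (ex half_com s) rC = Suc e" "e \<le> n"
    "1 \<le> e \<longrightarrow> ?p ^ (2 * (e - 1)) < n" "e = n \<or> n \<le> ?p ^ (2 * e)" "ok (ex half_com s)"
    unfolding I_def by blast
  show "ok (ex half_com s)" "1 \<le> reg (ex half_com s) rC" "reg (ex half_com s) rC \<le> n + 1"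
    using e by simp_all
  show "n \<le> ?p ^ (2 * (reg (ex half_com s) rC - 1))"
  proof (cases "n \<le> ?p ^ (2 * e)")
    case False
    \<comment> \<open>All rounds were active. For \<open>n = 1\<close> this is impossible, since the
      power before the last round was already 1.\<close>
    then have "e = n" using e(4) by simp
    then have "n \<noteq> 1" using e(3) by auto
    then have "2 \<le> ?p" using n_pos assms(4) by simp
    have "n < 2 ^ n" by (rule less_exp)
    also have "(2::nat) ^ n \<le> ?p ^ n" using \<open>2 \<le> ?p\<close> by (rule power_mono) simp
    also have "\<dots> \<le> ?p ^ (2 * n)" using \<open>2 \<le> ?p\<close> by (intro power_increasing) auto
    finally show ?thesis using e(1) \<open>e = n\<close> by simp
  qed (use e in simp)
  show "2 \<le> reg (ex half_com s) rC \<Longrightarrow> ?p ^ (2 * (reg (ex half_com s) rC - 2)) < n"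
    using e by (simp add: numeral_2_eq_2)
qed

lemma tuples_com_correct:
  assumes "reg s rN = n" "reg s rC = c" "c \<le> n + 1" "ok s"
  shows "ok (ex tuples_com s)" "reg (ex tuples_com s) rTuples = n ^ c"
    "reg (ex tuples_com s) r2C = 2 * c" "reg (ex tuples_com s) rOff = 1" "reg (ex tuples_com s) rBase = 0"
proof -
  let ?b = "SetC 36 0 ;; For 37 rN (Plus 36 36 rTuples) ;; Copy rTuples 36"
  let ?s = "set_reg rTuples 1 s"
  have "reg (ex (For 34 rC ?b) ?s) rTuples = n ^ c \<and> ok (ex (For 34 rC ?b) ?s)"
  proof (rule For_invariant[where I = "\<lambda>i t. reg t rTuples = n ^ i \<and> ok t"])
    fix i and t :: state
    assume *: "i < c" "reg t rTuples = n ^ i \<and> ok t"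
      "\<And>x. x \<notin> writes ?b \<Longrightarrow> x \<noteq> 34 \<Longrightarrow> reg t x = reg ?s x"
    have t: "reg t rN = n" using *(3)[of rN] assms(1) by simp
    have "n * n ^ i \<le> (n + 1) ^ Suc i" by (simp add: mult_le_mono power_mono del: One_nat_def)
    also have "\<dots> \<le> M" using M_ge_power[of "Suc i"] *(1) assms(3) by simp
    finally show "reg (set_reg 34 (Suc i) (ex ?b t)) rTuples = n ^ Suc i \<and>
        ok (set_reg 34 (Suc i) (ex ?b t))"
      using add_loop[of 37 rN 36 rTuples "set_reg 36 0 t" M] t *(2) by simp
  qed (use assms in auto)
  moreover have "reg (ex (For 34 rC ?b) ?s) rC = c" using assms by (simp add: exec_frame_reg)
  moreover have "c + c \<le> M" using assms(3) M_ge(3) by simp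
  ultimately show "ok (ex tuples_com s)" "reg (ex tuples_com s) rTuples = n ^ c"
    "reg (ex tuples_com s) r2C = 2 * c" "reg (ex tuples_com s) rOff = 1" "reg (ex tuples_com s) rBase = 0"
    by (simp_all add: tuples_com_def)
qed

end

context table_program
begin

definition stored :: "nat \<Rightarrow> nat \<Rightarrow> nat \<Rightarrow> bool" where
  "stored c k a \<longleftrightarrow> (let L = closure_list f n (greedy_extend f n c (digits n c k)) in
     length L = n \<and> a = table_code f n L)"

lemma store_loop_correct:
  assumes "reg s rN = n" "reg s rOff = off" "reg s rC = c" "reg s r2C = 2 * c" "c \<le> n + 1"
    "reg s rTuples = N" "reg s rBase = 0" "\<And>i. arr s WRD i = 0" "\<And>a. arr s HSH a = 0" "ok s"
  shows "ok (ex (For 40 rTuples store_body) s)"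
    "arr (ex (For 40 rTuples store_body) s) HSH a = (if \<exists>k<N. stored c k a then 1 else 0)"
proof -
  define I where "I k t \<longleftrightarrow> (\<forall>i<c. arr t WRD i = k div n ^ i mod n) \<and>
    (\<forall>a. arr t HSH a = (if \<exists>j<k. stored c j a then 1 else 0)) \<and> ok t" for k and t :: state
  have cM: "2 * c \<le> M" using assms(5) M_ge(3) by simp
  have "I N (ex (For 40 rTuples store_body) s)"
  proof (rule For_invariant[where I = I])
    show "I 0 (set_reg 40 0 s)" using assms by (simp add: I_def)
  next
    fix k and t :: state
    assume *: "k < N" "I k t" "reg t 40 = k"
      "\<And>x. x \<notin> writes store_body \<Longrightarrow> x \<noteq> 40 \<Longrightarrow> reg t x = reg s x"
    let ?w = "digits n c k"
    let ?v = "greedy_extend f n c ?w"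
    let ?L = "closure_list f n ?v"
    define t1 where "t1 = set_reg rLen c t"
    have t: "reg t rN = n" "reg t rOff = off" "reg t rC = c" "reg t r2C = 2 * c" "reg t rBase = 0"
      using *(4)[of rN] *(4)[of rOff] *(4)[of rC] *(4)[of r2C] *(4)[of rBase] assms by simp_all
    have t1: "reg t1 rN = n" "reg t1 rOff = off" "holds_word t1 ?w" "set ?w \<subseteq> {..<n}" "reg t1 rC = c"
      "length ?w + c \<le> reg t1 r2C" "ok t1" "length ?w + c \<le> M"
      using t *(2) cM n_pos by (simp_all add: t1_def holds_word_def digits_bounds digits_nth I_def)
    define t2 where "t2 = ex extends_com t1"
    note e = extends_com_correct[OF t1, folded t2_def]
    note eb = greedy_extend_bounds[OF n_pos t1(4), of f c]
    have t2: "reg t2 rN = n" "reg t2 rOff = off" "length ?v \<le> reg t2 r2C"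
      "reg t2 rC = c" "reg t2 rBase = 0" "arr t2 HSH = arr t HSH"
      using t eb by (simp_all add: t2_def t1_def exec_frame_reg exec_frame_arr digits_bounds)
    have w2: "arr t2 WRD i = k div n ^ i mod n" if "i < c" for i
      using e(3)[of i] that *(2) by (simp add: digits_bounds t1_def I_def)
    define t3 where "t3 = ex build_com t2"
    have "set ?v \<subseteq> {..<n}" using eb by simp
    note b = build_com_correct[OF t2(1,2) e(1) this t2(3) e(2), folded t3_def]
    have t3: "reg t3 rN = n" "reg t3 rOff = off" "reg t3 rC = c" "reg t3 rBase = 0"
      "arr t3 HSH = arr t HSH" "arr t3 WRD = arr t2 WRD"
      using t2 by (simp_all add: t3_def exec_frame_reg exec_frame_arr)
    define t4 where "t4 = ex (Equal 32 rCnt rN ;; IfNZ 32 (code_com ;; SetC 16 1 ;; Put HSH rCode 16)) t3"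
    have t4: "reg t4 rN = n" "reg t4 rC = c" "reg t4 rBase = 0" "arr t4 WRD = arr t2 WRD"
      using t3 by (simp_all add: t4_def exec_frame_reg exec_frame_arr)
    have "(arr t4 HSH a = (if \<exists>j<Suc k. stored c j a then 1 else 0)) \<and> ok t4" for a
    proof (cases "length ?L = n")
      case False
      then have "t4 = set_reg 32 0 t3" using b(1) t3(1) by (simp add: t4_def repr_def)
      moreover have "(\<exists>j<Suc k. stored c j a) \<longleftrightarrow> (\<exists>j<k. stored c j a)"
        using False by (auto simp: stored_def Let_def less_Suc_eq)
      ultimately show ?thesis using t3(5) b(2) *(2) by (simp add: I_def)
    next
      case True
      let ?u = "set_reg 32 1 t3"
      have "reg ?u rN = n" "reg ?u rOff = off" "repr ?u ?L" "ok ?u"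
        using t3 b by (simp_all add: repr_def)
      note code = code_com_correct[OF this(1-3) True this(4)]
      have "t4 = ex (SetC 16 1 ;; Put HSH rCode 16) (ex code_com ?u)"
        using True b(1) t3(1) by (simp add: t4_def repr_def)
      moreover have "arr (ex code_com ?u) HSH = arr t HSH" using t3 by (simp add: exec_frame_arr)
      moreover have "(\<exists>j<Suc k. stored c j a) \<longleftrightarrow> a = table_code f n ?L \<or> (\<exists>j<k. stored c j a)"
        using True by (auto simp: stored_def Let_def less_Suc_eq)
      ultimately show ?thesis using code *(2) by (simp add: I_def)
    qed
    then have h4: "\<And>a. arr t4 HSH a = (if \<exists>j<Suc k. stored c j a then 1 else 0)" "ok t4" by auto
    have w4: "arr t4 WRD (0 + i) = k div n ^ i mod n" if "i < c" for i
      using w2[OF that] t4(4) by simp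
    have "0 + c \<le> M" using cM by simp
    note od = odometer_com_correct[OF t4(1-3) this h4(2) w4]
    have "ex store_body t = ex odometer_com t4"
      using t by (simp add: store_body_def t1_def t2_def t3_def t4_def)
    then show "I (Suc k) (set_reg 40 (Suc k) (ex store_body t))"
      unfolding I_def using od(1,3) h4(1) by (simp add: exec_frame_arr)
  qed (use assms in auto)
  then show "ok (ex (For 40 rTuples store_body) s)"
    "arr (ex (For 40 rTuples store_body) s) HSH a = (if \<exists>k<N. stored c k a then 1 else 0)"
    unfolding I_def by blast+
qed

lemma prefix_com_correct:
  assumes "reg s rN = n" "reg s rOff = 1" "reg s rC = c" "reg s r2C = 2 * c" "c \<le> n + 1"
    "off = n * n + 1" "ok s"
  shows "ok (ex prefix_com s)" "reg (ex prefix_com s) rOff = off" "reg (ex prefix_com s) rBase = c"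
    "reg (ex prefix_com s) rLen = 2 * c"
    "\<And>i. i < c \<Longrightarrow> arr (ex prefix_com s) WRD i = greedy_extend f n c [] ! i"
    "\<And>i. i < c \<Longrightarrow> arr (ex prefix_com s) WRD (c + i) = 0"
proof -
  have cM: "2 * c \<le> M" using assms(5) M_ge(3) by simp
  define s1 where "s1 = ex (For 34 rN (Plus rOff rOff rN)) s"
  have "1 + n * n \<le> M" using M_ge(2) by simp
  then have s1: "reg s1 rOff = off" "ok s1"
    unfolding s1_def using add_loop[of 34 rN rOff rN s M] assms by simp_all
  define s2 where "s2 = set_reg rLen 0 s1"
  have s2: "reg s2 rN = n" "reg s2 rOff = off" "holds_word s2 []" "set ([] :: nat list) \<subseteq> {..<n}" "reg s2 rC = c"
    "length ([] :: nat list) + c \<le> reg s2 r2C" "ok s2" "length ([] :: nat list) + c \<le> M"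
    using s1 assms cM by (simp_all add: s2_def s1_def holds_word_def exec_frame_reg)
  define s3 where "s3 = set_reg 16 0 (ex extends_com s2)"
  note e = extends_com_correct(1,2)[OF s2]
  have len: "length (greedy_extend f n c []) = c" using greedy_extend_bounds[OF n_pos s2(4), of f c] by simp
  have s3: "reg s3 rOff = off" "reg s3 rC = c" "ok s3" "reg s3 16 = 0" "reg s3 r2C = 2 * c"
    "\<And>i. i < c \<Longrightarrow> arr s3 WRD i = greedy_extend f n c [] ! i"
    using e s1 assms len by (simp_all add: s3_def s2_def s1_def exec_frame_reg holds_word_def)
  let ?b = "Plus 29 rC 34 ;; Put WRD 29 16"
  define s4 where "s4 = ex (For 34 rC ?b) s3"
  have s4: "(\<forall>i<c. arr s4 WRD i = greedy_extend f n c [] ! i) \<and> (\<forall>i<c. arr s4 WRD (c + i) = 0) \<and> ok s4"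
    unfolding s4_def
  proof (rule For_invariant[where I = "\<lambda>k t. (\<forall>i<c. arr t WRD i = greedy_extend f n c [] ! i) \<and>
      (\<forall>i<k. arr t WRD (c + i) = 0) \<and> ok t"])
    fix k and t :: state
    assume *: "k < c" "(\<forall>i<c. arr t WRD i = greedy_extend f n c [] ! i) \<and>
      (\<forall>i<k. arr t WRD (c + i) = 0) \<and> ok t" "reg t 34 = k"
      "\<And>x. x \<notin> writes ?b \<Longrightarrow> x \<noteq> 34 \<Longrightarrow> reg t x = reg s3 x"
    have "reg t rC = c" "reg t 16 = 0" using *(4)[of rC] *(4)[of 16] s3 by simp_all
    then show "(\<forall>i<c. arr (set_reg 34 (Suc k) (ex ?b t)) WRD i = greedy_extend f n c [] ! i) \<and>
      (\<forall>i<Suc k. arr (set_reg 34 (Suc k) (ex ?b t)) WRD (c + i) = 0) \<and>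
      ok (set_reg 34 (Suc k) (ex ?b t))"
      using *(1-3) cM by (auto simp: less_Suc_eq)
  qed (use s3 in auto)
  have s4': "reg s4 rOff = off" "reg s4 rC = c" "reg s4 r2C = 2 * c"
    using s3 by (simp_all add: s4_def exec_frame_reg)
  have "ex prefix_com s = ex (Copy rBase rC ;; Copy rLen r2C) s4"
    by (simp add: prefix_com_def s1_def s2_def s3_def s4_def)
  then show "ok (ex prefix_com s)" "reg (ex prefix_com s) rOff = off" "reg (ex prefix_com s) rBase = c"
    "reg (ex prefix_com s) rLen = 2 * c"
    "\<And>i. i < c \<Longrightarrow> arr (ex prefix_com s) WRD i = greedy_extend f n c [] ! i"
    "\<And>i. i < c \<Longrightarrow> arr (ex prefix_com s) WRD (c + i) = 0"
    using s4 s4' by simp_all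
qed

text \<open>\<open>A\<close> stands for the contents of the code table, which is filled under the
  instance of the locale for the other group.\<close>

definition hit :: "(nat \<Rightarrow> bool) \<Rightarrow> nat \<Rightarrow> nat \<Rightarrow> bool" where
  "hit A c k \<longleftrightarrow> (let L = closure_list f n (greedy_extend f n c [] @ digits n c k) in
     length L = n \<and> A (table_code f n L))"

lemma lookup_loop_correct:
  assumes "reg s rN = n" "reg s rOff = off" "reg s rC = c" "reg s r2C = 2 * c" "c \<le> n + 1"
    "reg s rTuples = N" "reg s rBase = c" "reg s rLen = 2 * c" "reg s rRes = 0"
    "\<And>i. i < c \<Longrightarrow> arr s WRD i = greedy_extend f n c [] ! i"
    "\<And>i. i < c \<Longrightarrow> arr s WRD (c + i) = 0"
    "\<And>a. arr s HSH a = (if A a then 1 else 0)" "ok s"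
  shows "ok (ex (For 40 rTuples lookup_body) s)"
    "reg (ex (For 40 rTuples lookup_body) s) rRes = (if \<exists>k<N. hit A c k then 1 else 0)"
proof -
  let ?t = "greedy_extend f n c []"
  define I where "I k t \<longleftrightarrow> (\<forall>i<c. arr t WRD i = ?t ! i) \<and> (\<forall>i<c. arr t WRD (c + i) = k div n ^ i mod n) \<and>
    reg t rRes = (if \<exists>j<k. hit A c j then 1 else 0) \<and> ok t" for k and t :: state
  have cM: "2 * c \<le> M" using assms(5) M_ge(3) by simp
  have len: "length ?t = c" "set ?t \<subseteq> {..<n}" using greedy_extend_bounds[OF n_pos, of "[]" f c] by simp_all
  have "I N (ex (For 40 rTuples lookup_body) s)"
  proof (rule For_invariant[where I = I])
    show "I 0 (set_reg 40 0 s)" using assms by (simp add: I_def)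
  next
    fix k and t :: state
    assume *: "k < N" "I k t" "reg t 40 = k"
      "\<And>x. x \<notin> writes lookup_body \<Longrightarrow> x \<noteq> 40 \<Longrightarrow> reg t x = reg s x"
      "\<And>a. a \<notin> array_writes lookup_body \<Longrightarrow> arr t a = arr s a"
    let ?v = "?t @ digits n c k"
    let ?L = "closure_list f n ?v"
    have t: "reg t rN = n" "reg t rOff = off" "reg t rC = c" "reg t r2C = 2 * c" "reg t rBase = c"
      "reg t rLen = 2 * c" "arr t HSH = arr s HSH"
      using *(4)[of rN] *(4)[of rOff] *(4)[of rC] *(4)[of r2C] *(4)[of rBase] *(4)[of rLen]
        *(5)[of HSH] assms by simp_all
    have "arr t WRD i = ?v ! i" if "i < 2 * c" for i
    proof (cases "i < c")
      case True
      then show ?thesis using *(2) len by (simp add: I_def nth_append)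
    next
      case False
      define j where "j = i - c"
      have "i = c + j" "j < c" using False \<open>i < 2 * c\<close> by (simp_all add: j_def)
      then show ?thesis using *(2) len by (simp add: I_def nth_append digits_nth)
    qed
    then have w: "holds_word t ?v" using t(6) len by (simp add: holds_word_def digits_bounds)
    have v: "set ?v \<subseteq> {..<n}" "length ?v \<le> reg t r2C"
      using len t(4) digits_bounds(1)[OF n_pos, of c k] by (auto simp: digits_bounds)
    define t3 where "t3 = ex build_com t"
    have "ok t" using *(2) by (simp add: I_def)
    note b = build_com_correct[OF t(1,2) w v this, folded t3_def]
    have t3: "reg t3 rN = n" "reg t3 rOff = off" "reg t3 rC = c" "reg t3 rBase = c"
      "arr t3 HSH = arr s HSH" "arr t3 WRD = arr t WRD" "reg t3 rRes = reg t rRes"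
      using t by (simp_all add: t3_def exec_frame_reg exec_frame_arr)
    define t4 where "t4 = ex (Equal 32 rCnt rN ;;
      IfNZ 32 (code_com ;; Get 15 HSH rCode ;; IfNZ 15 (SetC rRes 1))) t3"
    have t4: "reg t4 rN = n" "reg t4 rC = c" "reg t4 rBase = c" "arr t4 WRD = arr t WRD"
      using t3 by (simp_all add: t4_def exec_frame_reg exec_frame_arr)
    have h4: "reg t4 rRes = (if \<exists>j<Suc k. hit A c j then 1 else 0) \<and> ok t4"
    proof (cases "length ?L = n")
      case False
      then have "t4 = set_reg 32 0 t3" using b(1) t3(1) by (simp add: t4_def repr_def)
      moreover have "(\<exists>j<Suc k. hit A c j) \<longleftrightarrow> (\<exists>j<k. hit A c j)"
        using False by (auto simp: hit_def Let_def less_Suc_eq)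
      ultimately show ?thesis using t3(7) b(2) *(2) by (simp add: I_def)
    next
      case True
      let ?u = "set_reg 32 1 t3"
      have "reg ?u rN = n" "reg ?u rOff = off" "repr ?u ?L" "ok ?u"
        using t3 b by (simp_all add: repr_def)
      note code = code_com_correct[OF this(1-3) True this(4)]
      have "t4 = ex (Get 15 HSH rCode ;; IfNZ 15 (SetC rRes 1)) (ex code_com ?u)"
        using True b(1) t3(1) by (simp add: t4_def repr_def)
      moreover have "arr (ex code_com ?u) HSH = arr s HSH" "reg (ex code_com ?u) rRes = reg t rRes"
        using t3 by (simp_all add: exec_frame_arr exec_frame_reg)
      moreover have "(\<exists>j<Suc k. hit A c j) \<longleftrightarrow> A (table_code f n ?L) \<or> (\<exists>j<k. hit A c j)"
        using True by (auto simp: hit_def Let_def less_Suc_eq)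
      ultimately show ?thesis using code *(2) assms(12) by (simp add: I_def)
    qed
    have w4: "arr t4 WRD (c + i) = k div n ^ i mod n" if "i < c" for i
      using that *(2) t4(4) by (simp add: I_def)
    have "c + c \<le> M" using cM by simp
    note od = odometer_com_correct[OF t4(1-3) this conjunct2[OF h4] w4]
    have "ex lookup_body t = ex odometer_com t4"
      by (simp add: lookup_body_def t3_def t4_def)
    then show "I (Suc k) (set_reg 40 (Suc k) (ex lookup_body t))"
      unfolding I_def using od h4 *(2) t4(4) by (simp add: exec_frame_reg I_def)
  qed (use assms in auto)
  then show "ok (ex (For 40 rTuples lookup_body) s)"
    "reg (ex (For 40 rTuples lookup_body) s) rRes = (if \<exists>k<N. hit A c k then 1 else 0)"
    unfolding I_def by blast+
qed

end


section \<open>Step count and running time\<close>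

lemma limits_coms [simp]:
  "limits read_com = {}"
  "limits prime_com = {1, 33}"
  "limits half_com = {1, 6}"
  "limits tuples_com = {1, 3}"
  "limits store_body = {1, 3, 22}"
  "limits prefix_com = {1, 3, 22}"
  "limits lookup_body = {1, 3, 22}"
  by (auto simp: read_com_def prime_com_def half_com_def tuples_com_def store_body_def
      prefix_com_def lookup_body_def mul_com_def insert_com_def build_com_def extend_com_def
      extends_com_def code_com_def odometer_com_def)

lemma wf_main_com: "wf_com main_com"
  by (simp add: main_com_def read_com_def prime_com_def half_com_def tuples_com_def store_body_def
      prefix_com_def lookup_body_def mul_com_def insert_com_def build_com_def extend_com_def
      extends_com_def code_com_def odometer_com_def)

text \<open>A shape shared by all phases, so that their bounds add up to one multiple of
  \<open>B ^ D * N\<close>.\<close>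

lemma steps_le_scaled:
  assumes "1 \<le> B" "limits c \<inter> writes c = {}" "\<And>l. l \<in> limits c \<Longrightarrow> reg s l \<le> B"
    "depth c \<le> D" "1 \<le> N"
  shows "steps xs M c s \<le> coeff c * (B ^ D * N)"
proof -
  have "steps xs M c s \<le> coeff c * B ^ depth c" using assms(1-3) by (rule steps_le)
  also have "\<dots> \<le> coeff c * (B ^ D * N)"
  proof (rule mult_le_mono2)
    have "B ^ depth c * 1 \<le> B ^ D * N"
      using assms(1,4,5) by (intro mult_le_mono power_increasing) auto
    then show "B ^ depth c \<le> B ^ D * N" by simp
  qed
  finally show ?thesis .
qed

text \<open>The outer loops run through all words, a number far above \<open>B\<close>. Treating
  them separately lets this number enter only to the first power.\<close>

lemma steps_For_le_scaled:
  assumes "1 \<le> B" "limits c \<inter> writes c = {}" "r \<notin> limits c" "\<And>l. l \<in> limits c \<Longrightarrow> reg s l \<le> B"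
    "depth c \<le> D" "reg s l = N" "1 \<le> N"
  shows "steps xs M (For r l c) s \<le> coeff (For r l c) * (B ^ D * N)"
proof -
  have "steps xs M c (iter xs M r c s i) \<le> coeff c * B ^ D" for i
  proof -
    have "reg (iter xs M r c s i) l \<le> B" if "l \<in> limits c" for l
    proof -
      have "l \<notin> writes c" "l \<noteq> r" using that assms(2,3) by auto
      then show ?thesis using assms(4)[OF that] by (simp add: iter_frame_reg)
    qed
    from steps_le_scaled[OF assms(1,2) this assms(5), where N = 1] show ?thesis by simp
  qed
  then have "(\<Sum>i<N. 5 + steps xs M c (iter xs M r c s i)) \<le> (\<Sum>i<N. 5 + coeff c * B ^ D)"
    by (intro sum_mono) simp
  then have "steps xs M (For r l c) s \<le> 5 + N * (5 + coeff c * B ^ D)"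
    using assms(6) by simp
  also have "\<dots> \<le> 10 * (B ^ D * N) + coeff c * (B ^ D * N)"
  proof -
    have "1 * N \<le> B ^ D * N" using assms(1) by (intro mult_le_mono1) simp
    then have "5 + 5 * N \<le> 10 * (B ^ D * N)" using assms(7) by linarith
    then show ?thesis by (simp add: algebra_simps)
  qed
  finally show ?thesis by (simp add: algebra_simps)
qed

lemma mult_table_nth:
  assumes "a < n" "b < n"
  shows "a * n + b < n * n" "mult_table n G ! (a * n + b) = a \<otimes>\<^bsub>G\<^esub> b"
proof -
  have "a * n + b < Suc a * n" using assms(2) by simp
  also have "\<dots> \<le> n * n" using assms(1) by (intro mult_le_mono1) simp
  finally show *: "a * n + b < n * n" .
  show "mult_table n G ! (a * n + b) = a \<otimes>\<^bsub>G\<^esub> b"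
    using * assms by (simp add: mult_table_def product_nth)
qed

lemma length_mult_table [simp]: "length (mult_table n G) = n * n"
  by (simp add: mult_table_def)

lemma main_com_correct:
  assumes G: "table_group n G" and H: "table_group n H"
    and xs: "xs = n # mult_table n G @ mult_table n H"
    and M: "8 * (n + 1) ^ (n * n + n + 3) \<le> M"
  shows "ok (exec xs M main_com init_state) \<and>
    reg (exec xs M main_com init_state) rRes = (if G \<cong> H then 1 else 0) \<and>
    (\<exists>c. steps xs M main_com init_state \<le> coeff main_com * ((2 * n + 2) ^ depth main_com * n ^ c) \<and>
      (2 \<le> n \<longrightarrow> 2 \<le> c \<longrightarrow> smallest_prime_divisor n ^ (2 * (c - 2)) < n))"
proof -
  interpret G: table_group n G by fact
  interpret H: table_group n H by fact
  interpret program xs M n using G.n_pos M by unfold_locales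
  interpret PG: table_program xs M n 1 "mult G"
  proof
    fix a b assume ab: "a < n" "b < n"
    show "input_at xs (1 + b + a * n) = a \<otimes>\<^bsub>G\<^esub> b"
      using mult_table_nth(1)[OF ab] mult_table_nth(2)[OF ab, of G] by (simp add: input_at_def xs nth_append add.commute)
  qed (auto simp: G.f_lt)
  interpret PH: table_program xs M n "n * n + 1" "mult H"
  proof
    fix a b assume ab: "a < n" "b < n"
    show "input_at xs (n * n + 1 + b + a * n) = a \<otimes>\<^bsub>H\<^esub> b"
      using mult_table_nth(1)[OF ab] mult_table_nth(2)[OF ab, of H] by (simp add: input_at_def xs nth_append add.commute)
  qed (auto simp: H.f_lt)
  have x0: "input_at xs 0 = n" by (simp add: input_at_def xs)
  define s1 where "s1 = exec xs M read_com init_state"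
  define s2 where "s2 = exec xs M prime_com s1"
  define s3 where "s3 = exec xs M half_com s2"
  define s4 where "s4 = exec xs M tuples_com s3"
  define s5 where "s5 = exec xs M (For 40 rTuples store_body) s4"
  define s6 where "s6 = exec xs M prefix_com s5"
  define s7 where "s7 = exec xs M (For 40 rTuples lookup_body) s6"
  have main: "exec xs M main_com init_state = s7"
    by (simp add: main_com_def s1_def s2_def s3_def s4_def s5_def s6_def s7_def)
  have s1: "reg s1 rN = n" "reg s1 33 = n - 1" "reg s1 rP = 1" "ok s1"
    by (simp_all add: s1_def read_com_def init_state_def x0)
  note p = prime_com_correct[OF s1, folded s2_def]
  have s2: "reg s2 rN = n" using s1 by (simp add: s2_def exec_frame_reg)
  have p2: "2 \<le> reg s2 rP" if "2 \<le> n"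
  proof -
    have "\<exists>p. prime p \<and> p dvd n" using that prime_factor_nat[of n] by auto
    then have "prime (smallest_prime_divisor n)"
      unfolding smallest_prime_divisor_def by (rule LeastI2_ex) simp
    then show ?thesis using p(4)[OF that] prime_ge_2_nat by simp
  qed
  note h = half_com_correct[OF s2 p(2,3) p2 p(1), folded s3_def]
  define c where "c = reg s3 rC"
  have c: "1 \<le> c" "c \<le> n + 1" "n \<le> reg s2 rP ^ (2 * (c - 1))"
    "2 \<le> c \<Longrightarrow> reg s2 rP ^ (2 * (c - 2)) < n"
    using h(2-5) by (simp_all add: c_def)
  have n1: "n = 1" if "\<not> 2 \<le> n" using that n_pos by simp
  \<comment> \<open>For \<open>n = 1\<close> the computed value 1 need not be
    \<open>smallest_prime_divisor 1\<close>, which is unspecified; but then \<open>c = 1\<close> and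
    the exponent vanishes.\<close>
  have c3: "n \<le> smallest_prime_divisor n ^ (2 * (c - 1))"
  proof (cases "2 \<le> n")
    case True
    then show ?thesis using c(3) p(4) by simp
  next
    case False
    then have "n = 1" by (rule n1)
    then have "reg s2 rP = 1" using p(2,3) by simp
    then have "c = 1" using c(1,4) \<open>n = 1\<close> by (cases "2 \<le> c") auto
    then show ?thesis using \<open>n = 1\<close> by simp
  qed
  have s3: "reg s3 rN = n" "reg s3 rC = c" using s2 by (simp_all add: s3_def c_def exec_frame_reg)
  note t = tuples_com_correct[OF s3 c(2) h(1), folded s4_def]
  have s4: "reg s4 rN = n" "reg s4 rC = c" "arr s4 = (\<lambda>_ _. 0)" "reg s4 rRes = 0"
    using s3 by (simp_all add: s4_def s3_def s2_def s1_def exec_frame_reg exec_frame_arr fun_eq_iff init_state_def)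
  have "\<And>i. arr s4 WRD i = 0" "\<And>a. arr s4 HSH a = 0" using s4 by simp_all
  note g = PG.store_loop_correct[OF s4(1) t(4) s4(2) t(3) c(2) t(2,5) this t(1), folded s5_def]
  have s5: "reg s5 rN = n" "reg s5 rC = c" "reg s5 r2C = 2 * c" "reg s5 rOff = 1" "reg s5 rRes = 0"
    "reg s5 rTuples = n ^ c"
    using s4 t by (simp_all add: s5_def exec_frame_reg)
  note x = PH.prefix_com_correct[OF s5(1,4,2,3) c(2) refl g(1), folded s6_def]
  have s6: "reg s6 rN = n" "reg s6 rC = c" "reg s6 r2C = 2 * c" "reg s6 rRes = 0"
    "reg s6 rTuples = n ^ c" "arr s6 HSH = arr s5 HSH"
    using s5 by (simp_all add: s6_def exec_frame_reg exec_frame_arr)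
  let ?A = "\<lambda>a. \<exists>k<n ^ c. PG.stored c k a"
  have "\<And>a. arr s6 HSH a = (if ?A a then 1 else 0)" using s6(6) g(2) by simp
  note l = PH.lookup_loop_correct[OF s6(1) x(2) s6(2,3) c(2) s6(5) x(3,4) s6(4) x(5,6) this x(1),
      folded s7_def]
  have iff: "(\<exists>k<n ^ c. PH.hit ?A c k) \<longleftrightarrow> G \<cong> H"
  proof -
    have "(\<exists>k<n ^ c. PH.hit ?A c k) \<longleftrightarrow> (\<exists>s u. length s = c \<and> set s \<subseteq> {..<n} \<and> length u = c \<and>
      set u \<subseteq> {..<n} \<and>
      length (closure_list (mult G) n (greedy_extend (mult G) n c s)) = n \<and>
      length (closure_list (mult H) n (greedy_extend (mult H) n c [] @ u)) = n \<and>
      table_code (mult G) n (closure_list (mult G) n (greedy_extend (mult G) n c s)) =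
      table_code (mult H) n (closure_list (mult H) n (greedy_extend (mult H) n c [] @ u)))" (is "?l \<longleftrightarrow> ?r")
    proof
      assume ?l
      then obtain k j where "PG.stored c j (table_code (mult H) n
          (closure_list (mult H) n (greedy_extend (mult H) n c [] @ digits n c k)))"
        "length (closure_list (mult H) n (greedy_extend (mult H) n c [] @ digits n c k)) = n"
        by (auto simp: PH.hit_def Let_def)
      then show ?r
        using digits_bounds(1)[OF n_pos, of c j] digits_bounds(1)[OF n_pos, of c k]
        by (intro exI[of _ "digits n c j"] exI[of _ "digits n c k"])
          (simp add: PG.stored_def Let_def digits_bounds(2))
    next
      assume ?r
      then obtain s u where su: "length s = c" "set s \<subseteq> {..<n}" "length u = c" "set u \<subseteq> {..<n}"
        "length (closure_list (mult G) n (greedy_extend (mult G) n c s)) = n"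
        "length (closure_list (mult H) n (greedy_extend (mult H) n c [] @ u)) = n"
        "table_code (mult G) n (closure_list (mult G) n (greedy_extend (mult G) n c s)) =
         table_code (mult H) n (closure_list (mult H) n (greedy_extend (mult H) n c [] @ u))"
        by blast
      obtain j where j: "j < n ^ c" "digits n c j = s" using digits_surj[OF su(2)] su(1) by auto
      obtain k where k: "k < n ^ c" "digits n c k = u" using digits_surj[OF su(4)] su(3) by auto
      have "PG.stored c j (table_code (mult H) n (closure_list (mult H) n (greedy_extend (mult H) n c [] @ u)))"
        using su j by (simp add: PG.stored_def Let_def)
      then have "PH.hit ?A c k" using su k j by (auto simp: PH.hit_def Let_def)
      then show ?l using k(1) by blast
    qed
    then show ?thesis using iso_iff_collision[OF G H c(1) c3] by simp
  qed
  have res: "reg s7 rRes = (if G \<cong> H then 1 else 0)" using l(2) unfolding iff .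
  \<comment> \<open>The largest limit other than the number of words is \<open>2 * c\<close>, and
    \<open>c \<le> n + 1\<close>.\<close>
  let ?B = "2 * n + 2" and ?D = "depth main_com" and ?N = "n ^ c"
  have N: "1 \<le> ?N" using n_pos by simp
  have B: "1 \<le> ?B" by simp
  have st: "steps xs M main_com init_state \<le> coeff main_com * (?B ^ ?D * ?N)"
  proof -
    have coeff_main: "coeff main_com = coeff read_com + (coeff prime_com + (coeff half_com +
        (coeff tuples_com + (coeff (For 40 rTuples store_body) + (coeff prefix_com +
        coeff (For 40 rTuples lookup_body))))))"
      by (simp only: main_com_def coeff.simps(10))
    have st1: "steps xs M read_com init_state \<le> coeff read_com * (?B ^ ?D * ?N)"
      by (rule steps_le_scaled[OF B _ _ _ N]) (simp_all add: main_com_def)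
    have st2: "steps xs M prime_com s1 \<le> coeff prime_com * (?B ^ ?D * ?N)"
      by (rule steps_le_scaled[OF B _ _ _ N]) (use s1 in \<open>auto simp: main_com_def le_max_iff_disj\<close>)
    have st3: "steps xs M half_com s2 \<le> coeff half_com * (?B ^ ?D * ?N)"
      by (rule steps_le_scaled[OF B _ _ _ N]) (use s2 p(3) in \<open>auto simp: main_com_def le_max_iff_disj\<close>)
    have st4: "steps xs M tuples_com s3 \<le> coeff tuples_com * (?B ^ ?D * ?N)"
      by (rule steps_le_scaled[OF B _ _ _ N]) (use s3 c(2) in \<open>auto simp: main_com_def le_max_iff_disj\<close>)
    have st5: "steps xs M (For 40 rTuples store_body) s4 \<le> coeff (For 40 rTuples store_body) * (?B ^ ?D * ?N)"
      by (rule steps_For_le_scaled[OF B _ _ _ _ t(2) N]) (use s4 t c(2) in \<open>auto simp: main_com_def le_max_iff_disj\<close>)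
    have st6: "steps xs M prefix_com s5 \<le> coeff prefix_com * (?B ^ ?D * ?N)"
      by (rule steps_le_scaled[OF B _ _ _ N]) (use s5 c(2) in \<open>auto simp: main_com_def le_max_iff_disj\<close>)
    have st7: "steps xs M (For 40 rTuples lookup_body) s6 \<le> coeff (For 40 rTuples lookup_body) * (?B ^ ?D * ?N)"
      by (rule steps_For_le_scaled[OF B _ _ _ _ s6(5) N]) (use s6 c(2) in \<open>auto simp: main_com_def le_max_iff_disj\<close>)
    have "steps xs M main_com init_state = steps xs M read_com init_state + (steps xs M prime_com s1 +
        (steps xs M half_com s2 + (steps xs M tuples_com s3 +
        (steps xs M (For 40 rTuples store_body) s4 + (steps xs M prefix_com s5 +
        steps xs M (For 40 rTuples lookup_body) s6)))))"
      by (simp only: main_com_def steps.simps(10) s1_def s2_def s3_def s4_def s5_def s6_def)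
    also have "\<dots> \<le> coeff main_com * (?B ^ ?D * ?N)"
      unfolding coeff_main add_mult_distrib by (intro add_mono st1 st2 st3 st4 st5 st6 st7)
    finally show ?thesis .
  qed
  have "2 \<le> n \<longrightarrow> 2 \<le> c \<longrightarrow> smallest_prime_divisor n ^ (2 * (c - 2)) < n"
    using c(4) p(4) by metis
  then show ?thesis unfolding main using l(1) res st by blast
qed

text \<open>The crude estimate \<open>n + 1 \<le> 2 ^ n\<close> already gives \<open>M\<close> a bit
  length of order \<open>n ^ 3\<close>; the exponent 12 is generous.\<close>

lemma width_bound:
  assumes "2 \<le> n"
  shows "width (64 + 8 * (n + 1) ^ (n * n + n + 3)) \<le> n ^ 12"
proof -
  let ?e = "n * (n * n + n + 3)"
  have "n + 1 \<le> 2 ^ n" using Suc_leI[OF less_exp] unfolding Suc_eq_plus1 .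
  then have "(n + 1) ^ (n * n + n + 3) \<le> (2 ^ n) ^ (n * n + n + 3)" by (rule power_mono) simp
  also have "\<dots> = 2 ^ ?e" by (simp add: power_mult)
  finally have le: "(n + 1) ^ (n * n + n + 3) \<le> 2 ^ ?e" .
  have one: "(1::nat) \<le> 2 ^ ?e" by simp
  have "4 * (64 + 8 * (n + 1) ^ (n * n + n + 3)) + 68 \<le> 512 * 2 ^ ?e"
  proof -
    have "4 * (64 + 8 * x) + 68 \<le> 512 * y" if "x \<le> y" "1 \<le> y" for x y :: nat
    proof -
      have "4 * (64 + 8 * x) + 68 = 32 * x + 324 * 1" by simp
      also have "\<dots> \<le> 32 * y + 324 * y" using that by (intro add_mono mult_le_mono2)
      also have "\<dots> \<le> 512 * y" by simp
      finally show ?thesis .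
    qed
    from this[OF le one] show ?thesis .
  qed
  also have "\<dots> = 2 ^ (?e + 9)" by (simp add: power_add)
  finally have "floor_log (4 * (64 + 8 * (n + 1) ^ (n * n + n + 3)) + 68) \<le> floor_log (2 ^ (?e + 9))"
    by (rule monoD[OF floor_log_mono])
  then have "bits (4 * (64 + 8 * (n + 1) ^ (n * n + n + 3)) + 68) \<le> ?e + 10"
    unfolding bits_def floor_log_power by simp
  then have "width (64 + 8 * (n + 1) ^ (n * n + n + 3)) \<le> 5 * (?e + 10)"
    by (simp add: width_def)
  also have "\<dots> \<le> n ^ 12"
  proof -
    have n: "1 \<le> n" using assms by simp
    have pw: "2 ^ k \<le> n ^ k" for k using assms by (simp add: power_mono)
    have m: "n ^ i \<le> n ^ j" if "i \<le> j" for i j using n that by (rule power_increasing[rotated])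
    have "5 * (?e + 10) = 5 * n ^ 3 + 5 * n ^ 2 + 15 * n + 50"
      by (simp add: power3_eq_cube power2_eq_square algebra_simps)
    also have "\<dots> \<le> 5 * n ^ 3 + 5 * n ^ 3 + 15 * n ^ 3 + 50 * n ^ 3"
      using m[of 2 3] m[of 1 3] m[of 0 3] by simp
    also have "\<dots> = 75 * n ^ 3" by simp
    \<comment> \<open>The constant 75 is below \<open>2 ^ 7\<close>.\<close>
    also have "\<dots> \<le> n ^ 7 * n ^ 3" using pw[of 7] by (intro mult_le_mono1) simp
    also have "\<dots> = n ^ 10" by (simp add: power_add[symmetric])
    also have "\<dots> \<le> n ^ 12" by (rule m) simp
    finally show ?thesis .
  qed
  finally show ?thesis .
qed

text \<open>Taking logarithms in the minimality property of \<open>c\<close>; for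
  \<open>c < 2\<close> it is enough that the logarithm is nonnegative.\<close>

lemma half_log_bound:
  assumes "2 \<le> n" "2 \<le> c \<longrightarrow> smallest_prime_divisor n ^ (2 * (c - 2)) < n"
  shows "real c \<le> 1 / 2 * log (real (smallest_prime_divisor n)) (real n) + 2"
proof -
  let ?p = "smallest_prime_divisor n"
  have "\<exists>p. prime p \<and> p dvd n" using assms(1) prime_factor_nat[of n] by auto
  then have "prime ?p" unfolding smallest_prime_divisor_def by (rule LeastI2_ex) simp
  then have p: "1 < real ?p" using prime_gt_1_nat by simp
  show ?thesis
  proof (cases "2 \<le> c")
    case False
    have "0 \<le> log (real ?p) (real n)" using p assms(1) by simp
    then show ?thesis using False by simp
  next
    case True
    then have "real ?p ^ (2 * (c - 2)) \<le> real n"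
      using assms(2) by (metis less_imp_le of_nat_le_iff of_nat_power)
    then have "log (real ?p) (real ?p ^ (2 * (c - 2))) \<le> log (real ?p) (real n)"
      using p by (intro log_mono) auto
    then have "real (2 * (c - 2)) \<le> log (real ?p) (real n)"
      using p by (simp add: log_nat_power)
    then show ?thesis using True by (simp add: of_nat_diff)
  qed
qed

text \<open>Once \<open>ln n > 1\<close>, which \<open>n \<ge> 4\<close> ensures,
  \<open>ln (ln n) \<le> ln n\<close> makes the quotient at least 1.\<close>

lemma const_bigo_ln_div_lnln: "(\<lambda>_. C) \<in> O(\<lambda>n :: nat. ln (real n) / ln (ln (real n)))" for C :: real
proof (rule bigoI)
  show "\<forall>\<^sub>F n in sequentially. norm C \<le> \<bar>C\<bar> * norm (ln (real n) / ln (ln (real n)))"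
    using eventually_ge_at_top[of 4]
  proof eventually_elim
    case (elim n)
    have "exp 1 < real n" using exp_le elim by linarith
    then have n: "1 < ln (real n)" by (metis exp_gt_zero ln_exp ln_less_cancel_iff less_trans)
    then have "0 < ln (ln (real n))" by simp
    moreover have "ln (ln (real n)) \<le> ln (real n)" using ln_le_minus_one[of "ln (real n)"] n by simp
    ultimately have "1 \<le> norm (ln (real n) / ln (ln (real n)))" using n by simp
    from mult_left_mono[OF this, of "\<bar>C\<bar>"] show ?case by simp
  qed
qed

theorem theorem1:
  shows "\<exists>(P :: ram) (f :: nat \<Rightarrow> real).
    f \<in> O(\<lambda>n. ln (real n) / ln (ln (real n))) \<and>
    (\<forall>(n :: nat) (G :: nat monoid) (H :: nat monoid).
       solvable_group_on n G \<longrightarrow> solvable_group_on n H \<longrightarrow>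
       (\<exists>T :: nat.
          computes_in_time P (n # mult_table n G @ mult_table n H) (if G \<cong> H then 1 else 0) T \<and>
          (n \<ge> 2 \<longrightarrow>
             real T \<le> real n powr
               (1 / 2 * log (real (smallest_prime_divisor n)) (real n) + f n))))"
proof -
  \<comment> \<open>Exponents of \<open>n\<close> that absorb the overhead for
    \<open>n \<ge> 2\<close>: \<open>coeff main_com\<close> for the constant factor,
    \<open>3 * depth main_com\<close> for the powers of \<open>2 * n + 2\<close>, 12 for the width,
    and 2 from \<open>half_log_bound\<close>.\<close>
  define K where "K = coeff main_com + 3 * depth main_com + 14"
  have "\<exists>T. computes_in_time (compile 0 main_com) (n # mult_table n G @ mult_table n H)
        (if G \<cong> H then 1 else 0) T \<and>
      (n \<ge> 2 \<longrightarrow> real T \<le> real n powr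
         (1 / 2 * log (real (smallest_prime_divisor n)) (real n) + real K))"
    if sG: "solvable_group_on n G" and sH: "solvable_group_on n H" for n and G H :: "nat monoid"
  proof -
    have G: "table_group n G" and H: "table_group n H"
      using sG sH by (auto simp: solvable_group_on_def table_group_def)
    interpret G: table_group n G by fact
    interpret H: table_group n H by fact
    let ?xs = "n # mult_table n G @ mult_table n H"
    \<comment> \<open>The summand 64 satisfies the compiler's requirement on \<open>M\<close>; the
      rest is what the program analysis needs.\<close>
    define M where "M = 64 + 8 * (n + 1) ^ (n * n + n + 3)"
    have "(n + 1) ^ 1 \<le> (n + 1) ^ (n * n + n + 3)" by (intro power_increasing) auto
    then have nM: "n \<le> M" by (simp add: M_def)
    have "x \<le> n" if "x \<in> set ?xs" for x
      using that G.f_lt H.f_lt by (auto simp: mult_table_def less_imp_le)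
    then have "input_at ?xs k \<le> n" for k by (simp add: input_at_def del: set_simps)
    then have inp: "input_at ?xs k \<le> M" for k using nM le_trans by blast
    have "8 * (n + 1) ^ (n * n + n + 3) \<le> M" by (simp add: M_def)
    from main_com_correct[OF G H refl this] obtain c where
      ok: "ok (exec ?xs M main_com init_state)"
      and res: "reg (exec ?xs M main_com init_state) 0 = (if G \<cong> H then 1 else 0)"
      and st: "steps ?xs M main_com init_state \<le> coeff main_com * ((2 * n + 2) ^ depth main_com * n ^ c)"
      and c: "2 \<le> n \<longrightarrow> 2 \<le> c \<longrightarrow> smallest_prime_divisor n ^ (2 * (c - 2)) < n"
      by auto
    obtain T where T: "computes_in_time (compile 0 main_com) ?xs (if G \<cong> H then 1 else 0) T"
      "T \<le> steps ?xs M main_com init_state * width M"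
      using compiled_computes[OF wf_main_com _ inp ok] unfolding res by (auto simp: M_def)
    have "real T \<le> real n powr (1 / 2 * log (real (smallest_prime_divisor n)) (real n) + real K)"
      if n: "2 \<le> n"
    proof -
      have "coeff main_com \<le> 2 ^ coeff main_com" using less_exp less_imp_le by blast
      also have "\<dots> \<le> n ^ coeff main_com" using n by (rule power_mono) simp
      finally have 1: "coeff main_com \<le> n ^ coeff main_com" .
      have "2 * n + 2 \<le> 2 * n + n" using n by simp
      also have "\<dots> = 3 * n" by simp
      also have "\<dots> \<le> (2 * 2) * n" by simp
      also have "\<dots> \<le> (n * n) * n" using n by (intro mult_le_mono) auto
      also have "\<dots> = n ^ 3" by (simp add: power3_eq_cube)
      finally have "(2 * n + 2) ^ depth main_com \<le> (n ^ 3) ^ depth main_com" by (rule power_mono) simp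
      then have 2: "(2 * n + 2) ^ depth main_com \<le> n ^ (3 * depth main_com)" by (simp add: power_mult)
      have "T \<le> coeff main_com * ((2 * n + 2) ^ depth main_com * n ^ c) * width M"
        using T(2) st mult_le_mono1 le_trans by blast
      also have "\<dots> \<le> n ^ coeff main_com * (n ^ (3 * depth main_com) * n ^ c) * n ^ 12"
        using 1 2 width_bound[OF n] unfolding M_def by (intro mult_le_mono) auto
      also have "\<dots> = n ^ (c + (K - 2))"
        by (simp add: K_def power_add[symmetric] ac_simps)
      finally have "real T \<le> real (n ^ (c + (K - 2)))" by (rule of_nat_mono)
      also have "\<dots> = real n powr (real c + (real K - 2))"
        using n by (simp add: powr_realpow[symmetric] of_nat_diff K_def)
      also have "\<dots> \<le> real n powr (1 / 2 * log (real (smallest_prime_divisor n)) (real n) + real K)"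
        using half_log_bound[OF n, of c] c n by (intro powr_mono) auto
      finally show ?thesis .
    qed
    then show ?thesis using T(1) by blast
  qed
  then show ?thesis using const_bigo_ln_div_lnln[of "real K"] by blast
qed

end
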